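(* Let $\Phi$ be a locally square-integrable invariant random measure on $\mathbb R^d$, and let $K$ be an invariant probability kernel from $\Omega\times\mathbb R^d$ to $\mathbb R^d$. Let $K^*(\omega,x,B):=K(\omega,x,B+x)$ and define $\kappa\colon\mathbb R^d\to[0,2]$ by $$\kappa(y):=\big\|\mathbb E^\Phi_{0,y}[K^*_y\otimes K^*_0]-\big(\mathbb E^\Phi_0[K^*_0]\big)^{\otimes2}\big\|,\quad y\in\mathbb R^d.$$ Assume that $\int\kappa(y)\,\alpha_\Phi(\mathrm dy)<\infty$. Let $W\in\mathcal K_0$. Then: (i) If $\Phi$ is hyperuniform with respect to $W$, then $K\Phi$ is hyperuniform with respect to $W$. (ii) If either $W$ is Fourier smooth or $\beta_\Phi$ has finite total variation, i.e. $|\beta_\Phi|(\mathbb R^d)<\infty$, then $$\lim_{r\to\infty}\lambda_d(rW)^{-1}\operatorname{Var}[\Phi(rW)]=\lim_{r\to\infty}\lambda_d(rW)^{-1}\operatorname{Var}[K\Phi(rW)],$$ provided one of these limits exists.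
   Context: $\lambda_d$ is Lebesgue measure and $\mathcal B^d$ the Borel $\sigma$-field on $\mathbb R^d$. $(\Omega,\mathcal A,\mathbb P)$ is a probability space, $(\Omega,\mathcal A)$ is a Borel space, and there is a measurable flow on $\Omega$: maps $\theta_x\colon\Omega\to\Omega$, $x\in\mathbb R^d$, with $(\omega,x)\mapsto\theta_x\omega$ measurable, $\theta_0=\mathrm{id}$, $\theta_x\circ\theta_y=\theta_{x+y}$, and $\mathbb P(\theta_xA)=\mathbb P(A)$ for all $x\in\mathbb R^d$, $A\in\mathcal A$. A random measure $\Phi$ on $\mathbb R^d$ is a random locally finite measure. It is invariant if $\Phi(\omega,B+x)=\Phi(\theta_x\omega,B)$ for all $\omega,x,B$, and locally square-integrable if $\mathbb E\Phi(B)^2<\infty$ for all bounded $B\in\mathcal B^d$. Its intensity $\gamma:=\mathbb E\Phi([0,1]^d)$ is assumed positive and finite. The Palm probability measure is $\mathbb P^\Phi_0(A):=\gamma^{-1}\mathbb E\int_{[0,1]^d}\mathbf 1_A(\theta_x)\,\Phi(\mathrm dx)$, with expectation $\mathbb E^\Phi_0$. The reduced second moment measure is $$\alpha_\Phi(B):=\mathbb E\int \mathbf 1\{x\in[0,1]^d,\,y-x\in B\}\,\Phi^2(\mathrm d(x,y)),\quad B\in\mathcal B^d ,$$ and the covariance measure is $\beta_\Phi:=\alpha_\Phi-\gamma^2\lambda_d$ (a signed measure, defined on bounded Borel sets). The two-point Palm probability measures $\mathbb P^\Phi_{0,y}$, $y\in\mathbb R^d$, form a probability kernel from $\mathbb R^d$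 to $\Omega$ satisfying $$\mathbb E\int f(x,y-x,\theta_x)\,\Phi^2(\mathrm d(x,y))=\iiint f(x,y,\omega)\,\mathbb P^\Phi_{0,y}(\mathrm d\omega)\,\alpha_\Phi(\mathrm dy)\,\mathrm dx$$ for all measurable $f\ge0$; $\mathbb E^\Phi_{0,y}$ is the corresponding expectation. A probability kernel $K$ from $\Omega\times\mathbb R^d$ to $\mathbb R^d$ is invariant if $K(\omega,x,B+x)=K(\theta_x\omega,0,B)$ for all $\omega,x,B$. Write $K_x=K(x)$ for the random probability measure $\omega\mapsto K(\omega,x,\cdot)$ (similarly $K^*_x$) and $K\Phi(\omega,\cdot):=\int K(\omega,x,\cdot)\,\Phi(\omega,\mathrm dx)$. Expectations of random measures are taken setwise. For a finite signed measure $\nu$, $\|\nu\|:=\sup|\int f\,\mathrm d\nu|$ over measurable $f$ with values in $[-1,1]$. $\mathcal K_0$ is the set of convex bounded sets containing $0$ in their interior. A bounded Borel set $B$ is Fourier smooth if there are $c,\vartheta>0$ with $|\widehat{\mathbf 1_B}(k)|\le c(1+\|k\|)^{-(d+\vartheta)/2}$ for all $k\in\mathbb R^d$, where $\hat f(k)=\int f(x)e^{-i\langle k,x\rangle}\mathrm dx$. A stationary locally square-integrable random measure $\Psi$ is hyperuniform w.r.t. $W$ if $\lim_{r\to\infty}\lambda_d(rW)^{-1}\operatorname{Var}[\Psi(rW)]=0$. *)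

theory Defs
  imports "HOL-Probability.Probability"
begin

section \<open>The underlying probability space and the flow\<close>

text \<open>Measurably isomorphic to a Borel subset of the unit interval.\<close>

definition standard_borel :: "'w measure \<Rightarrow> bool" where
  "standard_borel M \<longleftrightarrow>
     (\<exists>(B::real set) f. B \<in> sets borel \<and> B \<subseteq> {0..1} \<and> bij_betw f (space M) B \<and>
        f \<in> M \<rightarrow>\<^sub>M restrict_space borel B \<and>
        the_inv_into (space M) f \<in> restrict_space borel B \<rightarrow>\<^sub>M M)"

definition measurable_flow :: "'w measure \<Rightarrow> ('a::euclidean_space \<Rightarrow> 'w \<Rightarrow> 'w) \<Rightarrow> bool" where
  "measurable_flow M \<theta> \<longleftrightarrow>
     (\<lambda>(\<omega>, x). \<theta> x \<omega>) \<in> M \<Otimes>\<^sub>M borel \<rightarrow>\<^sub>M M \<and>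
     (\<forall>\<omega>\<in>space M. \<theta> 0 \<omega> = \<omega>) \<and>
     (\<forall>x y. \<forall>\<omega>\<in>space M. \<theta> x (\<theta> y \<omega>) = \<theta> (x + y) \<omega>) \<and>
     (\<forall>x. \<forall>A\<in>sets M. emeasure M (\<theta> x ` A) = emeasure M A)"

section \<open>Random measures\<close>

text \<open>
  All measures on the \<open>\<sigma>\<close>-algebra of \<open>N\<close>, with the \<open>\<sigma>\<close>-algebra generated by the evaluation
  maps; this is \<^const>\<open>subprob_algebra\<close> without the bound on the total mass.
\<close>

definition measure_algebra :: "'b measure \<Rightarrow> 'b measure measure" where
  "measure_algebra N =
     (SUP A \<in> sets N. vimage_algebra {\<mu>. sets \<mu> = sets N} (\<lambda>\<mu>. emeasure \<mu> A) borel)"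

definition locally_finite :: "'a::euclidean_space measure \<Rightarrow> bool" where
  "locally_finite \<mu> \<longleftrightarrow> (\<forall>B\<in>sets borel. bounded B \<longrightarrow> emeasure \<mu> B < \<infinity>)"

definition random_measure :: "'w measure \<Rightarrow> ('w \<Rightarrow> 'a::euclidean_space measure) \<Rightarrow> bool" where
  "random_measure M \<Phi> \<longleftrightarrow>
     \<Phi> \<in> M \<rightarrow>\<^sub>M measure_algebra borel \<and> (\<forall>\<omega>\<in>space M. locally_finite (\<Phi> \<omega>))"

definition invariant_random_measure ::
  "'w measure \<Rightarrow> ('a::euclidean_space \<Rightarrow> 'w \<Rightarrow> 'w) \<Rightarrow> ('w \<Rightarrow> 'a measure) \<Rightarrow> bool" where
  "invariant_random_measure M \<theta> \<Phi> \<longleftrightarrow>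
     (\<forall>\<omega>\<in>space M. \<forall>x. \<forall>B\<in>sets borel.
        emeasure (\<Phi> \<omega>) ((\<lambda>b. b + x) ` B) = emeasure (\<Phi> (\<theta> x \<omega>)) B)"

definition locally_square_integrable ::
  "'w measure \<Rightarrow> ('w \<Rightarrow> 'a::euclidean_space measure) \<Rightarrow> bool" where
  "locally_square_integrable M \<Phi> \<longleftrightarrow>
     (\<forall>B\<in>sets borel. bounded B \<longrightarrow> (\<integral>\<^sup>+ \<omega>. (emeasure (\<Phi> \<omega>) B)\<^sup>2 \<partial>M) < \<infinity>)"

definition stationary :: "'w measure \<Rightarrow> ('w \<Rightarrow> 'a::euclidean_space measure) \<Rightarrow> bool" where
  "stationary M \<Psi> \<longleftrightarrow>
     (\<forall>x. distr M (measure_algebra borel) (\<lambda>\<omega>. distr (\<Psi> \<omega>) borel (\<lambda>z. z - x)) =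
          distr M (measure_algebra borel) \<Psi>)"

text \<open>The unit cube \<open>[0,1]\<^sup>d\<close> is \<open>cbox 0 One\<close>.\<close>

definition intensity :: "'w measure \<Rightarrow> ('w \<Rightarrow> 'a::euclidean_space measure) \<Rightarrow> ennreal" where
  "intensity M \<Phi> = (\<integral>\<^sup>+ \<omega>. emeasure (\<Phi> \<omega>) (cbox 0 One) \<partial>M)"

section \<open>Palm measures and second order quantities\<close>

definition palm_measure ::
  "'w measure \<Rightarrow> ('a::euclidean_space \<Rightarrow> 'w \<Rightarrow> 'w) \<Rightarrow> ('w \<Rightarrow> 'a measure) \<Rightarrow> 'w measure" where
  "palm_measure M \<theta> \<Phi> = measure_of (space M) (sets M)
     (\<lambda>A. (\<integral>\<^sup>+ \<omega>. \<integral>\<^sup>+ x. indicator (cbox 0 One) x * indicator A (\<theta> x \<omega>) \<partial>\<Phi> \<omega> \<partial>M) / intensity M \<Phi>)"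

definition reduced_second_moment ::
  "'w measure \<Rightarrow> ('w \<Rightarrow> 'a::euclidean_space measure) \<Rightarrow> 'a measure" where
  "reduced_second_moment M \<Phi> = measure_of UNIV (sets borel)
     (\<lambda>B. \<integral>\<^sup>+ \<omega>. \<integral>\<^sup>+ (x, y). indicator {(x, y). x \<in> cbox 0 One \<and> y - x \<in> B} (x, y)
            \<partial>(\<Phi> \<omega> \<Otimes>\<^sub>M \<Phi> \<omega>) \<partial>M)"

text \<open>A set function that is meaningful on bounded Borel sets only.\<close>

definition covariance_measure ::
  "'w measure \<Rightarrow> ('w \<Rightarrow> 'a::euclidean_space measure) \<Rightarrow> 'a set \<Rightarrow> real" where
  "covariance_measure M \<Phi> B =
     measure (reduced_second_moment M \<Phi>) B - (enn2real (intensity M \<Phi>))\<^sup>2 * measure lborel B"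

text \<open>
  Total variation on the whole space of a signed measure defined on bounded Borel sets: the
  supremum over finite disjoint families of such sets.
\<close>

definition total_variation :: "('a::euclidean_space set \<Rightarrow> real) \<Rightarrow> ennreal" where
  "total_variation \<nu> =
     (SUP F \<in> {F. finite F \<and> disjoint F \<and> (\<forall>B\<in>F. B \<in> sets borel \<and> bounded B)}.
        \<Sum>B\<in>F. ennreal \<bar>\<nu> B\<bar>)"

text \<open>
  The predicate below says that \<open>P2\<close> is a version of the kernel of two-point Palm probability
  measures (which is determined only up to null sets of the reduced second moment measure).
\<close>

definition two_point_palm ::
  "'w measure \<Rightarrow> ('a::euclidean_space \<Rightarrow> 'w \<Rightarrow> 'w) \<Rightarrow> ('w \<Rightarrow> 'a measure) \<Rightarrow> ('a \<Rightarrow> 'w measure) \<Rightarrow> bool"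
where
  "two_point_palm M \<theta> \<Phi> P2 \<longleftrightarrow>
     P2 \<in> borel \<rightarrow>\<^sub>M prob_algebra M \<and>
     (\<forall>f :: 'a \<times> 'a \<times> 'w \<Rightarrow> ennreal. f \<in> borel_measurable (borel \<Otimes>\<^sub>M borel \<Otimes>\<^sub>M M) \<longrightarrow>
        (\<integral>\<^sup>+ \<omega>. \<integral>\<^sup>+ (x, y). f (x, y - x, \<theta> x \<omega>) \<partial>(\<Phi> \<omega> \<Otimes>\<^sub>M \<Phi> \<omega>) \<partial>M) =
        (\<integral>\<^sup>+ x. \<integral>\<^sup>+ y. \<integral>\<^sup>+ \<omega>. f (x, y, \<omega>) \<partial>P2 y \<partial>reduced_second_moment M \<Phi> \<partial>lborel))"

section \<open>Invariant kernels\<close>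

definition invariant_prob_kernel ::
  "'w measure \<Rightarrow> ('a::euclidean_space \<Rightarrow> 'w \<Rightarrow> 'w) \<Rightarrow> ('w \<Rightarrow> 'a \<Rightarrow> 'a measure) \<Rightarrow> bool" where
  "invariant_prob_kernel M \<theta> K \<longleftrightarrow>
     (\<lambda>(\<omega>, x). K \<omega> x) \<in> M \<Otimes>\<^sub>M borel \<rightarrow>\<^sub>M prob_algebra borel \<and>
     (\<forall>\<omega>\<in>space M. \<forall>x. \<forall>B\<in>sets borel.
        emeasure (K \<omega> x) ((\<lambda>b. b + x) ` B) = emeasure (K (\<theta> x \<omega>) 0) B)"

definition kernel_transform ::
  "('w \<Rightarrow> 'a::euclidean_space \<Rightarrow> 'a measure) \<Rightarrow> ('w \<Rightarrow> 'a measure) \<Rightarrow> 'w \<Rightarrow> 'a measure" where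
  "kernel_transform K \<Phi> \<omega> = \<Phi> \<omega> \<bind> K \<omega>"

text \<open>\<open>K\<^sup>*(\<omega>, x, B) = K(\<omega>, x, B + x)\<close>, since the preimage of \<open>B\<close> under \<open>z \<mapsto> z - x\<close> is \<open>B + x\<close>.\<close>

definition Kstar ::
  "('w \<Rightarrow> 'a::euclidean_space \<Rightarrow> 'a measure) \<Rightarrow> 'w \<Rightarrow> 'a \<Rightarrow> 'a measure" where
  "Kstar K \<omega> x = distr (K \<omega> x) borel (\<lambda>z. z - x)"

text \<open>The norm of the finite signed measure \<open>\<mu> - \<nu>\<close>, for finite measures on the same \<open>\<sigma>\<close>-algebra.\<close>

definition diff_norm :: "'b measure \<Rightarrow> 'b measure \<Rightarrow> real" where
  "diff_norm \<mu> \<nu> =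
     (SUP f \<in> {f \<in> borel_measurable \<mu>. \<forall>z. f z \<in> {-1..1}}.
        \<bar>(\<integral>z. f z \<partial>\<mu>) - (\<integral>z. f z \<partial>\<nu>)\<bar>)"

text \<open>
  For a probability measure \<open>P\<close> and a random probability measure \<open>\<eta>\<close>, the setwise expectation of
  \<open>\<eta>\<close> under \<open>P\<close> is the monadic composition \<open>P \<bind> \<eta>\<close>.
\<close>

definition kappa ::
  "'w measure \<Rightarrow> ('a::euclidean_space \<Rightarrow> 'w \<Rightarrow> 'w) \<Rightarrow> ('w \<Rightarrow> 'a measure) \<Rightarrow> ('a \<Rightarrow> 'w measure) \<Rightarrow>
     ('w \<Rightarrow> 'a \<Rightarrow> 'a measure) \<Rightarrow> 'a \<Rightarrow> real" where
  "kappa M \<theta> \<Phi> P2 K y =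
     (let Q = palm_measure M \<theta> \<Phi> \<bind> (\<lambda>\<omega>. Kstar K \<omega> 0)
      in diff_norm (P2 y \<bind> (\<lambda>\<omega>. Kstar K \<omega> y \<Otimes>\<^sub>M Kstar K \<omega> 0)) (Q \<Otimes>\<^sub>M Q))"

section \<open>Hyperuniformity\<close>

definition convex_K0 :: "'a::euclidean_space set set" where
  "convex_K0 = {W. convex W \<and> bounded W \<and> 0 \<in> interior W}"

definition fourier :: "('a::euclidean_space \<Rightarrow> complex) \<Rightarrow> 'a \<Rightarrow> complex" where
  "fourier f k = (\<integral>x. f x * exp (- (\<i> * of_real (k \<bullet> x))) \<partial>lborel)"

definition fourier_smooth :: "'a::euclidean_space set \<Rightarrow> bool" where
  "fourier_smooth B \<longleftrightarrow> B \<in> sets borel \<and> bounded B \<and>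
     (\<exists>c>0. \<exists>t>0. \<forall>k.
        norm (fourier (indicator B) k) \<le> c * (1 + norm k) powr (- (real DIM('a) + t) / 2))"

text \<open>\<open>\<lambda>\<^sub>d(rW)\<^sup>-\<^sup>1 Var[\<Psi>(rW)]\<close>\<close>

definition normalized_variance ::
  "'w measure \<Rightarrow> ('w \<Rightarrow> 'a::euclidean_space measure) \<Rightarrow> 'a set \<Rightarrow> real \<Rightarrow> real" where
  "normalized_variance M \<Psi> W r =
     prob_space.variance M (\<lambda>\<omega>. measure (\<Psi> \<omega>) ((\<lambda>x. r *\<^sub>R x) ` W)) /
     measure lborel ((\<lambda>x. r *\<^sub>R x) ` W)"

text \<open>
  Pointwise local finiteness of \<open>\<Psi>\<close> is not required here: \<open>kernel_transform K \<Phi>\<close> may fail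
  to be locally finite on a null set. Almost sure local finiteness follows from local square
  integrability, which also ensures that the variances below are genuine.
\<close>

definition hyperuniform ::
  "'w measure \<Rightarrow> ('w \<Rightarrow> 'a::euclidean_space measure) \<Rightarrow> 'a set \<Rightarrow> bool" where
  "hyperuniform M \<Psi> W \<longleftrightarrow>
     \<Psi> \<in> M \<rightarrow>\<^sub>M measure_algebra borel \<and> stationary M \<Psi> \<and> locally_square_integrable M \<Psi> \<and>
     (normalized_variance M \<Psi> W \<longlongrightarrow> 0) at_top"

end

theory Submission
  imports Defs
begin

text \<open>
  Write \<open>\<alpha>\<close> for the reduced second moment measure, \<open>\<gamma>\<close> for the intensity, \<open>overlap B z\<close> for the volume of
  \<open>B \<inter> (B - z)\<close>, and \<open>R\<close> for the law of \<open>u - v\<close> when \<open>u\<close>, \<open>v\<close> are independent with distribution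
  \<open>\<E>\<^sub>0[K\<^sup>*\<^sub>0]\<close>. The variance of \<open>\<Phi>(B)\<close> is \<open>\<integral> overlap B d\<alpha> - \<gamma>\<^sup>2 \<lambda>(B)\<^sup>2\<close>. The variance of
  \<open>K\<Phi>(B)\<close> is given by the same formula with \<open>overlap B z\<close> averaged over \<open>z + u - v\<close>, where \<open>(u, v)\<close> is
  distributed according to the two-point Palm expectation of \<open>K\<^sup>*\<^sub>z \<otimes> K\<^sup>*\<^sub>0\<close>. Replacing that law by the product
  law costs \<open>o(\<lambda>(rW))\<close>, by dominated convergence with dominating function \<open>\<kappa>\<close>, and leaves the quantity
  \<open>cov R B\<close>. By stationarity \<open>cov R B\<close> is at most the variance of \<open>\<Phi>(B)\<close>, which gives (i).

  For (ii) the difference between that variance and \<open>cov R (rW)\<close> must be bounded. If the covariance measure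
  \<open>\<beta>\<close> has finite total variation this is dominated convergence with respect to \<open>|\<beta>|\<close>. If \<open>W\<close> is
  Fourier smooth, the overlap function is the Fourier transform of the integrable function
  \<open>|\<F> 1\<^sub>B|\<^sup>2\<close>, and the variance becomes the limit for \<open>s \<rightarrow> 0\<close> of its integral against the nonnegative
  function \<open>f\<^sub>s(k) = \<integral> exp(-s|z|\<^sup>2) cos(k z) \<beta>(dz)\<close>; for \<open>cov R\<close> there is an additional factor
  \<open>\<rho>(k) = \<integral> cos(k w) R(dw)\<close>, which tends to 1 at the origin. Frequencies near 0 thus contribute a small
  fraction of the variance, and the remaining ones contribute \<open>O(r powr (d - t))\<close>, because the integrals of
  \<open>f\<^sub>s\<close> against \<open>(1 + |k|) powr (-d - t)\<close> are bounded uniformly in \<open>s\<close>.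
\<close>

section \<open>Gaussian integrals\<close>

text \<open>The spectral measure of \<beta> is never constructed: \<beta> is signed and only locally
  finite, so its Fourier transform need not be a function. Two properties of the damped densities
  stand in for it: they are nonnegative, by Jensen's inequality for Gaussian-weighted cosine sums
  over \<open>\<Phi>\<close>, and Gaussian windows of them have mass bounded uniformly in s and in
  the position of the window. The latter rests on the Cauchy-Schwarz bound for shifted overlaps,
  which also yields \<open>cov R B\<close> \<le> \<open>cov (return borel 0) B\<close>; hence (ii)
  only needs a lower bound for \<open>cov R\<close>. The exponent d - t is 2d, from scaling the
  squared Fourier transform, minus the decay rate d + t. The low frequencies cost an error
  proportional to the variance itself, which may be unbounded after normalisation, so the final
  comparison of limits has to tolerate relative errors. Two further obstacles: \<kappa> need not be
  measurable, so domination uses a countable supremum lying below it; and a bounded convex set need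
  not be Borel, in which case the normalised variances are 0 by convention.\<close>

lemma gaussian_fourier_real:
  fixes s k :: real
  assumes "s > 0"
  shows "integrable lborel (\<lambda>x. complex_of_real (exp (- s * x\<^sup>2)) * iexp (k * x))"
    and "(\<integral>x. complex_of_real (exp (- s * x\<^sup>2)) * iexp (k * x) \<partial>lborel)
           = of_real (sqrt (pi / s) * exp (- k\<^sup>2 / (4 * s)))"
proof -
  \<comment> \<open>With c^2 = 2s the standard normal density at c x is exp (- s x^2) up to the
    factor 1 / sqrt (2 pi), so the known characteristic function can be used at k / c.\<close>
  define c where "c = sqrt (2 * s)"
  have c: "c > 0" "c * c = 2 * s" using assms by (auto simp: c_def)
  define F where "F = (\<lambda>x. complex_of_real (std_normal_density x) * iexp (k / c * x))"
  have iF: "integrable lborel F"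
  proof (rule Bochner_Integration.integrable_bound[where f = std_normal_density])
    show "F \<in> borel_measurable lborel" unfolding F_def by measurable
  qed (auto simp: F_def norm_mult)
  have "char std_normal_distribution (k / c) = of_real (exp (- (k / c)\<^sup>2 / 2))"
    by (simp add: char_std_normal_distribution)
  moreover have "char std_normal_distribution (k / c) = integral\<^sup>L lborel F"
    unfolding char_def F_def
    by (subst integral_density) (auto simp: scaleR_conv_of_real)
  ultimately have eF: "integral\<^sup>L lborel F = of_real (exp (- (k / c)\<^sup>2 / 2))" by simp
  have Fc: "F (0 + c * x) = complex_of_real (1 / sqrt (2 * pi)) *
      (complex_of_real (exp (- s * x\<^sup>2)) * iexp (k * x))" for x
  proof -
    have "(c * x)\<^sup>2 / 2 = s * x\<^sup>2" using c by (simp add: power2_eq_square algebra_simps)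
    then show ?thesis using c by (simp add: F_def normal_density_def)
  qed
  have "integrable lborel (\<lambda>x. F (0 + c * x))"
    using lborel_integrable_real_affine[OF iF, of c 0] c by simp
  then have i1: "integrable lborel (\<lambda>x. complex_of_real (1 / sqrt (2 * pi)) *
      (complex_of_real (exp (- s * x\<^sup>2)) * iexp (k * x)))"
    unfolding Fc .
  have z: "complex_of_real (sqrt (2 * pi)) * (complex_of_real (1 / sqrt (2 * pi)) * w) = w" for w
    by simp
  show "integrable lborel (\<lambda>x. complex_of_real (exp (- s * x\<^sup>2)) * iexp (k * x))"
    using integrable_mult_right[OF i1, of "complex_of_real (sqrt (2 * pi))"] unfolding z .
  have "integral\<^sup>L lborel F = c *\<^sub>R (\<integral>x. F (0 + c * x) \<partial>lborel)"
    using lborel_integral_real_affine[of c F 0] c by simp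
  also have "\<dots> = of_real (c / sqrt (2 * pi)) *
      (\<integral>x. complex_of_real (exp (- s * x\<^sup>2)) * iexp (k * x) \<partial>lborel)"
    unfolding Fc by (simp add: scaleR_conv_of_real)
  finally have "(\<integral>x. complex_of_real (exp (- s * x\<^sup>2)) * iexp (k * x) \<partial>lborel)
      = of_real (sqrt (2 * pi) / c) * of_real (exp (- (k / c)\<^sup>2 / 2))"
    unfolding eF using c by (simp add: field_simps)
  moreover have "sqrt (2 * pi) / c = sqrt (pi / s)"
    using assms by (simp add: c_def real_sqrt_divide[symmetric])
  moreover have "(k / c)\<^sup>2 / 2 = k\<^sup>2 / (4 * s)"
    using c by (simp add: power_divide power2_eq_square)
  ultimately show "(\<integral>x. complex_of_real (exp (- s * x\<^sup>2)) * iexp (k * x) \<partial>lborel)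
           = of_real (sqrt (pi / s) * exp (- k\<^sup>2 / (4 * s)))"
    by simp
qed

text \<open>Lebesgue measure is the image of a product measure over \<open>Basis\<close>, and the
  integrand factorises over the coordinates, which leaves a product of one-dimensional
  integrals.\<close>

lemma gaussian_fourier_complex:
  fixes k :: "'a::euclidean_space"
  assumes "s > 0"
  shows "integrable lborel (\<lambda>x. complex_of_real (exp (- s * (norm x)\<^sup>2)) * iexp (k \<bullet> x))"
    and "(\<integral>x. complex_of_real (exp (- s * (norm x)\<^sup>2)) * iexp (k \<bullet> x) \<partial>lborel)
           = of_real (sqrt (pi / s) ^ DIM('a) * exp (- (norm k)\<^sup>2 / (4 * s)))"
proof -
  let ?P = "\<Pi>\<^sub>M b\<in>(Basis :: 'a set). (lborel :: real measure)"
  let ?h = "\<lambda>x::'a. complex_of_real (exp (- s * (norm x)\<^sup>2)) * iexp (k \<bullet> x)"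
  let ?g = "\<lambda>(b::'a) y. complex_of_real (exp (- s * y\<^sup>2)) * iexp ((k \<bullet> b) * y)"
  interpret product_sigma_finite "\<lambda>b::'a. (lborel :: real measure)" ..
  have eq: "?h (\<Sum>b\<in>Basis. f b *\<^sub>R b) = (\<Prod>b\<in>Basis. ?g b (f b))" for f :: "'a \<Rightarrow> real"
  proof -
    let ?x = "\<Sum>b\<in>Basis. f b *\<^sub>R b"
    have xb: "b \<in> Basis \<Longrightarrow> ?x \<bullet> b = f b" for b by simp
    have n: "(norm ?x)\<^sup>2 = (\<Sum>b\<in>Basis. (f b)\<^sup>2)"
      unfolding power2_norm_eq_inner euclidean_inner[of ?x ?x]
      by (intro sum.cong) (auto simp: xb power2_eq_square)
    have i: "k \<bullet> ?x = (\<Sum>b\<in>Basis. (k \<bullet> b) * f b)"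
      unfolding euclidean_inner[of k ?x] by (intro sum.cong) (auto simp: xb)
    have e1: "complex_of_real (exp (- s * (norm ?x)\<^sup>2)) = (\<Prod>b\<in>Basis. complex_of_real (exp (- s * (f b)\<^sup>2)))"
      unfolding n by (simp add: sum_distrib_left exp_sum flip: sum_negf)
    have e2: "iexp (k \<bullet> ?x) = (\<Prod>b\<in>Basis. iexp ((k \<bullet> b) * f b))"
      unfolding i by (simp add: sum_distrib_left exp_sum)
    show ?thesis unfolding e1 e2 by (simp add: prod.distrib)
  qed
  have m: "(\<lambda>f. \<Sum>b\<in>Basis. f b *\<^sub>R b) \<in> ?P \<rightarrow>\<^sub>M (borel :: 'a measure)" by measurable
  have L: "(lborel :: 'a measure) = distr ?P borel (\<lambda>f. \<Sum>b\<in>Basis. f b *\<^sub>R b)"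
    by (rule lborel_eq)
  have hm: "?h \<in> borel_measurable borel" by measurable
  have ip: "integrable ?P (\<lambda>f. \<Prod>b\<in>Basis. ?g b (f b))"
    by (rule product_integrable_prod[where f = ?g], simp, rule gaussian_fourier_real(1)[OF assms])
  show "integrable lborel ?h"
    unfolding L
    by (subst integrable_distr_eq[OF m hm]) (simp only: eq ip)
  have "integral\<^sup>L lborel ?h = (\<integral>f. (\<Prod>b\<in>Basis. ?g b (f b)) \<partial>?P)"
    unfolding L by (subst integral_distr[OF m hm]) (simp only: eq)
  also have "\<dots> = (\<Prod>b\<in>Basis. \<integral>y. ?g b y \<partial>lborel)"
    by (rule product_integral_prod[where f = ?g], simp, rule gaussian_fourier_real(1)[OF assms])
  also have "\<dots> = (\<Prod>b\<in>(Basis::'a set). complex_of_real (sqrt (pi / s) * exp (- (k \<bullet> b)\<^sup>2 / (4 * s))))"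
    by (intro prod.cong refl gaussian_fourier_real assms)
  also have "\<dots> = of_real (sqrt (pi / s) ^ DIM('a) * exp (\<Sum>b\<in>Basis. - (k \<bullet> b)\<^sup>2 / (4 * s)))"
    by (simp add: prod.distrib exp_sum)
  also have "(\<Sum>b\<in>Basis. - (k \<bullet> b)\<^sup>2 / (4 * s)) = - (norm k)\<^sup>2 / (4 * s)"
    unfolding power2_norm_eq_inner euclidean_inner[of k k]
    by (simp add: sum_negf sum_divide_distrib power2_eq_square)
  finally show "integral\<^sup>L lborel ?h = of_real (sqrt (pi / s) ^ DIM('a) * exp (- (norm k)\<^sup>2 / (4 * s)))" .
qed

lemma
  fixes k :: "'a::euclidean_space"
  assumes "s > 0"
  shows integrable_gaussian_cos: "integrable lborel (\<lambda>x::'a. exp (- s * (norm x)\<^sup>2) * cos (k \<bullet> x))"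
    and integral_gaussian_cos: "(\<integral>x. exp (- s * (norm x)\<^sup>2) * cos (k \<bullet> x) \<partial>lborel)
           = sqrt (pi / s) ^ DIM('a) * exp (- (norm k)\<^sup>2 / (4 * s))"
    and integrable_gaussian_sin: "integrable lborel (\<lambda>x::'a. exp (- s * (norm x)\<^sup>2) * sin (k \<bullet> x))"
    and integral_gaussian_sin: "(\<integral>x. exp (- s * (norm x)\<^sup>2) * sin (k \<bullet> x) \<partial>lborel) = 0"
proof -
  note g = gaussian_fourier_complex[OF assms, of k]
  have r: "Re (complex_of_real (exp (- s * (norm x)\<^sup>2)) * iexp (k \<bullet> x)) = exp (- s * (norm x)\<^sup>2) * cos (k \<bullet> x)"
    "Im (complex_of_real (exp (- s * (norm x)\<^sup>2)) * iexp (k \<bullet> x)) = exp (- s * (norm x)\<^sup>2) * sin (k \<bullet> x)" for x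
    by (simp_all add: Re_exp Im_exp)
  show "integrable lborel (\<lambda>x::'a. exp (- s * (norm x)\<^sup>2) * cos (k \<bullet> x))"
    using integrable_Re[OF g(1)] unfolding r .
  show "integrable lborel (\<lambda>x::'a. exp (- s * (norm x)\<^sup>2) * sin (k \<bullet> x))"
    using integrable_Im[OF g(1)] unfolding r .
  show "(\<integral>x. exp (- s * (norm x)\<^sup>2) * cos (k \<bullet> x) \<partial>lborel)
           = sqrt (pi / s) ^ DIM('a) * exp (- (norm k)\<^sup>2 / (4 * s))"
    using arg_cong[OF g(2), of Re] by (subst (asm) integral_Re[OF g(1), symmetric]) (simp only: r Re_complex_of_real)
  show "(\<integral>x. exp (- s * (norm x)\<^sup>2) * sin (k \<bullet> x) \<partial>lborel) = 0"
    using arg_cong[OF g(2), of Im] by (subst (asm) integral_Im[OF g(1), symmetric]) (simp only: r Im_complex_of_real)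
qed

lemma
  assumes "s > 0"
  shows integrable_gaussian: "integrable lborel (\<lambda>x::'a::euclidean_space. exp (- s * (norm x)\<^sup>2))"
    and integral_gaussian: "(\<integral>(x::'a). exp (- s * (norm x)\<^sup>2) \<partial>lborel) = sqrt (pi / s) ^ DIM('a)"
  using integrable_gaussian_cos[OF assms, of 0] integral_gaussian_cos[OF assms, of "0::'a"] by simp_all

section \<open>The overlap function and its Fourier transform\<close>

lemma nn_integral_lborel_affine:
  fixes t :: "'a::euclidean_space"
  assumes [measurable]: "f \<in> borel_measurable borel" and c: "c \<noteq> 0"
  shows "(\<integral>\<^sup>+x. f x \<partial>lborel) = ennreal (\<bar>c\<bar> ^ DIM('a)) * (\<integral>\<^sup>+x. f (t + c *\<^sub>R x) \<partial>lborel)"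
  by (subst lborel_affine[OF c, of t])
     (simp add: nn_integral_density nn_integral_distr nn_integral_cmult)

lemma integrable_lborel_affine:
  fixes t :: "'a::euclidean_space" and f :: "'a \<Rightarrow> real"
  assumes f: "integrable lborel f" and c: "c \<noteq> 0"
  shows "integrable lborel (\<lambda>x. f (t + c *\<^sub>R x))"
  using f f[THEN borel_measurable_integrable] c unfolding integrable_iff_bounded
  by (subst (asm) nn_integral_lborel_affine[where c = c and t = t])
     (auto simp: ennreal_mult_less_top top_unique)

lemma integral_lborel_affine:
  fixes t :: "'a::euclidean_space" and f :: "'a \<Rightarrow> real"
  assumes [measurable]: "f \<in> borel_measurable borel" and c: "c \<noteq> 0"
  shows "(\<integral>x. f x \<partial>lborel) = \<bar>c\<bar> ^ DIM('a) * (\<integral>x. f (t + c *\<^sub>R x) \<partial>lborel)"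
  by (subst lborel_affine[OF c, of t]) (simp add: integral_density integral_distr)

lemma nn_integral_lborel_translate:
  fixes t :: "'a::euclidean_space"
  assumes "f \<in> borel_measurable borel"
  shows "(\<integral>\<^sup>+x. f (t + x) \<partial>lborel) = (\<integral>\<^sup>+x. f x \<partial>lborel)"
  using nn_integral_lborel_affine[OF assms, of 1 t] by simp

lemma integral_lborel_translate:
  fixes t :: "'a::euclidean_space" and f :: "'a \<Rightarrow> real"
  assumes "f \<in> borel_measurable borel"
  shows "(\<integral>x. f (t + x) \<partial>lborel) = (\<integral>x. f x \<partial>lborel)"
  using integral_lborel_affine[OF assms, of 1 t] by simp

lemma integral_lborel_uminus:
  fixes f :: "'a::euclidean_space \<Rightarrow> real"
  assumes "f \<in> borel_measurable borel"
  shows "(\<integral>x. f (- x) \<partial>lborel) = (\<integral>x. f x \<partial>lborel)"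
  using integral_lborel_affine[OF assms, of "-1" 0] by simp

lemma sigma_finite_if_bounded_finite:
  fixes N :: "'a::euclidean_space measure"
  assumes N: "sets N = sets borel"
    and f: "\<And>A. A \<in> sets borel \<Longrightarrow> bounded A \<Longrightarrow> emeasure N A < \<infinity>"
  shows "sigma_finite_measure N"
proof
  define A where "A = range (\<lambda>n. cball (0::'a) (real n))"
  have c: "countable A" unfolding A_def by (rule countable_image) (rule countableI_type)
  have s: "A \<subseteq> sets N" by (auto simp: N A_def)
  have u: "\<Union> A = space N" using sets_eq_imp_space_eq[OF N] by (auto simp: A_def intro: real_arch_simple)
  have e: "emeasure N a \<noteq> \<infinity>" if "a \<in> A" for a
  proof -
    from that obtain n where "a = cball 0 (real n)" unfolding A_def by blast
    then show ?thesis using f[of "cball 0 (real n)"] by simp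
  qed
  show "\<exists>A. countable A \<and> A \<subseteq> sets N \<and> \<Union> A = space N \<and> (\<forall>a\<in>A. emeasure N a \<noteq> \<infinity>)"
    by (intro exI[of _ A] conjI ballI c s u e)
qed

lemma scaleR_image_sets:
  fixes B :: "'a::euclidean_space set"
  assumes B[measurable]: "B \<in> sets borel" and r: "r > 0"
  shows "(\<lambda>x. r *\<^sub>R x) ` B \<in> sets borel"
proof -
  have "(\<lambda>x. r *\<^sub>R x) ` B = (\<lambda>x. x /\<^sub>R r) -` B \<inter> space borel"
    using r by (auto simp: image_iff intro!: bexI[of _ "_ /\<^sub>R r"])
  also have "\<dots> \<in> sets borel" by measurable
  finally show ?thesis .
qed

text \<open>The set covariance function \<open>z \<mapsto> \<lambda>(B \<inter> (B - z))\<close>.\<close>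

definition overlap :: "'a::euclidean_space set \<Rightarrow> 'a \<Rightarrow> real" where
  "overlap B z = measure lborel (B \<inter> {x. x + z \<in> B})"

text \<open>The measure of the intersection is rewritten as a parametrised integral of a product of
  indicators, where measurability in z is automatic.\<close>

lemma overlap_measurable[measurable]:
  assumes [measurable]: "B \<in> sets borel"
  shows "overlap B \<in> borel_measurable borel"
proof -
  have "overlap B z = enn2real (\<integral>\<^sup>+x. indicator B x * indicator B (x + z) \<partial>lborel)" for z
  proof -
    have "emeasure lborel (B \<inter> {x. x + z \<in> B}) = (\<integral>\<^sup>+x. indicator (B \<inter> {x. x + z \<in> B}) x \<partial>lborel)"
      by simp
    also have "\<dots> = (\<integral>\<^sup>+x. indicator B x * indicator B (x + z) \<partial>lborel)"
      by (intro nn_integral_cong) (auto split: split_indicator)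
    finally show ?thesis by (simp add: overlap_def measure_def)
  qed
  then have "overlap B = (\<lambda>z. enn2real (\<integral>\<^sup>+x. indicator B x * indicator B (x + z) \<partial>lborel))" by (rule ext)
  also have "\<dots> \<in> borel_measurable borel" by measurable
  finally show ?thesis .
qed

context
  fixes B :: "'a::euclidean_space set"
  assumes B[measurable]: "B \<in> sets borel" and bB: "bounded B"
begin

lemma overlap_nn:
  "ennreal (overlap B z) = (\<integral>\<^sup>+x. indicator B x * indicator B (x + z) \<partial>lborel)"
proof -
  have "emeasure lborel (B \<inter> {x. x + z \<in> B}) < \<infinity>"
    by (rule le_less_trans[OF emeasure_mono emeasure_bounded_finite[OF bB]]) auto
  then have "ennreal (overlap B z) = emeasure lborel (B \<inter> {x. x + z \<in> B})"
    by (simp add: overlap_def measure_def)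
  also have "\<dots> = (\<integral>\<^sup>+x. indicator (B \<inter> {x. x + z \<in> B}) x \<partial>lborel)" by simp
  also have "\<dots> = (\<integral>\<^sup>+x. indicator B x * indicator B (x + z) \<partial>lborel)"
    by (intro nn_integral_cong) (auto split: split_indicator)
  finally show ?thesis .
qed

lemma overlap_nonneg: "0 \<le> overlap B z"
  by (simp add: overlap_def)

lemma overlap_le: "overlap B z \<le> measure lborel B"
  unfolding overlap_def using emeasure_bounded_finite[OF bB]
  by (intro measure_mono_fmeasurable) (auto simp: fmeasurable_def)

lemma overlap_0: "overlap B 0 = measure lborel B"
  unfolding overlap_def by (rule arg_cong[where f = "measure lborel"]) auto

lemma overlap_eq_0:
  assumes "B \<subseteq> cball 0 R" "norm z > 2 * R"
  shows "overlap B z = 0"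
proof -
  have "B \<inter> {x. x + z \<in> B} = {}"
  proof safe
    fix x assume "x \<in> B" "x + z \<in> B"
    then have "norm x \<le> R" "norm (x + z) \<le> R" using assms by auto
    then have "norm z \<le> 2 * R" using norm_triangle_ineq4[of "x + z" x] by simp
    then show "x \<in> {}" using assms by simp
  qed
  then show ?thesis by (simp add: overlap_def)
qed

text \<open>Translating by z exchanges the two sets in the intersection. This evenness removes all
  sine terms from the Fourier transform below.\<close>

lemma overlap_uminus: "overlap B (- z) = overlap B z"
proof -
  have "ennreal (overlap B (- z)) = (\<integral>\<^sup>+x. indicator B (z + x) * indicator B (z + x + (- z)) \<partial>lborel)"
    unfolding overlap_nn by (rule nn_integral_lborel_translate[symmetric]) measurable
  also have "\<dots> = ennreal (overlap B z)"
    unfolding overlap_nn by (intro nn_integral_cong) (simp add: ac_simps)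
  finally show ?thesis by (simp add: overlap_nonneg)
qed

lemma nn_integral_overlap:
  assumes [measurable]: "g \<in> borel_measurable borel"
  shows "(\<integral>\<^sup>+x. \<integral>\<^sup>+y. indicator B x * indicator B y * g (y - x) \<partial>lborel \<partial>lborel)
    = (\<integral>\<^sup>+z. ennreal (overlap B z) * g z \<partial>lborel)"
proof -
  have "(\<integral>\<^sup>+x. \<integral>\<^sup>+y. indicator B x * indicator B y * g (y - x) \<partial>lborel \<partial>lborel)
      = (\<integral>\<^sup>+x. \<integral>\<^sup>+z. indicator B x * indicator B (x + z) * g z \<partial>lborel \<partial>lborel)"
  proof (rule nn_integral_cong)
    fix x
    have "(\<integral>\<^sup>+y. indicator B x * indicator B y * g (y - x) \<partial>lborel)
      = (\<integral>\<^sup>+z. indicator B x * indicator B (x + z) * g (x + z - x) \<partial>lborel)"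
      by (rule nn_integral_lborel_translate[symmetric]) measurable
    then show "(\<integral>\<^sup>+y. indicator B x * indicator B y * g (y - x) \<partial>lborel)
      = (\<integral>\<^sup>+z. indicator B x * indicator B (x + z) * g z \<partial>lborel)" by simp
  qed
  also have "\<dots> = (\<integral>\<^sup>+z. \<integral>\<^sup>+x. indicator B x * indicator B (x + z) * g z \<partial>lborel \<partial>lborel)"
    by (rule lborel_pair.Fubini') measurable
  also have "\<dots> = (\<integral>\<^sup>+z. ennreal (overlap B z) * g z \<partial>lborel)"
    by (intro nn_integral_cong) (simp add: overlap_nn nn_integral_multc)
  finally show ?thesis .
qed

text \<open>The value does not depend on the shift w. For this reason the subtracted term in
  \<open>cov R B\<close> is the same for every law \<open>R\<close>.\<close>

lemma nn_integral_overlap_total: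
  "(\<integral>\<^sup>+z. ennreal (overlap B (w + z)) \<partial>lborel) = (ennreal (measure lborel B))\<^sup>2"
proof -
  have "(\<integral>\<^sup>+z. ennreal (overlap B (w + z)) \<partial>lborel) = (\<integral>\<^sup>+z. ennreal (overlap B z) \<partial>lborel)"
    by (rule nn_integral_lborel_translate) measurable
  also have "\<dots> = (\<integral>\<^sup>+x. \<integral>\<^sup>+y. indicator B x * indicator B y * 1 \<partial>lborel \<partial>lborel)"
    using nn_integral_overlap[of "\<lambda>_. 1"] by simp
  also have "\<dots> = (emeasure lborel B)\<^sup>2"
    by (simp add: nn_integral_cmult nn_integral_multc power2_eq_square)
  also have "emeasure lborel B = ennreal (measure lborel B)"
    using emeasure_bounded_finite[OF bB] by (simp add: emeasure_eq_ennreal_measure)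
  finally show ?thesis .
qed

lemma integrable_overlap: "integrable lborel (\<lambda>z. overlap B (w + z))"
  by (rule integrableI_nonneg)
    (auto simp: overlap_nonneg nn_integral_overlap_total power2_eq_square ennreal_mult_less_top)

text \<open>Substituting y = x + z and exchanging the integrals exhibits the overlap as the
  autocorrelation of the indicator. The bound on g serves to justify Fubini for signed
  integrands.\<close>

lemma integral_overlap:
  fixes g :: "'a \<Rightarrow> real"
  assumes [measurable]: "g \<in> borel_measurable borel" and bg: "\<And>z. \<bar>g z\<bar> \<le> b"
  shows "(\<integral>x. \<integral>y. indicator B x * indicator B y * g (y - x) \<partial>lborel \<partial>lborel)
    = (\<integral>z. overlap B z * g z \<partial>lborel)"
proof -
  have b: "b \<ge> 0" using bg[of 0] by simp
  have ip: "integrable (lborel \<Otimes>\<^sub>M lborel) (\<lambda>(x, y). indicator B x * indicator B (x + y) * g y)"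
  proof (rule integrableI_bounded)
    have "(\<integral>\<^sup>+p. ennreal (norm (case p of (x, y) \<Rightarrow> indicator B x * indicator B (x + y) * g y)) \<partial>(lborel \<Otimes>\<^sub>M lborel))
       = (\<integral>\<^sup>+x. \<integral>\<^sup>+y. ennreal (norm (indicator B x * indicator B (x + y) * g y)) \<partial>lborel \<partial>lborel)"
      by (subst lborel.nn_integral_fst[symmetric]) auto
    also have "\<dots> \<le> (\<integral>\<^sup>+x. \<integral>\<^sup>+y. indicator B x * indicator B (x + y) * ennreal b \<partial>lborel \<partial>lborel)"
      by (intro nn_integral_mono) (auto split: split_indicator simp: bg intro!: ennreal_leI)
    also have "\<dots> = (\<integral>\<^sup>+x. \<integral>\<^sup>+y. indicator B x * indicator B y * ennreal b \<partial>lborel \<partial>lborel)"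
    proof (rule nn_integral_cong)
      fix x
      show "(\<integral>\<^sup>+y. indicator B x * indicator B (x + y) * ennreal b \<partial>lborel)
        = (\<integral>\<^sup>+y. indicator B x * indicator B y * ennreal b \<partial>lborel)"
        by (rule nn_integral_lborel_translate) measurable
    qed
    also have "\<dots> = ennreal b * (emeasure lborel B * emeasure lborel B)"
      by (simp add: nn_integral_cmult nn_integral_multc ac_simps)
    also have "\<dots> < \<infinity>" using emeasure_bounded_finite[OF bB] by (simp add: ennreal_mult_less_top)
    finally show "(\<integral>\<^sup>+p. ennreal (norm (case p of (x, y) \<Rightarrow> indicator B x * indicator B (x + y) * g y)) \<partial>(lborel \<Otimes>\<^sub>M lborel)) < \<infinity>" .
  qed measurable
  have "(\<integral>x. \<integral>y. indicator B x * indicator B y * g (y - x) \<partial>lborel \<partial>lborel)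
      = (\<integral>x. \<integral>z. indicator B x * indicator B (x + z) * g z \<partial>lborel \<partial>lborel)"
  proof (rule Bochner_Integration.integral_cong[OF refl])
    fix x
    have "(\<integral>y. indicator B x * indicator B y * g (y - x) \<partial>lborel)
      = (\<integral>z. indicator B x * indicator B (x + z) * g (x + z - x) \<partial>lborel)"
      by (rule integral_lborel_translate[symmetric]) measurable
    then show "(\<integral>y. indicator B x * indicator B y * g (y - x) \<partial>lborel)
      = (\<integral>z. indicator B x * indicator B (x + z) * g z \<partial>lborel)" by simp
  qed
  also have "\<dots> = (\<integral>z. \<integral>x. indicator B x * indicator B (x + z) * g z \<partial>lborel \<partial>lborel)"
    by (rule lborel_pair.Fubini_integral[OF ip, symmetric])
  also have "\<dots> = (\<integral>z. overlap B z * g z \<partial>lborel)"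
  proof (rule Bochner_Integration.integral_cong[OF refl])
    fix z
    have "(\<integral>x. indicator B x * indicator B (x + z) \<partial>lborel) = (\<integral>x. indicat_real (B \<inter> {x. x + z \<in> B}) x \<partial>lborel)"
      by (intro Bochner_Integration.integral_cong) (auto split: split_indicator)
    also have "\<dots> = overlap B z" by (simp add: overlap_def)
    finally show "(\<integral>x. indicator B x * indicator B (x + z) * g z \<partial>lborel) = overlap B z * g z"
      by simp
  qed
  finally show ?thesis .
qed

text \<open>The indicators of the shifted sets converge at every x with x + w off the frontier of B,
  hence almost everywhere; the indicator of B dominates.\<close>

lemma overlap_tendsto:
  assumes fr: "frontier B \<in> null_sets lborel" and zn: "z \<longlonglongrightarrow> w"
  shows "(\<lambda>n. overlap B (z n)) \<longlonglongrightarrow> overlap B w"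
proof -
  have e: "overlap B y = (\<integral>x. indicator B x * indicator B (x + y) \<partial>lborel)" for y
  proof -
    have "(\<integral>x. indicator B x * indicator B (x + y) \<partial>lborel) = (\<integral>x. indicat_real (B \<inter> {x. x + y \<in> B}) x \<partial>(lborel :: 'a measure))"
      by (intro Bochner_Integration.integral_cong) (auto split: split_indicator)
    then show ?thesis by (simp add: overlap_def)
  qed
  have [measurable]: "frontier B \<in> sets borel" by simp
  have ae: "AE x in lborel. w + x \<notin> frontier B"
  proof (rule AE_I')
    have "emeasure lborel {x. w + x \<in> frontier B} = (\<integral>\<^sup>+x. indicator (frontier B) (w + x) \<partial>lborel)"
      by (subst nn_integral_indicator[symmetric], measurable, intro nn_integral_cong) (auto split: split_indicator)
    also have "\<dots> = 0"
      by (subst nn_integral_lborel_translate) (use fr in auto)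
    finally show "{x. w + x \<in> frontier B} \<in> null_sets lborel"
      by (intro null_setsI) auto
  qed auto
  show ?thesis unfolding e
  proof (rule integral_dominated_convergence[where w = "indicator B"])
    show "integrable lborel (indicator B :: 'a \<Rightarrow> real)"
      using emeasure_bounded_finite[OF bB] by simp
    show "AE x in lborel. (\<lambda>n. indicator B x * indicator B (x + z n) :: real) \<longlonglongrightarrow> indicator B x * indicator B (x + w)"
      using ae
    proof eventually_elim
      case (elim x)
      have l: "(\<lambda>n. x + z n) \<longlonglongrightarrow> x + w" by (intro tendsto_intros zn)
      have "(\<lambda>n. indicator B (x + z n) :: real) \<longlonglongrightarrow> indicator B (x + w)"
      proof (cases "x + w \<in> B")
        case True
        with elim have "x + w \<in> interior B" by (auto simp: frontier_def add.commute intro: closure_subset[THEN subsetD])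
        then have "eventually (\<lambda>n. x + z n \<in> interior B) sequentially"
          using l open_interior topological_tendstoD by blast
        then have "eventually (\<lambda>n. indicator B (x + z n) = (1 :: real)) sequentially"
          by eventually_elim (use interior_subset[of B] in \<open>auto simp: indicator_def\<close>)
        then show ?thesis using True by (simp add: tendsto_eventually)
      next
        case False
        with elim have "x + w \<in> - closure B" using interior_subset by (auto simp: frontier_def add.commute)
        then have "eventually (\<lambda>n. x + z n \<in> - closure B) sequentially"
          using topological_tendstoD[OF l, of "- closure B"] by auto
        then have "eventually (\<lambda>n. indicator B (x + z n) = (0 :: real)) sequentially"
          by eventually_elim (use closure_subset[of B] in \<open>auto simp: indicator_def\<close>)
        then show ?thesis using False by (simp add: tendsto_eventually)
      qed
      then show ?case by (intro tendsto_intros)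
    qed
  qed (auto split: split_indicator)
qed

end

lemma overlap_scaleR:
  fixes B :: "'a::euclidean_space set"
  assumes [measurable]: "B \<in> sets borel" and r: "r > 0"
  shows "overlap ((\<lambda>x. r *\<^sub>R x) ` B) z = r ^ DIM('a) * overlap B (z /\<^sub>R r)"
proof -
  have m: "x \<in> (\<lambda>x. r *\<^sub>R x) ` B \<longleftrightarrow> x /\<^sub>R r \<in> B" for x
    using r by (auto simp: image_iff intro!: bexI[of _ "x /\<^sub>R r"])
  note [measurable] = scaleR_image_sets[OF assms]
  have "overlap ((\<lambda>x. r *\<^sub>R x) ` B) z = (\<integral>x. indicator ((\<lambda>x. r *\<^sub>R x) ` B \<inter> {x. x + z \<in> (\<lambda>x. r *\<^sub>R x) ` B}) x \<partial>lborel)"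
    by (simp add: overlap_def)
  also have "\<dots> = r ^ DIM('a) * (\<integral>x. indicator ((\<lambda>x. r *\<^sub>R x) ` B \<inter> {x. x + z \<in> (\<lambda>x. r *\<^sub>R x) ` B}) (0 + r *\<^sub>R x) \<partial>lborel)"
    by (subst integral_lborel_affine[where c = r and t = 0]) (use r in auto)
  also have "(\<integral>x. indicator ((\<lambda>x. r *\<^sub>R x) ` B \<inter> {x. x + z \<in> (\<lambda>x. r *\<^sub>R x) ` B}) (0 + r *\<^sub>R x) \<partial>lborel)
     = (\<integral>x. indicator (B \<inter> {x. x + z /\<^sub>R r \<in> B}) x \<partial>(lborel :: 'a measure))"
    using r by (intro Bochner_Integration.integral_cong) (auto split: split_indicator simp: m scaleR_add_right)
  also have "\<dots> = overlap B (z /\<^sub>R r)" by (simp add: overlap_def)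
  finally show ?thesis .
qed

lemma (in pair_sigma_finite) integrable_product_mult:
  fixes f :: "'a \<Rightarrow> real" and g :: "'b \<Rightarrow> real"
  assumes f: "integrable M1 f" and g: "integrable M2 g"
  shows "integrable (M1 \<Otimes>\<^sub>M M2) (\<lambda>(x, y). f x * g y)"
proof (rule integrableI_bounded)
  have [measurable]: "f \<in> borel_measurable M1" "g \<in> borel_measurable M2"
    using f g by auto
  show "(\<lambda>(x, y). f x * g y) \<in> borel_measurable (M1 \<Otimes>\<^sub>M M2)" by measurable
  have "(\<integral>\<^sup>+p. ennreal (norm (case p of (x, y) \<Rightarrow> f x * g y)) \<partial>(M1 \<Otimes>\<^sub>M M2))
      = (\<integral>\<^sup>+x. \<integral>\<^sup>+y. ennreal (norm (f x)) * ennreal (norm (g y)) \<partial>M2 \<partial>M1)"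
    by (subst M2.nn_integral_fst[symmetric]) (auto simp: abs_mult ennreal_mult)
  also have "\<dots> = (\<integral>\<^sup>+x. ennreal (norm (f x)) \<partial>M1) * (\<integral>\<^sup>+y. ennreal (norm (g y)) \<partial>M2)"
    by (simp add: nn_integral_cmult nn_integral_multc)
  also have "\<dots> < \<infinity>"
    using f g by (simp add: integrable_iff_bounded ennreal_mult_less_top)
  finally show "(\<integral>\<^sup>+p. ennreal (norm (case p of (x, y) \<Rightarrow> f x * g y)) \<partial>(M1 \<Otimes>\<^sub>M M2)) < \<infinity>" .
qed

section \<open>The power spectrum of a set and Fourier inversion\<close>

definition spectrum :: "'a::euclidean_space set \<Rightarrow> 'a \<Rightarrow> real" where
  "spectrum B k = (cmod (fourier (indicator B) k))\<^sup>2"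

lemma spectrum_nonneg: "0 \<le> spectrum B k"
  by (simp add: spectrum_def)

context
  fixes B :: "'a::euclidean_space set"
  assumes B[measurable]: "B \<in> sets borel" and bB: "bounded B"
begin

text \<open>The squared modulus is the sum of the squared cosine and sine integrals. Written as
  double integrals these recombine, by the addition theorem, into the cosine of k . (y - x), to
  which the autocorrelation formula applies.\<close>

lemma spectrum_eq: "spectrum B k = (\<integral>z. overlap B z * cos (k \<bullet> z) \<partial>lborel)"
proof -
  have iB: "integrable lborel (indicat_real B)"
    using emeasure_bounded_finite[OF bB] by simp
  define C where "C = (\<integral>x. indicator B x * cos (k \<bullet> x) \<partial>lborel)"
  define S where "S = (\<integral>x. indicator B x * sin (k \<bullet> x) \<partial>lborel)"
  have iC: "integrable lborel (\<lambda>x. indicator B x * cos (k \<bullet> x))"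
    and iS: "integrable lborel (\<lambda>x. indicator B x * sin (k \<bullet> x))"
    by (rule Bochner_Integration.integrable_bound[OF iB]; auto split: split_indicator)+
  have ic: "integrable lborel (\<lambda>x. indicator B x * exp (- (\<i> * of_real (k \<bullet> x))))"
    by (rule Bochner_Integration.integrable_bound[OF iB]) (auto split: split_indicator)
  have re: "Re (indicator B x * exp (- (\<i> * of_real (k \<bullet> x)))) = indicator B x * cos (k \<bullet> x)"
    and im: "Im (indicator B x * exp (- (\<i> * of_real (k \<bullet> x)))) = - (indicator B x * sin (k \<bullet> x))" for x
    by (auto split: split_indicator simp: Re_exp Im_exp)
  have "Re (fourier (indicator B) k) = C"
    unfolding fourier_def C_def by (subst integral_Re[OF ic, symmetric]) (simp only: re)
  moreover have "Im (fourier (indicator B) k) = - S"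
    unfolding fourier_def S_def by (subst integral_Im[OF ic, symmetric]) (simp only: im Bochner_Integration.integral_minus)
  ultimately have "spectrum B k = C\<^sup>2 + S\<^sup>2"
    by (simp add: spectrum_def cmod_power2)
  also have "C\<^sup>2 + S\<^sup>2 = (\<integral>x. (indicator B x * cos (k \<bullet> x)) * C + (indicator B x * sin (k \<bullet> x)) * S \<partial>lborel)"
    by (simp only: Bochner_Integration.integral_add[OF integrable_mult_left[OF iC] integrable_mult_left[OF iS]]
        integral_mult_left_zero C_def[symmetric] S_def[symmetric] power2_eq_square)
  also have "\<dots> = (\<integral>x. \<integral>y. indicator B x * indicator B y * cos (k \<bullet> (y - x)) \<partial>lborel \<partial>lborel)"
  proof (rule Bochner_Integration.integral_cong[OF refl])
    fix x
    have "(\<integral>y. indicator B x * indicator B y * cos (k \<bullet> (y - x)) \<partial>lborel)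
      = (\<integral>y. (indicator B x * cos (k \<bullet> x)) * (indicator B y * cos (k \<bullet> y))
           + (indicator B x * sin (k \<bullet> x)) * (indicator B y * sin (k \<bullet> y)) \<partial>lborel)"
      by (intro Bochner_Integration.integral_cong refl) (simp add: inner_diff_right cos_diff algebra_simps)
    also have "\<dots> = (indicator B x * cos (k \<bullet> x)) * C + (indicator B x * sin (k \<bullet> x)) * S"
      by (simp only: Bochner_Integration.integral_add[OF integrable_mult_right[OF iC] integrable_mult_right[OF iS]]
        integral_mult_right_zero C_def[symmetric] S_def[symmetric])
    finally show "(indicator B x * cos (k \<bullet> x)) * C + (indicator B x * sin (k \<bullet> x)) * S
      = (\<integral>y. indicator B x * indicator B y * cos (k \<bullet> (y - x)) \<partial>lborel)" by simp
  qed
  also have "\<dots> = (\<integral>z. overlap B z * cos (k \<bullet> z) \<partial>lborel)"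
    by (rule integral_overlap[OF B bB, where b = 1]) auto
  finally show ?thesis .
qed

lemma spectrum_measurable[measurable]: "spectrum B \<in> borel_measurable borel"
  unfolding spectrum_eq[abs_def] by measurable

lemma integral_overlap_sin: "(\<integral>z. overlap B z * sin (k \<bullet> z) \<partial>lborel) = 0"
proof -
  have "(\<integral>z. overlap B (- z) * sin (k \<bullet> (- z)) \<partial>lborel) = (\<integral>z. overlap B z * sin (k \<bullet> z) \<partial>lborel)"
    by (rule integral_lborel_uminus) measurable
  then show ?thesis by (simp add: overlap_uminus[OF B bB])
qed

text \<open>The addition theorem produces a sine integral that vanishes because the overlap is even.
  The cosine of k . (w - z) on the right is what the Gaussian integral over k can be applied
  to.\<close>

lemma spectrum_mult_cos:
  "spectrum B k * cos (k \<bullet> z) = (\<integral>w. overlap B w * cos (k \<bullet> (w - z)) \<partial>lborel)"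
proof -
  have iB: "integrable lborel (overlap B)" using integrable_overlap[OF B bB, of 0] by simp
  have iC: "integrable lborel (\<lambda>x. overlap B x * cos (k \<bullet> x))"
    and iS: "integrable lborel (\<lambda>x. overlap B x * sin (k \<bullet> x))"
    by (rule Bochner_Integration.integrable_bound[OF iB];
      auto simp: abs_mult overlap_nonneg[OF B bB] mult_left_le)+
  have "(\<integral>w. overlap B w * cos (k \<bullet> (w - z)) \<partial>lborel)
    = (\<integral>w. (overlap B w * cos (k \<bullet> w)) * cos (k \<bullet> z) + (overlap B w * sin (k \<bullet> w)) * sin (k \<bullet> z) \<partial>lborel)"
    by (intro Bochner_Integration.integral_cong refl) (simp add: inner_diff_right cos_diff algebra_simps)
  also have "\<dots> = spectrum B k * cos (k \<bullet> z)"
    by (simp only: Bochner_Integration.integral_add[OF integrable_mult_left[OF iC] integrable_mult_left[OF iS]]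
        integral_mult_left_zero spectrum_eq[symmetric] integral_overlap_sin mult_zero_left add_0_right)
  finally show ?thesis by simp
qed

text \<open>Fourier inversion: both sides are regularised by the Gaussian \<open>exp (- t\<^sup>2 |k|\<^sup>2 / 4)\<close>.\<close>

lemma spectrum_gaussian:
  assumes t: "t > 0"
  shows "(\<integral>k. spectrum B k * exp (- (t\<^sup>2 / 4) * (norm k)\<^sup>2) * cos (k \<bullet> z) \<partial>lborel)
    = sqrt (4 * pi) ^ DIM('a) * (\<integral>v. overlap B (z + t *\<^sub>R v) * exp (- (norm v)\<^sup>2) \<partial>lborel)"
proof -
  \<comment> \<open>A Gaussian with parameter e has transform exp (- |x|^2 / (4 e)) = exp (- |x|^2 /
    t^2) up to a constant, so the substitution w = z + t v leaves exp (- |v|^2).\<close>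
  define e where "e = t\<^sup>2 / 4"
  have e: "e > 0" using t by (simp add: e_def)
  have iB: "integrable lborel (overlap B)" using integrable_overlap[OF B bB, of 0] by simp
  have ip: "integrable (lborel \<Otimes>\<^sub>M lborel) (\<lambda>(k, w). exp (- e * (norm k)\<^sup>2) * overlap B w * cos (k \<bullet> (w - z)))"
  proof (rule Bochner_Integration.integrable_bound)
    show "integrable (lborel \<Otimes>\<^sub>M lborel) (\<lambda>(k::'a, w). exp (- e * (norm k)\<^sup>2) * overlap B w)"
      by (rule lborel_pair.integrable_product_mult[OF integrable_gaussian[OF e] iB])
    show "(\<lambda>(k, w). exp (- e * (norm k)\<^sup>2) * overlap B w * cos (k \<bullet> (w - z))) \<in> borel_measurable (lborel \<Otimes>\<^sub>M lborel)"
      by measurable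
  qed (auto simp: abs_mult overlap_nonneg[OF B bB] mult_left_le)
  have "(\<integral>k. spectrum B k * exp (- e * (norm k)\<^sup>2) * cos (k \<bullet> z) \<partial>lborel)
    = (\<integral>k. \<integral>w. exp (- e * (norm k)\<^sup>2) * overlap B w * cos (k \<bullet> (w - z)) \<partial>lborel \<partial>lborel)"
  proof (rule Bochner_Integration.integral_cong[OF refl])
    fix k
    have "spectrum B k * exp (- e * (norm k)\<^sup>2) * cos (k \<bullet> z) = exp (- e * (norm k)\<^sup>2) * (spectrum B k * cos (k \<bullet> z))"
      by simp
    also have "\<dots> = (\<integral>w. exp (- e * (norm k)\<^sup>2) * (overlap B w * cos (k \<bullet> (w - z))) \<partial>lborel)"
      unfolding spectrum_mult_cos by simp
    finally show "spectrum B k * exp (- e * (norm k)\<^sup>2) * cos (k \<bullet> z) =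
      (\<integral>w. exp (- e * (norm k)\<^sup>2) * overlap B w * cos (k \<bullet> (w - z)) \<partial>lborel)"
      by (simp only: mult.assoc)
  qed
  also have "\<dots> = (\<integral>w. \<integral>k. exp (- e * (norm k)\<^sup>2) * overlap B w * cos (k \<bullet> (w - z)) \<partial>lborel \<partial>lborel)"
    by (rule lborel_pair.Fubini_integral[OF ip, symmetric])
  also have "\<dots> = (\<integral>w. overlap B w * (sqrt (pi / e) ^ DIM('a) * exp (- (norm (w - z))\<^sup>2 / (4 * e))) \<partial>lborel)"
  proof (rule Bochner_Integration.integral_cong[OF refl])
    fix w
    have "(\<integral>k. exp (- e * (norm k)\<^sup>2) * overlap B w * cos (k \<bullet> (w - z)) \<partial>lborel)
      = (\<integral>k. overlap B w * (exp (- e * (norm k)\<^sup>2) * cos ((w - z) \<bullet> k)) \<partial>lborel)"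
      by (intro Bochner_Integration.integral_cong refl) (simp add: inner_commute ac_simps)
    also have "\<dots> = overlap B w * (\<integral>k. exp (- e * (norm k)\<^sup>2) * cos ((w - z) \<bullet> k) \<partial>lborel)"
      by simp
    finally show "(\<integral>k. exp (- e * (norm k)\<^sup>2) * overlap B w * cos (k \<bullet> (w - z)) \<partial>lborel)
      = overlap B w * (sqrt (pi / e) ^ DIM('a) * exp (- (norm (w - z))\<^sup>2 / (4 * e)))"
      unfolding integral_gaussian_cos[OF e] .
  qed
  also have "\<dots> = t ^ DIM('a) * (\<integral>v. overlap B (z + t *\<^sub>R v) *
      (sqrt (pi / e) ^ DIM('a) * exp (- (norm (z + t *\<^sub>R v - z))\<^sup>2 / (4 * e))) \<partial>lborel)"
    by (subst integral_lborel_affine[where c = t and t = z]) (use t in auto)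
  also have "\<dots> = t ^ DIM('a) * (\<integral>v. sqrt (pi / e) ^ DIM('a) * (overlap B (z + t *\<^sub>R v) * exp (- (norm v)\<^sup>2)) \<partial>lborel)"
  proof -
    have "overlap B (z + t *\<^sub>R v) * (sqrt (pi / e) ^ DIM('a) * exp (- (norm (z + t *\<^sub>R v - z))\<^sup>2 / (4 * e)))
      = sqrt (pi / e) ^ DIM('a) * (overlap B (z + t *\<^sub>R v) * exp (- (norm v)\<^sup>2))" for v
      using t by (simp add: e_def power_mult_distrib)
    then show ?thesis by (simp only:)
  qed
  also have "\<dots> = (t * sqrt (pi / e)) ^ DIM('a) * (\<integral>v. overlap B (z + t *\<^sub>R v) * exp (- (norm v)\<^sup>2) \<partial>lborel)"
    by (simp add: power_mult_distrib)
  also have "t * sqrt (pi / e) = sqrt (4 * pi)"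
    using t by (simp add: e_def real_sqrt_divide real_sqrt_mult)
  finally show ?thesis unfolding e_def .
qed

text \<open>Let t tend to 0 in \<open>spectrum_gaussian\<close>. Integrability of the spectrum
  dominates the left side; on the right the null frontier makes the overlap continuous, so averages
  over shrinking Gaussian shifts converge to its value at z.\<close>

lemma overlap_inversion:
  assumes fr: "frontier B \<in> null_sets lborel" and i: "integrable lborel (spectrum B)"
  shows "(2 * pi) ^ DIM('a) * overlap B z = (\<integral>k. spectrum B k * cos (k \<bullet> z) \<partial>lborel)"
proof -
  define t where "t n = 1 / real (Suc n)" for n
  have t: "t n > 0" for n by (simp add: t_def)
  have t0: "t \<longlonglongrightarrow> 0" unfolding t_def[abs_def] by (rule LIMSEQ_Suc[OF lim_1_over_n])
  have L1: "(\<lambda>n. \<integral>k. spectrum B k * exp (- ((t n)\<^sup>2 / 4) * (norm k)\<^sup>2) * cos (k \<bullet> z) \<partial>lborel)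
    \<longlonglongrightarrow> (\<integral>k. spectrum B k * cos (k \<bullet> z) \<partial>lborel)"
  proof (rule integral_dominated_convergence[OF _ _ i])
    show "AE k in lborel. (\<lambda>n. spectrum B k * exp (- ((t n)\<^sup>2 / 4) * (norm k)\<^sup>2) * cos (k \<bullet> z))
        \<longlonglongrightarrow> spectrum B k * cos (k \<bullet> z)"
    proof (rule AE_I2)
      fix k
      have "(\<lambda>n. spectrum B k * exp (- ((t n)\<^sup>2 / 4) * (norm k)\<^sup>2) * cos (k \<bullet> z))
        \<longlonglongrightarrow> spectrum B k * exp (- (0\<^sup>2 / 4) * (norm k)\<^sup>2) * cos (k \<bullet> z)"
        by (intro tendsto_intros t0) auto
      then show "(\<lambda>n. spectrum B k * exp (- ((t n)\<^sup>2 / 4) * (norm k)\<^sup>2) * cos (k \<bullet> z))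
        \<longlonglongrightarrow> spectrum B k * cos (k \<bullet> z)" by simp
    qed
    show "AE k in lborel. norm (spectrum B k * exp (- ((t n)\<^sup>2 / 4) * (norm k)\<^sup>2) * cos (k \<bullet> z)) \<le> spectrum B k" for n
      by (rule AE_I2) (auto simp: abs_mult mult.assoc spectrum_nonneg intro!: mult_left_le mult_le_one)
  qed measurable
  have "(\<lambda>n. \<integral>v. overlap B (z + t n *\<^sub>R v) * exp (- (norm v)\<^sup>2) \<partial>lborel)
    \<longlonglongrightarrow> (\<integral>(v::'a). overlap B z * exp (- (norm v)\<^sup>2) \<partial>lborel)"
  proof (rule integral_dominated_convergence)
    show "integrable lborel (\<lambda>v::'a. measure lborel B * exp (- (norm v)\<^sup>2))"
      using integrable_gaussian[of 1, where 'a='a] by simp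
    show "AE v in lborel. (\<lambda>n. overlap B (z + t n *\<^sub>R v) * exp (- (norm v)\<^sup>2)) \<longlonglongrightarrow> overlap B z * exp (- (norm v)\<^sup>2)"
    proof (rule AE_I2)
      fix v
      have "(\<lambda>n. z + t n *\<^sub>R v) \<longlonglongrightarrow> z + 0 *\<^sub>R v" by (intro tendsto_intros t0)
      then have "(\<lambda>n. overlap B (z + t n *\<^sub>R v)) \<longlonglongrightarrow> overlap B z"
        by (intro overlap_tendsto[OF B bB fr]) simp
      then show "(\<lambda>n. overlap B (z + t n *\<^sub>R v) * exp (- (norm v)\<^sup>2)) \<longlonglongrightarrow> overlap B z * exp (- (norm v)\<^sup>2)"
        by (intro tendsto_intros)
    qed
    show "AE v in lborel. norm (overlap B (z + t n *\<^sub>R v) * exp (- (norm v)\<^sup>2)) \<le> measure lborel B * exp (- (norm v)\<^sup>2)" for n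
      by (rule AE_I2) (auto simp: overlap_nonneg[OF B bB] overlap_le[OF B bB])
  qed measurable
  then have L2: "(\<lambda>n. sqrt (4 * pi) ^ DIM('a) * (\<integral>v. overlap B (z + t n *\<^sub>R v) * exp (- (norm v)\<^sup>2) \<partial>lborel))
    \<longlonglongrightarrow> sqrt (4 * pi) ^ DIM('a) * (\<integral>(v::'a). overlap B z * exp (- (norm v)\<^sup>2) \<partial>lborel)"
    by (intro tendsto_intros)
  have "sqrt (4 * pi) ^ DIM('a) * (\<integral>(v::'a). overlap B z * exp (- (norm v)\<^sup>2) \<partial>lborel)
      = (sqrt (4 * pi) * sqrt pi) ^ DIM('a) * overlap B z"
    using integral_gaussian[of 1, where 'a='a] by (simp add: power_mult_distrib)
  also have "sqrt (4 * pi) * sqrt pi = 2 * pi"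
    by (simp add: real_sqrt_mult)
  finally have "sqrt (4 * pi) ^ DIM('a) * (\<integral>(v::'a). overlap B z * exp (- (norm v)\<^sup>2) \<partial>lborel)
      = (2 * pi) ^ DIM('a) * overlap B z" .
  with LIMSEQ_unique[OF L1[unfolded spectrum_gaussian[OF t]] L2] show ?thesis by (simp only:)
qed

end

text \<open>One factor r^d comes from the scaling of the overlap, the other from the substitution in
  its Fourier integral.\<close>

lemma spectrum_scaleR:
  fixes B :: "'a::euclidean_space set"
  assumes B[measurable]: "B \<in> sets borel" and bB: "bounded B" and r: "r > 0"
    and B': "(\<lambda>x. r *\<^sub>R x) ` B \<in> sets borel"
  shows "spectrum ((\<lambda>x. r *\<^sub>R x) ` B) k = r ^ (2 * DIM('a)) * spectrum B (r *\<^sub>R k)"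
proof -
  have "spectrum ((\<lambda>x. r *\<^sub>R x) ` B) k = (\<integral>z. overlap ((\<lambda>x. r *\<^sub>R x) ` B) z * cos (k \<bullet> z) \<partial>lborel)"
    by (rule spectrum_eq[OF B' bounded_scaling[OF bB]])
  also have "\<dots> = (\<integral>z. r ^ DIM('a) * (overlap B (z /\<^sub>R r) * cos (k \<bullet> z)) \<partial>lborel)"
    unfolding overlap_scaleR[OF B r] by (simp only: mult.assoc)
  also have "\<dots> = r ^ DIM('a) * (\<integral>z. overlap B (z /\<^sub>R r) * cos (k \<bullet> z) \<partial>lborel)"
    by simp
  also have "(\<integral>z. overlap B (z /\<^sub>R r) * cos (k \<bullet> z) \<partial>lborel)
     = r ^ DIM('a) * (\<integral>z. overlap B ((0 + r *\<^sub>R z) /\<^sub>R r) * cos (k \<bullet> (0 + r *\<^sub>R z)) \<partial>lborel)"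
    using r bB by (subst integral_lborel_affine[where c = r and t = 0]) auto
  also have "(\<integral>z. overlap B ((0 + r *\<^sub>R z) /\<^sub>R r) * cos (k \<bullet> (0 + r *\<^sub>R z)) \<partial>lborel) = spectrum B (r *\<^sub>R k)"
    unfolding spectrum_eq[OF B bB] using r by simp
  finally show ?thesis by (simp add: power_add mult_2)
qed

section \<open>Polynomially decaying weights\<close>

lemma le_suminf_ennreal:
  fixes f :: "nat \<Rightarrow> ennreal"
  shows "f n \<le> (\<Sum>m. f m)"
  using sum_le_suminf[OF summableI, of "{n}" f] by simp

text \<open>Dyadic shells: where 2^n \<le> 1 + |k| < 2^(n+1) the weight is at most 2^(-n q), on a
  ball of volume proportional to 2^(n d). The sum is a geometric series with ratio 2^(d - q) <
  1.\<close>

lemma integrable_powr_decay: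
  assumes q: "q > real DIM('a::euclidean_space)"
  shows "integrable lborel (\<lambda>k::'a. (1 + norm k) powr (- q))"
proof (rule integrableI_nonneg)
  let ?f = "\<lambda>n (k::'a). ennreal ((2 ^ n) powr (- q)) * indicator (ball 0 (2 ^ Suc n)) k"
  define V where "V = measure lborel (ball (0::'a) 1)"
  have ball_volume: "emeasure lborel (ball (0::'a) R) = ennreal (R ^ DIM('a) * V)" if "R \<ge> 0" for R
  proof -
    have "emeasure lborel (ball (0::'a) R) = ennreal (measure lborel (ball (0::'a) R))"
      by (rule emeasure_eq_ennreal_measure[OF emeasure_lborel_ball_finite[unfolded infinity_ennreal_def, THEN less_imp_neq]])
    then show ?thesis unfolding V_def content_ball_conv_unit_ball[OF that, of 0] .
  qed
  have "(\<integral>\<^sup>+k. ennreal ((1 + norm (k::'a)) powr (- q)) \<partial>lborel) \<le> (\<integral>\<^sup>+k. (\<Sum>n. ?f n k) \<partial>lborel)"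
  proof (rule nn_integral_mono)
    fix k :: 'a
    define n where "n = nat \<lfloor>log 2 (1 + norm k)\<rfloor>"
    have l0: "log 2 (1 + norm k) \<ge> 0" using zero_le_log_cancel_iff[of 2 "1 + norm k"] norm_ge_zero[of k] by linarith
    have r: "real n \<le> log 2 (1 + norm k)" "log 2 (1 + norm k) < real (Suc n)"
      unfolding n_def using l0 by linarith+
    have p: "2 powr (log 2 (1 + norm k)) = 1 + norm k"
      using norm_ge_zero[of k] by (intro powr_log_cancel) linarith+
    have "(2::real) ^ n = 2 powr real n" by (simp add: powr_realpow)
    also have "\<dots> \<le> 2 powr (log 2 (1 + norm k))" by (rule powr_mono[OF r(1)]) simp
    finally have lo: "2 ^ n \<le> 1 + norm k" unfolding p .
    have "2 powr (log 2 (1 + norm k)) < 2 powr real (Suc n)" by (rule powr_less_mono[OF r(2)]) simp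
    also have "\<dots> = 2 ^ Suc n" by (rule powr_realpow) simp
    finally have hi: "1 + norm k < 2 ^ Suc n" unfolding p .
    then have "k \<in> ball 0 (2 ^ Suc n)" by simp
    moreover have "(1 + norm k) powr (- q) \<le> (2 ^ n) powr (- q)"
      using q lo by (intro powr_mono2') auto
    ultimately have A: "ennreal ((1 + norm k) powr (- q)) \<le> ?f n k"
      by (simp add: ennreal_leI)
    note C = le_suminf_ennreal[of "\<lambda>m. ?f m k" n]
    show "ennreal ((1 + norm k) powr (- q)) \<le> (\<Sum>m. ?f m k)" by (rule order_trans[OF A C])
  qed
  also have "\<dots> = (\<Sum>n. ennreal ((2 ^ n) powr (- q)) * emeasure lborel (ball (0::'a) (2 ^ Suc n)))"
  proof -
    have b: "ball (0::'a) R \<in> sets lborel" for R by simp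
    have "?f n \<in> borel_measurable lborel" for n
      by (rule borel_measurable_times_ennreal[OF measurable_const borel_measurable_indicator[OF b]]) simp
    then have "(\<integral>\<^sup>+k. (\<Sum>n. ?f n k) \<partial>lborel) = (\<Sum>n. \<integral>\<^sup>+k. ?f n k \<partial>lborel)"
      by (rule nn_integral_suminf)
    also have "\<dots> = (\<Sum>n. ennreal ((2 ^ n) powr (- q)) * emeasure lborel (ball (0::'a) (2 ^ Suc n)))"
      by (rule suminf_cong[OF nn_integral_cmult_indicator[OF b]])
    finally show ?thesis .
  qed
  also have "\<dots> = (\<Sum>n. ennreal (2 ^ DIM('a) * V * (2 powr (real DIM('a) - q)) ^ n))"
  proof (intro suminf_cong)
    fix n
    have "ennreal ((2 ^ n) powr (- q)) * emeasure lborel (ball (0::'a) (2 ^ Suc n))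
       = ennreal ((2 ^ n) powr (- q)) * ennreal ((2 ^ Suc n) ^ DIM('a) * V)"
      by (subst ball_volume[OF zero_le_power[OF zero_le_numeral]]) (rule refl)
    also have "\<dots> = ennreal ((2 ^ n) powr (- q) * ((2 ^ Suc n) ^ DIM('a) * V))"
      by (rule ennreal_mult[symmetric]) (simp_all add: V_def)
    also have "(2 ^ n) powr (- q) * ((2 ^ Suc n) ^ DIM('a) * V) = 2 ^ DIM('a) * V * (2 powr (real DIM('a) - q)) ^ n"
    proof -
      have "(2 powr (real DIM('a) - q)) ^ n = 2 powr (real n * (real DIM('a) - q))"
        by (simp add: powr_powr mult.commute flip: powr_realpow)
      moreover have "(2 ^ n) powr (- q) = 2 powr (- (real n * q))"
        by (simp add: powr_powr flip: powr_realpow)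
      moreover have "(2 ^ Suc n) ^ DIM('a) = 2 ^ DIM('a) * (2::real) powr (real n * real DIM('a))"
        by (simp add: power_mult_distrib powr_realpow power_mult flip: of_nat_mult)
      ultimately show ?thesis by (simp add: right_diff_distrib powr_diff powr_minus field_simps)
    qed
    finally show "ennreal ((2 ^ n) powr (- q)) * emeasure lborel (ball (0::'a) (2 ^ Suc n))
       = ennreal (2 ^ DIM('a) * V * (2 powr (real DIM('a) - q)) ^ n)" .
  qed
  also have "\<dots> < \<infinity>"
  proof -
    define c where "c = (2::real) powr (real DIM('a) - q)"
    define b where "b = 2 ^ DIM('a) * V"
    have c0: "0 \<le> c" unfolding c_def by (rule powr_ge_zero)
    have "c < 2 powr 0" unfolding c_def using q by (intro powr_less_mono) linarith+
    then have c1: "c < 1" by simp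
    note c = c0 c1
    have b: "0 \<le> b" by (simp add: b_def V_def)
    have "summable (\<lambda>n. b * c ^ n)"
      using c by (intro summable_mult summable_geometric) simp
    then have "(\<Sum>n. ennreal (b * c ^ n)) \<noteq> top"
      using b c by (intro ennreal_suminf_neq_top) simp_all
    then show ?thesis unfolding c_def[symmetric] b_def[symmetric] by (simp flip: less_top)
  qed
  finally show "(\<integral>\<^sup>+k. ennreal ((1 + norm (k::'a)) powr (- q)) \<partial>lborel) < \<infinity>" .
qed simp_all

text \<open>Domination of the polynomial weight by its own convolution with a Gaussian lets bounds
  for Gaussian windows be summed into bounds for the weight. It follows from 1 + |k + h| \<le> (1 +
  |h|) (1 + |k|) by integrating over h.\<close>

lemma powr_decay_convolution:
  assumes q: "q > real DIM('a::euclidean_space)"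
  obtains c where "c > 0"
    "\<And>k::'a. ennreal (c * (1 + norm k) powr (- q))
       \<le> (\<integral>\<^sup>+l. ennreal ((1 + norm l) powr (- q)) * ennreal (exp (- (norm (k - l))\<^sup>2)) \<partial>lborel)"
proof
  define c where "c = (\<integral>(h::'a). (1 + norm h) powr (- q) * exp (- (norm h)\<^sup>2) \<partial>lborel)"
  have i: "integrable lborel (\<lambda>h::'a. (1 + norm h) powr (- q) * exp (- (norm h)\<^sup>2))"
    by (rule Bochner_Integration.integrable_bound[OF integrable_powr_decay[OF q]])
       (auto simp: abs_mult mult_left_le)
  \<comment> \<open>The integrand is positive everywhere, so a vanishing integral would force
    Lebesgue measure to be zero.\<close>
  have "c \<noteq> 0"
  proof
    assume "c = 0"
    moreover have "AE h in lborel. 0 \<le> (1 + norm (h::'a)) powr (- q) * exp (- (norm h)\<^sup>2)"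
      by (intro AE_I2 mult_nonneg_nonneg powr_ge_zero) simp
    ultimately have "AE h in lborel. (1 + norm (h::'a)) powr (- q) * exp (- (norm h)\<^sup>2) = 0"
      unfolding c_def using integral_nonneg_eq_0_iff_AE[OF i] by blast
    then have "AE h in (lborel :: 'a measure). False"
    proof (rule eventually_mono)
      fix h :: 'a
      assume "(1 + norm h) powr (- q) * exp (- (norm h)\<^sup>2) = 0"
      then have "1 + norm h = 0" by simp
      then show False using norm_ge_zero[of h] by linarith
    qed
    then have "emeasure lborel (space (lborel :: 'a measure)) = 0"
      by (simp only: eventually_False ae_filter_eq_bot_iff)
    then show False by (simp add: emeasure_lborel_UNIV)
  qed
  moreover have "c \<ge> 0" unfolding c_def
    by (intro Bochner_Integration.integral_nonneg mult_nonneg_nonneg powr_ge_zero) simp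
  ultimately show "c > 0" by simp
  fix k :: 'a
  have "ennreal (c * (1 + norm k) powr (- q)) =
     (\<integral>\<^sup>+(h::'a). ennreal ((1 + norm h) powr (- q) * exp (- (norm h)\<^sup>2) * (1 + norm k) powr (- q)) \<partial>lborel)"
  proof -
    have "(\<integral>\<^sup>+(h::'a). ennreal ((1 + norm h) powr (- q) * exp (- (norm h)\<^sup>2) * (1 + norm k) powr (- q)) \<partial>lborel)
      = ennreal (\<integral>(h::'a). (1 + norm h) powr (- q) * exp (- (norm h)\<^sup>2) * (1 + norm k) powr (- q) \<partial>lborel)"
      by (rule nn_integral_eq_integral[OF integrable_mult_left[OF i]]) simp
    then show ?thesis by (simp only: c_def integral_mult_left_zero)
  qed
  also have "\<dots> \<le> (\<integral>\<^sup>+h. ennreal ((1 + norm (k + h)) powr (- q)) * ennreal (exp (- (norm (k - (k + h)))\<^sup>2)) \<partial>lborel)"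
  proof (rule nn_integral_mono)
    fix h :: 'a
    have "1 + norm (k + h) \<le> (1 + norm h) * (1 + norm k)"
      using norm_triangle_ineq[of k h] mult_nonneg_nonneg[OF norm_ge_zero[of h] norm_ge_zero[of k]]
      unfolding distrib_left distrib_right by linarith
    then have "((1 + norm h) * (1 + norm k)) powr (- q) \<le> (1 + norm (k + h)) powr (- q)"
      using q by (intro powr_mono2') (simp_all add: add_pos_nonneg)
    then have "(1 + norm h) powr (- q) * (1 + norm k) powr (- q) \<le> (1 + norm (k + h)) powr (- q)"
      by (simp add: powr_mult)
    then have "(1 + norm h) powr (- q) * (1 + norm k) powr (- q) * exp (- (norm h)\<^sup>2) \<le> (1 + norm (k + h)) powr (- q) * exp (- (norm h)\<^sup>2)"
      by (rule mult_right_mono) simp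
    then show "ennreal ((1 + norm h) powr (- q) * exp (- (norm h)\<^sup>2) * (1 + norm k) powr (- q))
      \<le> ennreal ((1 + norm (k + h)) powr (- q)) * ennreal (exp (- (norm (k - (k + h)))\<^sup>2))"
      by (subst ennreal_mult[symmetric]) (auto intro!: ennreal_leI simp: ac_simps)
  qed
  also have "\<dots> = (\<integral>\<^sup>+l. ennreal ((1 + norm l) powr (- q)) * ennreal (exp (- (norm (k - l))\<^sup>2)) \<partial>lborel)"
    by (rule nn_integral_lborel_translate) measurable
  finally show "ennreal (c * (1 + norm k) powr (- q))
       \<le> (\<integral>\<^sup>+l. ennreal ((1 + norm l) powr (- q)) * ennreal (exp (- (norm (k - l))\<^sup>2)) \<partial>lborel)" .
qed

section \<open>Spectral analysis of the second moment measure\<close>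

text \<open>For the reduced second moment measure the shift inequality is Cauchy-Schwarz for the
  masses of B and of B - w, which have equal second moments by stationarity
  (\<open>overlap_shift_\<alpha>\<close>). It provides control of \<alpha> far from the
  origin.\<close>

locale shift_bounded_measure =
  fixes \<alpha> :: "'a::euclidean_space measure"
  assumes sets_\<alpha>[measurable_cong]: "sets \<alpha> = sets borel"
    and finite_\<alpha>: "\<And>B. B \<in> sets borel \<Longrightarrow> bounded B \<Longrightarrow> emeasure \<alpha> B < \<infinity>"
    and overlap_shift_le: "\<And>B w. B \<in> sets borel \<Longrightarrow> bounded B \<Longrightarrow>
      (\<integral>\<^sup>+z. ennreal (overlap B (z + w)) \<partial>\<alpha>) \<le> (\<integral>\<^sup>+z. ennreal (overlap B z) \<partial>\<alpha>)"
begin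

lemma space_\<alpha>[simp]: "space \<alpha> = UNIV"
  using sets_eq_imp_space_eq[OF sets_\<alpha>] by simp

lemma sigma_finite_\<alpha>: "sigma_finite_measure \<alpha>"
  by (rule sigma_finite_if_bounded_finite[OF sets_\<alpha> finite_\<alpha>])

lemma overlap_\<alpha>_finite:
  assumes B: "B \<in> sets borel" "bounded B"
  shows "(\<integral>\<^sup>+z. ennreal (overlap B z) \<partial>\<alpha>) < \<infinity>"
proof -
  obtain R where "\<forall>x\<in>B. norm x \<le> R" using B(2) unfolding bounded_iff by blast
  then have R: "B \<subseteq> cball 0 R" by auto
  have "(\<integral>\<^sup>+z. ennreal (overlap B z) \<partial>\<alpha>) \<le> (\<integral>\<^sup>+z. ennreal (measure lborel B) * indicator (cball 0 (2 * R)) z \<partial>\<alpha>)"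
  proof (rule nn_integral_mono)
    fix z
    show "ennreal (overlap B z) \<le> ennreal (measure lborel B) * indicator (cball 0 (2 * R)) z"
      using overlap_eq_0[OF B R, of z] overlap_le[OF B, of z]
      by (cases "norm z \<le> 2 * R") (auto intro: ennreal_leI)
  qed
  also have "\<dots> = ennreal (measure lborel B) * emeasure \<alpha> (cball 0 (2 * R))"
    by (rule nn_integral_cmult_indicator) (simp add: sets_\<alpha>)
  also have "\<dots> < \<infinity>" using finite_\<alpha>[of "cball 0 (2 * R)"] by (simp add: ennreal_mult_less_top)
  finally show ?thesis .
qed

text \<open>Where |z + w| \<le> 2 one has |w|^2 \<le> 2 |z|^2 + 8, hence exp (-4s) exp (-s |z|^2)
  \<le> exp (-(s/2) |w|^2); elsewhere the overlap of the unit ball at z + w vanishes. Integrating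
  this overlap over w gives the factor V^2 on the left, while on the right the shift inequality
  removes w from the integral against \<alpha>.\<close>

lemma integrable_gaussian_\<alpha>:
  assumes s: "s > 0"
  shows "integrable \<alpha> (\<lambda>z. exp (- s * (norm z)\<^sup>2))"
proof (rule integrableI_nonneg)
  let ?B = "cball (0::'a) 1"
  define V where "V = measure lborel ?B"
  have V: "V > 0" unfolding V_def using content_cball_pos[of 1 "0::'a"] by simp
  have B: "?B \<in> sets borel" "bounded ?B" by auto
  have s2: "s / 2 > 0" using s by simp
  note [measurable] = overlap_measurable[OF B(1)]
  have "ennreal (exp (- 4 * s) * V\<^sup>2) * (\<integral>\<^sup>+z. ennreal (exp (- s * (norm z)\<^sup>2)) \<partial>\<alpha>)
      = (\<integral>\<^sup>+z. ennreal (exp (- 4 * s) * exp (- s * (norm z)\<^sup>2)) * (ennreal V)\<^sup>2 \<partial>\<alpha>)"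
    by (subst nn_integral_cmult[symmetric])
      (auto intro!: nn_integral_cong simp: V_def ennreal_mult power2_eq_square ac_simps simp flip: ennreal_mult)
  also have "\<dots> = (\<integral>\<^sup>+z. \<integral>\<^sup>+w. ennreal (exp (- 4 * s) * exp (- s * (norm z)\<^sup>2)) * ennreal (overlap ?B (z + w)) \<partial>lborel \<partial>\<alpha>)"
    by (simp add: nn_integral_cmult nn_integral_overlap_total[OF B] V_def)
  also have "\<dots> \<le> (\<integral>\<^sup>+z. \<integral>\<^sup>+w. ennreal (exp (- (s / 2) * (norm w)\<^sup>2)) * ennreal (overlap ?B (z + w)) \<partial>lborel \<partial>\<alpha>)"
  proof (intro nn_integral_mono)
    fix z w :: 'a
    show "ennreal (exp (- 4 * s) * exp (- s * (norm z)\<^sup>2)) * ennreal (overlap ?B (z + w))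
      \<le> ennreal (exp (- (s / 2) * (norm w)\<^sup>2)) * ennreal (overlap ?B (z + w))"
    proof (cases "norm (z + w) \<le> 2")
      case True
      have "norm w \<le> norm z + 2" using norm_triangle_ineq4[of "z + w" z] True by simp
      then have "(norm w)\<^sup>2 \<le> (norm z + 2)\<^sup>2" by (intro power_mono) auto
      also have "\<dots> \<le> 2 * (norm z)\<^sup>2 + 8"
        using zero_le_power2[of "norm z - 2"] by (simp add: power2_eq_square algebra_simps)
      finally have "(s / 2) * (norm w)\<^sup>2 \<le> (s / 2) * (2 * (norm z)\<^sup>2 + 8)"
        using s by (intro mult_left_mono) auto
      also have "\<dots> = s * (norm z)\<^sup>2 + 4 * s" by (simp add: algebra_simps)
      finally have "exp (- 4 * s) * exp (- s * (norm z)\<^sup>2) \<le> exp (- (s / 2) * (norm w)\<^sup>2)"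
        unfolding exp_add[symmetric] by simp
      then show ?thesis by (intro mult_right_mono ennreal_leI) auto
    next
      case False
      then show ?thesis using overlap_eq_0[OF B subset_refl, of "z + w"] by simp
    qed
  qed
  also have "\<dots> = (\<integral>\<^sup>+w. \<integral>\<^sup>+z. ennreal (exp (- (s / 2) * (norm w)\<^sup>2)) * ennreal (overlap ?B (z + w)) \<partial>\<alpha> \<partial>lborel)"
  proof -
    interpret \<alpha>: sigma_finite_measure \<alpha> by (rule sigma_finite_\<alpha>)
    interpret pair_sigma_finite \<alpha> "lborel :: 'a measure" ..
    show ?thesis by (rule Fubini'[symmetric]) measurable
  qed
  also have "\<dots> = (\<integral>\<^sup>+w. ennreal (exp (- (s / 2) * (norm w)\<^sup>2)) * (\<integral>\<^sup>+z. ennreal (overlap ?B (z + w)) \<partial>\<alpha>) \<partial>lborel)"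
    by (intro nn_integral_cong nn_integral_cmult) measurable
  also have "\<dots> \<le> (\<integral>\<^sup>+(w::'a). ennreal (exp (- (s / 2) * (norm w)\<^sup>2)) * (\<integral>\<^sup>+z. ennreal (overlap ?B z) \<partial>\<alpha>) \<partial>lborel)"
    by (intro nn_integral_mono mult_left_mono overlap_shift_le[OF B]) auto
  also have "\<dots> = ennreal (\<integral>(w::'a). exp (- (s / 2) * (norm w)\<^sup>2) \<partial>lborel) * (\<integral>\<^sup>+z. ennreal (overlap ?B z) \<partial>\<alpha>)"
    by (subst nn_integral_multc, measurable, subst nn_integral_eq_integral[OF integrable_gaussian[OF s2]]) auto
  also have "\<dots> < \<infinity>"
    using overlap_\<alpha>_finite[OF B] by (simp add: ennreal_mult_less_top)
  finally have "ennreal (exp (- 4 * s) * V\<^sup>2) * (\<integral>\<^sup>+z. ennreal (exp (- s * (norm z)\<^sup>2)) \<partial>\<alpha>) < \<infinity>" .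
  then show "(\<integral>\<^sup>+z. ennreal (exp (- s * (norm z)\<^sup>2)) \<partial>\<alpha>) < \<infinity>"
    using V by (auto simp: ennreal_mult_less_top)
qed (simp_all add: sets_\<alpha>)

end

section \<open>Regularised spectral densities\<close>

text \<open>Here g stands for the squared intensity. \<open>pos_def\<close> is positive definiteness
  of \<alpha> - g * Lebesgue in the only form needed later: the Gaussian-damped Fourier transform is
  nonnegative at every frequency.\<close>

locale second_order_measure = shift_bounded_measure +
  fixes g :: real
  assumes g_nonneg: "0 \<le> g"
    and pos_def: "\<And>s k. 0 < s \<Longrightarrow> g * (\<integral>z. exp (- s * (norm z)\<^sup>2) * cos (k \<bullet> z) \<partial>lborel)
      \<le> (\<integral>z. exp (- s * (norm z)\<^sup>2) * cos (k \<bullet> z) \<partial>\<alpha>)"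
begin

text \<open>Integration against the covariance measure. Being a difference of two possibly infinite
  measures it is not a measure object, so the two integrals are subtracted instead; the value is
  meaningful when both exist.\<close>

definition cint :: "('a \<Rightarrow> real) \<Rightarrow> real" where
  "cint f = (\<integral>z. f z \<partial>\<alpha>) - g * (\<integral>z. f z \<partial>lborel)"

definition spec_density :: "real \<Rightarrow> 'a \<Rightarrow> real" where
  "spec_density s k = cint (\<lambda>z. exp (- s * (norm z)\<^sup>2) * cos (k \<bullet> z))"

lemma spec_density_nonneg: "0 < s \<Longrightarrow> 0 \<le> spec_density s k"
  using pos_def[of s k] by (simp add: spec_density_def cint_def)

lemma spec_density_measurable[measurable]: "spec_density s \<in> borel_measurable borel"
proof -
  interpret sigma_finite_measure \<alpha> by (rule sigma_finite_\<alpha>)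
  show ?thesis unfolding spec_density_def[abs_def] cint_def by measurable
qed

text \<open>The measure \<alpha> + g * Lebesgue is used here as a majorant of the variation of
  \<alpha> - g * Lebesgue.\<close>

definition gauss_mass :: "real \<Rightarrow> real" where
  "gauss_mass s = (\<integral>z. exp (- s * (norm z)\<^sup>2) \<partial>\<alpha>) + g * (\<integral>z. exp (- s * (norm (z::'a))\<^sup>2) \<partial>lborel)"

lemma abs_cint_le_gauss_mass:
  assumes s: "0 < s" and [measurable]: "f \<in> borel_measurable borel"
    and f: "\<And>z. \<bar>f z\<bar> \<le> exp (- s * (norm z)\<^sup>2)"
  shows "\<bar>cint f\<bar> \<le> gauss_mass s"
proof -
  have "\<bar>\<integral>z. f z \<partial>\<alpha>\<bar> \<le> (\<integral>z. exp (- s * (norm z)\<^sup>2) \<partial>\<alpha>)"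
  proof -
    have "integrable \<alpha> f"
      by (rule Bochner_Integration.integrable_bound[OF integrable_gaussian_\<alpha>[OF s]]) (use f in auto)
    then have "(\<integral>z. \<bar>f z\<bar> \<partial>\<alpha>) \<le> (\<integral>z. exp (- s * (norm z)\<^sup>2) \<partial>\<alpha>)"
      by (intro integral_mono integrable_abs integrable_gaussian_\<alpha>[OF s] f)
    with integral_abs_bound[of \<alpha> f] show ?thesis by linarith
  qed
  moreover have "\<bar>\<integral>z. f z \<partial>lborel\<bar> \<le> (\<integral>(z::'a). exp (- s * (norm z)\<^sup>2) \<partial>lborel)"
  proof -
    have "integrable lborel f"
      by (rule Bochner_Integration.integrable_bound[OF integrable_gaussian[OF s]]) (use f in auto)
    then have "(\<integral>z. \<bar>f z\<bar> \<partial>lborel) \<le> (\<integral>(z::'a). exp (- s * (norm z)\<^sup>2) \<partial>lborel)"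
      by (intro integral_mono integrable_abs integrable_gaussian[OF s] f)
    with integral_abs_bound[of lborel f] show ?thesis by linarith
  qed
  then have "g * \<bar>\<integral>z. f z \<partial>lborel\<bar> \<le> g * (\<integral>(z::'a). exp (- s * (norm z)\<^sup>2) \<partial>lborel)"
    using g_nonneg by (rule mult_left_mono)
  ultimately show ?thesis
    unfolding cint_def gauss_mass_def
    using abs_triangle_ineq4[of "\<integral>z. f z \<partial>\<alpha>" "g * (\<integral>z. f z \<partial>lborel)"] g_nonneg
    by (simp add: abs_mult)
qed

lemma abs_spec_density_le: "0 < s \<Longrightarrow> \<bar>spec_density s k\<bar> \<le> gauss_mass s"
  unfolding spec_density_def by (rule abs_cint_le_gauss_mass) (auto simp: abs_mult mult_left_le)

lemma integrable_mult_spec_density: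
  assumes s: "0 < s" and f: "integrable lborel f"
  shows "integrable lborel (\<lambda>k. f k * spec_density s k)"
proof (rule Bochner_Integration.integrable_bound)
  show "integrable lborel (\<lambda>k. f k * gauss_mass s)" using f by simp
  show "(\<lambda>k. f k * spec_density s k) \<in> borel_measurable lborel"
    using borel_measurable_integrable[OF f] by measurable
  have "0 \<le> gauss_mass s" using abs_spec_density_le[OF s, of 0] by linarith
  then show "AE k in lborel. norm (f k * spec_density s k) \<le> norm (f k * gauss_mass s)"
    using abs_spec_density_le[OF s] by (auto simp: abs_mult intro!: mult_left_mono)
qed

text \<open>Stated for a general measure because Fubini has to be applied to \<alpha> and to
  Lebesgue measure separately before the two are subtracted in \<open>cint\<close>.\<close>

lemma fubini_gaussian_cos:
  fixes h :: "'a \<Rightarrow> real" and \<mu> :: "'a measure"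
  assumes s: "0 < s" and h: "integrable lborel h"
    and "sigma_finite_measure \<mu>" and sets_\<mu>[measurable_cong]: "sets \<mu> = sets borel"
    and i: "integrable \<mu> (\<lambda>z. exp (- s * (norm z)\<^sup>2))"
  shows "integrable lborel (\<lambda>k. h k * (\<integral>z. exp (- s * (norm z)\<^sup>2) * cos (k \<bullet> z) \<partial>\<mu>))"
    and "(\<integral>k. h k * (\<integral>z. exp (- s * (norm z)\<^sup>2) * cos (k \<bullet> z) \<partial>\<mu>) \<partial>lborel)
      = (\<integral>z. exp (- s * (norm z)\<^sup>2) * (\<integral>k. h k * cos (k \<bullet> z) \<partial>lborel) \<partial>\<mu>)"
proof -
  interpret sigma_finite_measure \<mu> by fact
  interpret P: pair_sigma_finite lborel \<mu> ..
  have [measurable]: "h \<in> borel_measurable borel" using borel_measurable_integrable[OF h] by simp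
  have ip: "integrable (lborel \<Otimes>\<^sub>M \<mu>) (\<lambda>(k, z). h k * (exp (- s * (norm z)\<^sup>2) * cos (k \<bullet> z)))"
  proof (rule Bochner_Integration.integrable_bound[OF P.integrable_product_mult[OF h i]])
    show "(\<lambda>(k, z). h k * (exp (- s * (norm z)\<^sup>2) * cos (k \<bullet> z))) \<in> borel_measurable (lborel \<Otimes>\<^sub>M \<mu>)"
      by measurable
    show "AE p in lborel \<Otimes>\<^sub>M \<mu>. norm (case p of (k, z) \<Rightarrow> h k * (exp (- s * (norm z)\<^sup>2) * cos (k \<bullet> z)))
      \<le> norm (case p of (k, z) \<Rightarrow> h k * exp (- s * (norm z)\<^sup>2))"
      by (rule AE_I2) (auto simp: abs_mult intro!: mult_left_mono mult_left_le)
  qed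
  show "integrable lborel (\<lambda>k. h k * (\<integral>z. exp (- s * (norm z)\<^sup>2) * cos (k \<bullet> z) \<partial>\<mu>))"
    using P.integrable_fst'[OF ip] by simp
  have "(\<integral>k. h k * (\<integral>z. exp (- s * (norm z)\<^sup>2) * cos (k \<bullet> z) \<partial>\<mu>) \<partial>lborel)
     = (\<integral>k. \<integral>z. h k * (exp (- s * (norm z)\<^sup>2) * cos (k \<bullet> z)) \<partial>\<mu> \<partial>lborel)"
    by simp
  also have "\<dots> = (\<integral>z. \<integral>k. h k * (exp (- s * (norm z)\<^sup>2) * cos (k \<bullet> z)) \<partial>lborel \<partial>\<mu>)"
    by (rule P.Fubini_integral[OF ip, symmetric])
  also have "\<dots> = (\<integral>z. \<integral>k. exp (- s * (norm z)\<^sup>2) * (h k * cos (k \<bullet> z)) \<partial>lborel \<partial>\<mu>)"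
    by (simp only: mult.left_commute)
  finally show "(\<integral>k. h k * (\<integral>z. exp (- s * (norm z)\<^sup>2) * cos (k \<bullet> z) \<partial>\<mu>) \<partial>lborel)
      = (\<integral>z. exp (- s * (norm z)\<^sup>2) * (\<integral>k. h k * cos (k \<bullet> z) \<partial>lborel) \<partial>\<mu>)"
    by simp
qed

text \<open>A Parseval identity: integrals over frequencies become damped integrals of the cosine
  transform over space.\<close>

lemma integral_mult_spec_density:
  assumes s: "0 < s" and h: "integrable lborel h"
  shows "(\<integral>k. h k * spec_density s k \<partial>lborel)
    = cint (\<lambda>z. exp (- s * (norm z)\<^sup>2) * (\<integral>k. h k * cos (k \<bullet> z) \<partial>lborel))"
proof -
  note a = fubini_gaussian_cos[OF s h sigma_finite_\<alpha> sets_\<alpha> integrable_gaussian_\<alpha>[OF s]]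
  note l = fubini_gaussian_cos[OF s h lborel.sigma_finite_measure_axioms sets_lborel integrable_gaussian[OF s]]
  have "(\<integral>k. h k * spec_density s k \<partial>lborel)
    = (\<integral>k. h k * (\<integral>z. exp (- s * (norm z)\<^sup>2) * cos (k \<bullet> z) \<partial>\<alpha>)
        - g * (h k * (\<integral>z. exp (- s * (norm z)\<^sup>2) * cos (k \<bullet> z) \<partial>lborel)) \<partial>lborel)"
    by (simp only: spec_density_def cint_def right_diff_distrib mult.left_commute)
  also have "\<dots> = cint (\<lambda>z. exp (- s * (norm z)\<^sup>2) * (\<integral>k. h k * cos (k \<bullet> z) \<partial>lborel))"
    unfolding cint_def a(2)[symmetric] l(2)[symmetric]
    by (subst Bochner_Integration.integral_diff[OF a(1) integrable_mult_right[OF l(1)]]) simp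
  finally show ?thesis .
qed

lemma cint_cmult: "cint (\<lambda>z. c * f z) = c * cint f"
  by (simp add: cint_def algebra_simps)

text \<open>Uniform in both s and l. By Parseval the window in k becomes the factor exp (- |z|^2 /
  4) in z, while exp (- s |z|^2) is at most 1 and the position l only enters through a cosine. This
  replaces translation boundedness of a spectral measure.\<close>

lemma gaussian_spec_density_le:
  assumes s: "0 < s"
  shows "(\<integral>k. exp (- (norm (k - l))\<^sup>2) * spec_density s k \<partial>lborel) \<le> sqrt pi ^ DIM('a) * gauss_mass (1 / 4)"
proof -
  have i: "integrable lborel (\<lambda>k. exp (- (norm (k - l))\<^sup>2))"
    using integrable_lborel_affine[OF integrable_gaussian[of 1, where 'a='a], of 1 "- l"] by simp
  \<comment> \<open>After recentring at l the addition theorem gives a cosine and a sine integral of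
    a centred Gaussian; the sine integral is 0.\<close>
  have c: "(\<integral>k. exp (- (norm (k - l))\<^sup>2) * cos (k \<bullet> z) \<partial>lborel)
      = sqrt pi ^ DIM('a) * (exp (- (1 / 4) * (norm z)\<^sup>2) * cos (l \<bullet> z))" for z
  proof -
    have "(\<integral>k. exp (- (norm (k - l))\<^sup>2) * cos (k \<bullet> z) \<partial>lborel)
      = (\<integral>k. exp (- (norm (l + k - l))\<^sup>2) * cos ((l + k) \<bullet> z) \<partial>lborel)"
      by (rule integral_lborel_translate[symmetric]) measurable
    also have "\<dots> = (\<integral>k. cos (l \<bullet> z) * (exp (- 1 * (norm k)\<^sup>2) * cos (z \<bullet> k))
        - sin (l \<bullet> z) * (exp (- 1 * (norm k)\<^sup>2) * sin (z \<bullet> k)) \<partial>lborel)"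
      by (intro Bochner_Integration.integral_cong refl)
        (simp add: inner_add_left cos_add inner_commute[of _ z] algebra_simps)
    also have "\<dots> = sqrt pi ^ DIM('a) * (exp (- (1 / 4) * (norm z)\<^sup>2) * cos (l \<bullet> z))"
      by (subst Bochner_Integration.integral_diff)
        (simp_all add: integral_gaussian_cos[of 1 z, simplified] integral_gaussian_sin[of 1 z, simplified]
          integrable_gaussian_cos[of 1 z, simplified] integrable_gaussian_sin[of 1 z, simplified])
    finally show ?thesis .
  qed
  have "(\<integral>k. exp (- (norm (k - l))\<^sup>2) * spec_density s k \<partial>lborel)
    = sqrt pi ^ DIM('a) * cint (\<lambda>z. exp (- s * (norm z)\<^sup>2) * (exp (- (1 / 4) * (norm z)\<^sup>2) * cos (l \<bullet> z)))"
    unfolding integral_mult_spec_density[OF s i] c cint_cmult[symmetric]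
    by (simp only: mult.left_commute)
  also have "\<dots> \<le> sqrt pi ^ DIM('a) * gauss_mass (1 / 4)"
  proof (rule mult_left_mono)
    have "\<bar>cint (\<lambda>z. exp (- s * (norm z)\<^sup>2) * (exp (- (1 / 4) * (norm z)\<^sup>2) * cos (l \<bullet> z)))\<bar> \<le> gauss_mass (1 / 4)"
    proof (rule abs_cint_le_gauss_mass)
      fix z :: 'a
      have "exp (- s * (norm z)\<^sup>2) \<le> 1" using s by simp
      then have "exp (- s * (norm z)\<^sup>2) * (exp (- (1 / 4) * (norm z)\<^sup>2) * \<bar>cos (l \<bullet> z)\<bar>) \<le> 1 * (exp (- (1 / 4) * (norm z)\<^sup>2) * 1)"
        by (intro mult_mono) auto
      then show "\<bar>exp (- s * (norm z)\<^sup>2) * (exp (- (1 / 4) * (norm z)\<^sup>2) * cos (l \<bullet> z))\<bar> \<le> exp (- (1 / 4) * (norm z)\<^sup>2)"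
        by (simp add: abs_mult)
    qed (simp_all)
    then show "cint (\<lambda>z. exp (- s * (norm z)\<^sup>2) * (exp (- (1 / 4) * (norm z)\<^sup>2) * cos (l \<bullet> z))) \<le> gauss_mass (1 / 4)"
      by linarith
  qed simp
  finally show ?thesis .
qed

lemma integrable_gaussian_spec_density:
  assumes s: "0 < s"
  shows "integrable lborel (\<lambda>k. exp (- (norm (k - l))\<^sup>2) * spec_density s k)"
  using integrable_lborel_affine[OF integrable_gaussian[of 1, where 'a='a], of 1 "- l"]
  by (intro integrable_mult_spec_density[OF s]) simp

text \<open>The weight is replaced by its Gaussian convolution and the integrals are exchanged by
  Tonelli. The inner integral is then a Gaussian window of a nonnegative density, bounded uniformly,
  and the outer weight is integrable because q exceeds the dimension.\<close>

lemma powr_spec_density_le: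
  assumes q: "q > real DIM('a)"
  obtains C where "\<And>s. 0 < s \<Longrightarrow> (\<integral>k. (1 + norm k) powr (- q) * spec_density s k \<partial>lborel) \<le> C"
proof -
  let ?p = "\<lambda>k::'a. (1 + norm k) powr (- q)"
  obtain c where c: "c > 0" and conv: "\<And>k::'a. ennreal (c * ?p k)
       \<le> (\<integral>\<^sup>+l. ennreal (?p l) * ennreal (exp (- (norm (k - l))\<^sup>2)) \<partial>lborel)"
    using powr_decay_convolution[OF q] by blast
  define C1 where "C1 = sqrt pi ^ DIM('a) * gauss_mass (1 / 4)"
  define I where "I = (\<integral>k. ?p k \<partial>lborel)"
  have I0: "I \<ge> 0" unfolding I_def by (intro Bochner_Integration.integral_nonneg powr_ge_zero)
  have "0 \<le> gauss_mass (1 / 4)" using abs_spec_density_le[of "1/4" 0] by linarith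
  then have C10: "C1 \<ge> 0" by (simp add: C1_def)
  have ip: "(\<integral>\<^sup>+l. ennreal (?p l) \<partial>lborel) = ennreal I"
    unfolding I_def by (rule nn_integral_eq_integral[OF integrable_powr_decay[OF q]]) simp
  show ?thesis
  proof (rule that)
    fix s :: real assume s: "0 < s"
    note nn = spec_density_nonneg[OF s]
    have i: "integrable lborel (\<lambda>k. ?p k * spec_density s k)"
      by (rule integrable_mult_spec_density[OF s integrable_powr_decay[OF q]])
    have "ennreal (c * (\<integral>k. ?p k * spec_density s k \<partial>lborel)) = (\<integral>\<^sup>+k. ennreal (c * (?p k * spec_density s k)) \<partial>lborel)"
      by (subst nn_integral_eq_integral[OF integrable_mult_right[OF i]]) (use c nn in auto)
    also have "\<dots> = (\<integral>\<^sup>+k. ennreal (c * ?p k) * ennreal (spec_density s k) \<partial>lborel)"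
      using c nn by (intro nn_integral_cong) (simp add: mult.assoc flip: ennreal_mult)
    also have "\<dots> \<le> (\<integral>\<^sup>+k. (\<integral>\<^sup>+l. ennreal (?p l) * ennreal (exp (- (norm (k - l))\<^sup>2)) \<partial>lborel) * ennreal (spec_density s k) \<partial>lborel)"
      by (intro nn_integral_mono mult_right_mono conv) simp
    also have "\<dots> = (\<integral>\<^sup>+k. (\<integral>\<^sup>+l. ennreal (?p l) * ennreal (exp (- (norm (k - l))\<^sup>2)) * ennreal (spec_density s k) \<partial>lborel) \<partial>lborel)"
      by (intro nn_integral_cong nn_integral_multc[symmetric]) measurable
    also have "\<dots> = (\<integral>\<^sup>+l. (\<integral>\<^sup>+k. ennreal (?p l) * ennreal (exp (- (norm (k - l))\<^sup>2)) * ennreal (spec_density s k) \<partial>lborel) \<partial>lborel)"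
      by (rule lborel_pair.Fubini'[symmetric]) measurable
    also have "\<dots> \<le> (\<integral>\<^sup>+(l::'a). ennreal (?p l) * ennreal C1 \<partial>lborel)"
    proof (rule nn_integral_mono)
      fix l :: 'a
      have "(\<integral>\<^sup>+k. ennreal (?p l) * ennreal (exp (- (norm (k - l))\<^sup>2)) * ennreal (spec_density s k) \<partial>lborel)
        = (\<integral>\<^sup>+k. ennreal (?p l) * ennreal (exp (- (norm (k - l))\<^sup>2) * spec_density s k) \<partial>lborel)"
        using nn by (intro nn_integral_cong) (simp add: mult.assoc ennreal_mult)
      also have "\<dots> = ennreal (?p l) * (\<integral>\<^sup>+k. ennreal (exp (- (norm (k - l))\<^sup>2) * spec_density s k) \<partial>lborel)"
        by (rule nn_integral_cmult) measurable
      also have "(\<integral>\<^sup>+k. ennreal (exp (- (norm (k - l))\<^sup>2) * spec_density s k) \<partial>lborel)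
         = ennreal (\<integral>k. exp (- (norm (k - l))\<^sup>2) * spec_density s k \<partial>lborel)"
        by (rule nn_integral_eq_integral[OF integrable_gaussian_spec_density[OF s]]) (use nn in auto)
      also have "ennreal (?p l) * \<dots> \<le> ennreal (?p l) * ennreal C1"
        unfolding C1_def by (intro mult_left_mono ennreal_leI gaussian_spec_density_le[OF s]) simp
      finally show "(\<integral>\<^sup>+k. ennreal (?p l) * ennreal (exp (- (norm (k - l))\<^sup>2)) * ennreal (spec_density s k) \<partial>lborel)
         \<le> ennreal (?p l) * ennreal C1" .
    qed
    also have "\<dots> = ennreal I * ennreal C1"
      by (subst nn_integral_multc) (simp_all add: ip)
    also have "\<dots> = ennreal (I * C1)" using I0 C10 by (simp add: ennreal_mult)
    finally have "c * (\<integral>k. ?p k * spec_density s k \<partial>lborel) \<le> I * C1"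
      using I0 C10 by (subst (asm) ennreal_le_iff) auto
    then show "(\<integral>k. ?p k * spec_density s k \<partial>lborel) \<le> I * C1 / c"
      using c by (simp add: field_simps)
  qed
qed

section \<open>Covariances with randomly shifted overlaps\<close>

text \<open>With the point mass at 0 as \<open>R\<close> this becomes the variance of the original
  random measure (\<open>variance_\<Phi>\<close>), so both quantities to be compared are values of
  one functional.\<close>

definition cov :: "'a measure \<Rightarrow> 'a set \<Rightarrow> real" where
  "cov R B = (\<integral>z. (\<integral>w. overlap B (z + w) \<partial>R) \<partial>\<alpha>) - g * (measure lborel B)\<^sup>2"

lemma cov_return_0:
  "B \<in> sets borel \<Longrightarrow> cov (return borel 0) B = (\<integral>z. overlap B z \<partial>\<alpha>) - g * (measure lborel B)\<^sup>2"
  unfolding cov_def by (subst integral_return) auto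

context
  fixes R :: "'a measure" and B :: "'a set"
  assumes R: "prob_space R" and sets_R[measurable_cong]: "sets R = sets borel"
    and B[measurable]: "B \<in> sets borel" and bB: "bounded B"
begin

interpretation R: prob_space R by (rule R)

lemma overlap_shift_integrable_R: "integrable R (\<lambda>w. overlap B (z + w))"
  by (rule R.integrable_const_bound[where B = "measure lborel B"])
    (auto simp: overlap_nonneg[OF B bB] overlap_le[OF B bB])

lemma mean_overlap_nonneg: "0 \<le> (\<integral>w. overlap B (z + w) \<partial>R)"
  by (intro Bochner_Integration.integral_nonneg overlap_nonneg[OF B bB])

lemma mean_overlap_measurable[measurable]: "(\<lambda>z. \<integral>w. overlap B (z + w) \<partial>R) \<in> borel_measurable borel"
  by measurable

lemma mean_overlap_eq_nn: "ennreal (\<integral>w. overlap B (z + w) \<partial>R) = (\<integral>\<^sup>+w. ennreal (overlap B (z + w)) \<partial>R)"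
  by (rule nn_integral_eq_integral[OF overlap_shift_integrable_R, symmetric])
    (simp add: overlap_nonneg[OF B bB])

lemma nn_integral_mean_overlap:
  assumes "sigma_finite_measure \<mu>" and [measurable_cong]: "sets \<mu> = sets borel"
  shows "(\<integral>\<^sup>+z. ennreal (\<integral>w. overlap B (z + w) \<partial>R) \<partial>\<mu>) = (\<integral>\<^sup>+w. (\<integral>\<^sup>+z. ennreal (overlap B (z + w)) \<partial>\<mu>) \<partial>R)"
proof -
  interpret sigma_finite_measure \<mu> by fact
  interpret P: pair_sigma_finite \<mu> R ..
  show ?thesis unfolding mean_overlap_eq_nn by (rule P.Fubini'[symmetric]) measurable
qed

lemma nn_integral_mean_overlap_le:
  "(\<integral>\<^sup>+z. ennreal (\<integral>w. overlap B (z + w) \<partial>R) \<partial>\<alpha>) \<le> (\<integral>\<^sup>+z. ennreal (overlap B z) \<partial>\<alpha>)"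
proof -
  have "(\<integral>\<^sup>+z. ennreal (\<integral>w. overlap B (z + w) \<partial>R) \<partial>\<alpha>) \<le> (\<integral>\<^sup>+w. (\<integral>\<^sup>+z. ennreal (overlap B z) \<partial>\<alpha>) \<partial>R)"
    unfolding nn_integral_mean_overlap[OF sigma_finite_\<alpha> sets_\<alpha>]
    by (intro nn_integral_mono overlap_shift_le[OF B bB])
  also have "\<dots> = (\<integral>\<^sup>+z. ennreal (overlap B z) \<partial>\<alpha>)"
    by (simp add: R.emeasure_space_1)
  finally show ?thesis .
qed

lemma integrable_mean_overlap_\<alpha>: "integrable \<alpha> (\<lambda>z. \<integral>w. overlap B (z + w) \<partial>R)"
  by (rule integrableI_nonneg)
    (use nn_integral_mean_overlap_le overlap_\<alpha>_finite[OF B bB] mean_overlap_nonneg in auto)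

lemma nn_integral_mean_overlap_lborel:
  "(\<integral>\<^sup>+z. ennreal (\<integral>w. overlap B (z + w) \<partial>R) \<partial>lborel) = ennreal ((measure lborel B)\<^sup>2)"
proof -
  have "(\<integral>\<^sup>+z. ennreal (overlap B (z + w)) \<partial>lborel) = ennreal ((measure lborel B)\<^sup>2)" for w
    using nn_integral_overlap_total[OF B bB, of w] by (simp add: add.commute power2_eq_square ennreal_mult)
  then show ?thesis
    unfolding nn_integral_mean_overlap[OF lborel.sigma_finite_measure_axioms sets_lborel]
    by (simp add: R.emeasure_space_1)
qed

lemma integrable_mean_overlap_lborel: "integrable lborel (\<lambda>z. \<integral>w. overlap B (z + w) \<partial>R)"
  by (rule integrableI_nonneg)
    (use nn_integral_mean_overlap_lborel mean_overlap_nonneg in auto)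

lemma integral_mean_overlap_lborel: "(\<integral>z. (\<integral>w. overlap B (z + w) \<partial>R) \<partial>lborel) = (measure lborel B)\<^sup>2"
  using nn_integral_mean_overlap_lborel mean_overlap_nonneg
  by (subst integral_eq_nn_integral) auto

text \<open>The Lebesgue integral of the mean overlap is the squared volume for every law
  \<open>R\<close>, so the subtracted constant can be absorbed into \<open>cint\<close>.\<close>

lemma cov_eq_cint: "cov R B = cint (\<lambda>z. \<integral>w. overlap B (z + w) \<partial>R)"
  by (simp add: cov_def cint_def integral_mean_overlap_lborel)

text \<open>Symmetry of \<open>R\<close> makes its characteristic function real. Averaging over
  shifts therefore only multiplies the spectrum by the mean of cos (k . w).\<close>

lemma mean_overlap_inversion:
  assumes fr: "frontier B \<in> null_sets lborel" and i: "integrable lborel (spectrum B)"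
    and sym: "distr R borel uminus = R"
  shows "(2 * pi) ^ DIM('a) * (\<integral>w. overlap B (z + w) \<partial>R)
    = (\<integral>k. spectrum B k * (\<integral>w. cos (k \<bullet> w) \<partial>R) * cos (k \<bullet> z) \<partial>lborel)"
proof -
  have [measurable]: "spectrum B \<in> borel_measurable borel" by (rule spectrum_measurable[OF B bB])
  interpret P: pair_sigma_finite R "lborel :: 'a measure" ..
  have sin0: "(\<integral>w. sin (k \<bullet> w) \<partial>R) = 0" for k
  proof -
    have "(\<integral>w. sin (k \<bullet> w) \<partial>R) = (\<integral>w. sin (k \<bullet> w) \<partial>distr R borel uminus)" by (simp only: sym)
    also have "\<dots> = - (\<integral>w. sin (k \<bullet> w) \<partial>R)" by (subst integral_distr) auto
    finally show ?thesis by simp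
  qed
  have ic: "integrable R (\<lambda>w. cos (k \<bullet> w))" and isn: "integrable R (\<lambda>w. sin (k \<bullet> w))" for k
    by (auto intro!: R.integrable_const_bound[where B = 1])
  have ip: "integrable (R \<Otimes>\<^sub>M lborel) (\<lambda>(w, k). spectrum B k * cos (k \<bullet> (z + w)))"
  proof (rule Bochner_Integration.integrable_bound[OF P.integrable_product_mult[OF R.integrable_const[of 1] i]])
    show "(\<lambda>(w, k). spectrum B k * cos (k \<bullet> (z + w))) \<in> borel_measurable (R \<Otimes>\<^sub>M lborel)" by measurable
  qed (intro AE_I2, auto simp: abs_mult intro!: mult_left_le)
  have "(2 * pi) ^ DIM('a) * (\<integral>w. overlap B (z + w) \<partial>R) = (\<integral>w. (2 * pi) ^ DIM('a) * overlap B (z + w) \<partial>R)"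
    by simp
  also have "\<dots> = (\<integral>w. \<integral>k. spectrum B k * cos (k \<bullet> (z + w)) \<partial>lborel \<partial>R)"
    by (simp only: overlap_inversion[OF B bB fr i])
  also have "\<dots> = (\<integral>k. \<integral>w. spectrum B k * cos (k \<bullet> (z + w)) \<partial>R \<partial>lborel)"
    by (rule P.Fubini_integral[OF ip, symmetric])
  also have "\<dots> = (\<integral>k. spectrum B k * (\<integral>w. cos (k \<bullet> w) \<partial>R) * cos (k \<bullet> z) \<partial>lborel)"
  proof (rule Bochner_Integration.integral_cong[OF refl])
    fix k
    have "(\<integral>w. cos (k \<bullet> (z + w)) \<partial>R) = (\<integral>w. cos (k \<bullet> z) * cos (k \<bullet> w) - sin (k \<bullet> z) * sin (k \<bullet> w) \<partial>R)"
      by (simp add: inner_add_right cos_add)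
    also have "\<dots> = cos (k \<bullet> z) * (\<integral>w. cos (k \<bullet> w) \<partial>R)"
      by (subst Bochner_Integration.integral_diff[OF integrable_mult_right[OF ic] integrable_mult_right[OF isn]])
        (simp add: sin0)
    finally show "(\<integral>w. spectrum B k * cos (k \<bullet> (z + w)) \<partial>R) = spectrum B k * (\<integral>w. cos (k \<bullet> w) \<partial>R) * cos (k \<bullet> z)"
      by simp
  qed
  finally show ?thesis .
qed

lemma abs_char_le: "\<bar>\<integral>w. cos (k \<bullet> w) \<partial>R\<bar> \<le> 1"
proof -
  have "\<bar>\<integral>w. cos (k \<bullet> w) \<partial>R\<bar> \<le> (\<integral>w. \<bar>cos (k \<bullet> w)\<bar> \<partial>R)" by (rule integral_abs_bound)
  also have "\<dots> \<le> (\<integral>w. 1 \<partial>R)"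
    by (intro integral_mono R.integrable_const_bound[where B = 1]) auto
  finally show ?thesis by (simp add: R.prob_space)
qed

lemma integrable_spectrum_char:
  assumes i: "integrable lborel (spectrum B)"
  shows "integrable lborel (\<lambda>k. spectrum B k * (\<integral>w. cos (k \<bullet> w) \<partial>R))"
proof (rule Bochner_Integration.integrable_bound[OF i])
  have [measurable]: "spectrum B \<in> borel_measurable borel" by (rule spectrum_measurable[OF B bB])
  show "(\<lambda>k. spectrum B k * (\<integral>w. cos (k \<bullet> w) \<partial>R)) \<in> borel_measurable lborel" by measurable
qed (auto simp: abs_mult abs_char_le intro!: mult_left_le)

lemma cint_gaussian_tendsto:
  assumes t: "\<And>n. 0 < t n" "t \<longlonglongrightarrow> 0"
  shows "(\<lambda>n. cint (\<lambda>z. exp (- t n * (norm z)\<^sup>2) * (\<integral>w. overlap B (z + w) \<partial>R))) \<longlonglongrightarrow> cov R B"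
proof -
  have *: "(\<lambda>n. \<integral>z. exp (- t n * (norm z)\<^sup>2) * (\<integral>w. overlap B (z + w) \<partial>R) \<partial>\<mu>) \<longlonglongrightarrow> (\<integral>z. (\<integral>w. overlap B (z + w) \<partial>R) \<partial>\<mu>)"
    if i: "integrable \<mu> (\<lambda>z. \<integral>w. overlap B (z + w) \<partial>R)" and [measurable_cong]: "sets \<mu> = sets borel" for \<mu>
  proof (rule integral_dominated_convergence[OF _ _ i])
    show "AE z in \<mu>. (\<lambda>n. exp (- t n * (norm z)\<^sup>2) * (\<integral>w. overlap B (z + w) \<partial>R)) \<longlonglongrightarrow> (\<integral>w. overlap B (z + w) \<partial>R)"
    proof (rule AE_I2)
      fix z
      have "(\<lambda>n. exp (- t n * (norm z)\<^sup>2) * (\<integral>w. overlap B (z + w) \<partial>R)) \<longlonglongrightarrow> exp (- 0 * (norm z)\<^sup>2) * (\<integral>w. overlap B (z + w) \<partial>R)"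
        by (intro tendsto_intros t(2))
      then show "(\<lambda>n. exp (- t n * (norm z)\<^sup>2) * (\<integral>w. overlap B (z + w) \<partial>R)) \<longlonglongrightarrow> (\<integral>w. overlap B (z + w) \<partial>R)" by simp
    qed
    show "AE z in \<mu>. norm (exp (- t n * (norm z)\<^sup>2) * (\<integral>w. overlap B (z + w) \<partial>R)) \<le> (\<integral>w. overlap B (z + w) \<partial>R)" for n
      using t(1)[of n] mean_overlap_nonneg by (intro AE_I2) (simp add: abs_mult mult_left_le_one_le)
  qed measurable
  show ?thesis
    unfolding cov_eq_cint unfolding cint_def
    by (intro tendsto_intros * integrable_mean_overlap_\<alpha> integrable_mean_overlap_lborel sets_\<alpha> sets_lborel)
qed

text \<open>Parseval with the spectrum times the characteristic function as test function; dominated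
  convergence then removes the Gaussian damping.\<close>

lemma spectral_tendsto:
  assumes fr: "frontier B \<in> null_sets lborel" and i: "integrable lborel (spectrum B)"
    and sym: "distr R borel uminus = R"
    and t: "\<And>n. 0 < t n" "t \<longlonglongrightarrow> 0"
  shows "(\<lambda>n. \<integral>k. spectrum B k * (\<integral>w. cos (k \<bullet> w) \<partial>R) * spec_density (t n) k \<partial>lborel)
    \<longlonglongrightarrow> (2 * pi) ^ DIM('a) * cov R B"
proof -
  have "(\<integral>k. spectrum B k * (\<integral>w. cos (k \<bullet> w) \<partial>R) * spec_density (t n) k \<partial>lborel)
    = (2 * pi) ^ DIM('a) * cint (\<lambda>z. exp (- t n * (norm z)\<^sup>2) * (\<integral>w. overlap B (z + w) \<partial>R))" for n
    unfolding integral_mult_spec_density[OF t(1) integrable_spectrum_char[OF i]]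
      mean_overlap_inversion[OF fr i sym, symmetric] cint_cmult[symmetric]
    by (simp only: mult.left_commute)
  then show ?thesis
    using tendsto_mult_left[OF cint_gaussian_tendsto[OF t], of "(2 * pi) ^ DIM('a)"] by simp
qed

end

end

section \<open>The covariance difference for Fourier smooth sets\<close>

lemma frontier_convex_null:
  fixes W :: "'a::euclidean_space set"
  assumes "convex W"
  shows "frontier W \<in> null_sets lborel"
  using negligible_convex_frontier[OF assms] frontier_closed[of W]
  by (auto simp: negligible_iff_null_sets null_sets_completion_iff borel_closed)

text \<open>Volume is the overlap at shift 0, so the scaling rule for overlaps applies.\<close>

lemma measure_scaleR_image:
  fixes W :: "'a::euclidean_space set"
  assumes "W \<in> sets borel" "bounded W" and r: "r > 0"
  shows "measure lborel ((\<lambda>x. r *\<^sub>R x) ` W) = r ^ DIM('a) * measure lborel W"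
  using overlap_scaleR[OF assms(1) r, of 0] assms
  by (simp add: overlap_0 scaleR_image_sets bounded_scaling)

text \<open>Continuity of the characteristic function at the origin, by dominated convergence along
  sequences. Halving the radius turns the strict distance condition into a closed one.\<close>

lemma cos_mean_near_1:
  fixes R :: "'a::euclidean_space measure"
  assumes "prob_space R" and [measurable_cong]: "sets R = sets borel" and d: "0 < d"
  obtains e where "0 < e" "\<And>k. norm k \<le> e \<Longrightarrow> 1 - (\<integral>w. cos (k \<bullet> w) \<partial>R) \<le> d"
proof -
  interpret prob_space R by fact
  have "((\<lambda>k. \<integral>w. cos (k \<bullet> w) \<partial>R) \<longlongrightarrow> (\<integral>w. cos (0 \<bullet> w) \<partial>R)) (at (0::'a))"
    unfolding tendsto_at_iff_sequentially comp_def
  proof safe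
    fix X :: "nat \<Rightarrow> 'a" assume X: "X \<longlonglongrightarrow> 0"
    show "(\<lambda>n. \<integral>w. cos (X n \<bullet> w) \<partial>R) \<longlonglongrightarrow> (\<integral>w. cos (0 \<bullet> w) \<partial>R)"
    proof (rule integral_dominated_convergence[where w = "\<lambda>_. 1"])
      show "AE w in R. (\<lambda>n. cos (X n \<bullet> w)) \<longlonglongrightarrow> cos (0 \<bullet> w)"
        by (intro AE_I2 tendsto_intros X)
    qed auto
  qed
  then have "((\<lambda>k. \<integral>w. cos (k \<bullet> w) \<partial>R) \<longlongrightarrow> 1) (at (0::'a))"
    by (simp add: prob_space)
  then obtain s where s: "s > 0" "\<And>k. k \<noteq> 0 \<Longrightarrow> dist k 0 < s \<Longrightarrow> dist (\<integral>w. cos (k \<bullet> w) \<partial>R) 1 < d"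
    using d unfolding tendsto_iff eventually_at by (metis UNIV_I)
  show ?thesis
  proof (rule that[of "s / 2"])
    fix k :: 'a assume k: "norm k \<le> s / 2"
    show "1 - (\<integral>w. cos (k \<bullet> w) \<partial>R) \<le> d"
    proof (cases "k = 0")
      case True then show ?thesis using d by (simp add: prob_space)
    next
      case False
      then have "dist (\<integral>w. cos (k \<bullet> w) \<partial>R) 1 < d" using k s(1) by (intro s(2)) auto
      then show ?thesis by (simp add: dist_real_def)
    qed
  qed (use s in simp)
qed

context second_order_measure
begin

context
  fixes R :: "'a measure"
  assumes R: "prob_space R" and sets_R[measurable_cong]: "sets R = sets borel"
    and sym: "distr R borel uminus = R"
begin

text \<open>For each damping parameter the integrand is (1 - \<rho>) times the spectrum times a
  nonnegative density, with \<rho> the characteristic function of \<open>R\<close>. Below frequency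
  e the first factor is at most d; above e it is at most 2, and the spectrum is at most A times the
  weight whose integral C bounds uniformly. The estimate survives the limit because C does not
  depend on the damping.\<close>

lemma cov_difference_le:
  assumes B[measurable]: "B \<in> sets borel" and bB: "bounded B"
    and fr: "frontier B \<in> null_sets lborel" and i: "integrable lborel (spectrum B)"
    and q: "q > real DIM('a)"
    and C: "\<And>s. 0 < s \<Longrightarrow> (\<integral>k. (1 + norm k) powr (- q) * spec_density s k \<partial>lborel) \<le> C"
    and d: "0 \<le> d" "\<And>k. norm k \<le> e \<Longrightarrow> 1 - (\<integral>w. cos (k \<bullet> w) \<partial>R) \<le> d"
    and A: "0 \<le> A" "\<And>k. e < norm k \<Longrightarrow> spectrum B k \<le> A * (1 + norm k) powr (- q)"
  shows "(2 * pi) ^ DIM('a) * (cov (return borel 0) B - cov R B)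
    \<le> d * ((2 * pi) ^ DIM('a) * cov (return borel 0) B) + 2 * A * C"
proof -
  define t where "t n = 1 / real (Suc n)" for n
  have t: "t n > 0" for n by (simp add: t_def)
  have t0: "t \<longlonglongrightarrow> 0" unfolding t_def[abs_def] by (rule LIMSEQ_Suc[OF lim_1_over_n])
  let ?\<rho> = "\<lambda>k. \<integral>w. cos (k \<bullet> w) \<partial>R"
  let ?c = "(2 * pi) ^ DIM('a)"
  have L0: "(\<lambda>n. \<integral>k. spectrum B k * spec_density (t n) k \<partial>lborel) \<longlonglongrightarrow> ?c * cov (return borel 0) B"
  proof -
    \<comment> \<open>The point mass at 0 is a symmetric law with characteristic function 1, so the
      same limit statement covers the unshifted covariance.\<close>
    have "distr (return borel (0::'a)) borel uminus = return borel 0"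
      by (subst distr_return) auto
    from spectral_tendsto[OF prob_space_return sets_return B bB fr i this t t0]
    show ?thesis by (simp add: integral_return)
  qed
  note LR = spectral_tendsto[OF R sets_R B bB fr i sym t t0]
  have "(\<integral>k. spectrum B k * spec_density (t n) k \<partial>lborel) - (\<integral>k. spectrum B k * ?\<rho> k * spec_density (t n) k \<partial>lborel)
    \<le> d * (\<integral>k. spectrum B k * spec_density (t n) k \<partial>lborel) + 2 * A * C" for n
  proof -
    let ?f = "spec_density (t n)"
    let ?p = "\<lambda>k. (1 + norm k) powr (- q) * ?f k"
    have i0: "integrable lborel (\<lambda>k. spectrum B k * ?f k)"
      by (rule integrable_mult_spec_density[OF t i])
    have i1: "integrable lborel (\<lambda>k. spectrum B k * ?\<rho> k * ?f k)"
      by (rule integrable_mult_spec_density[OF t integrable_spectrum_char[OF R sets_R B bB i]])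
    have i2: "integrable lborel ?p"
      by (rule integrable_mult_spec_density[OF t integrable_powr_decay[OF q]])
    have "(\<integral>k. spectrum B k * ?f k \<partial>lborel) - (\<integral>k. spectrum B k * ?\<rho> k * ?f k \<partial>lborel)
      = (\<integral>k. spectrum B k * ?f k - spectrum B k * ?\<rho> k * ?f k \<partial>lborel)"
      by (rule Bochner_Integration.integral_diff[OF i0 i1, symmetric])
    also have "\<dots> \<le> (\<integral>k. d * (spectrum B k * ?f k) + 2 * A * ?p k \<partial>lborel)"
    proof (rule integral_mono)
      show "integrable lborel (\<lambda>k. spectrum B k * ?f k - spectrum B k * ?\<rho> k * ?f k)"
        using i0 i1 by (rule Bochner_Integration.integrable_diff)
      show "integrable lborel (\<lambda>k. d * (spectrum B k * ?f k) + 2 * A * ?p k)"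
        by (intro Bochner_Integration.integrable_add integrable_mult_right i0 i2)
      fix k :: 'a
      have f0: "0 \<le> ?f k" by (rule spec_density_nonneg[OF t])
      have s0: "0 \<le> spectrum B k * ?f k" by (intro mult_nonneg_nonneg f0 spectrum_nonneg)
      have p0: "0 \<le> ?p k" by (intro mult_nonneg_nonneg f0 powr_ge_zero)
      have "spectrum B k * ?f k - spectrum B k * ?\<rho> k * ?f k = (1 - ?\<rho> k) * (spectrum B k * ?f k)"
        by (simp add: algebra_simps)
      also have "\<dots> \<le> d * (spectrum B k * ?f k) + 2 * A * ?p k"
      proof (cases "norm k \<le> e")
        case True
        have "(1 - ?\<rho> k) * (spectrum B k * ?f k) \<le> d * (spectrum B k * ?f k)"
          by (rule mult_right_mono[OF d(2)[OF True] s0])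
        moreover have "0 \<le> 2 * A * ?p k" using A(1) p0 by simp
        ultimately show ?thesis by linarith
      next
        case False
        have "(1 - ?\<rho> k) * (spectrum B k * ?f k) \<le> 2 * (spectrum B k * ?f k)"
          using abs_char_le[OF R sets_R B bB, of k] by (intro mult_right_mono s0) linarith
        also have "\<dots> \<le> 2 * (A * (1 + norm k) powr (- q) * ?f k)"
          using A(2)[of k] False f0 by (intro mult_left_mono mult_right_mono) auto
        also have "\<dots> = 2 * A * ?p k" by simp
        finally show ?thesis using mult_nonneg_nonneg[OF d(1) s0] by linarith
      qed
      finally show "spectrum B k * ?f k - spectrum B k * ?\<rho> k * ?f k \<le> d * (spectrum B k * ?f k) + 2 * A * ?p k" .
    qed
    also have "\<dots> = d * (\<integral>k. spectrum B k * ?f k \<partial>lborel) + 2 * A * (\<integral>k. ?p k \<partial>lborel)"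
      by (subst Bochner_Integration.integral_add[OF integrable_mult_right[OF i0] integrable_mult_right[OF i2]])
        (simp only: integral_mult_right_zero)
    also have "\<dots> \<le> d * (\<integral>k. spectrum B k * ?f k \<partial>lborel) + 2 * A * C"
      using A(1) by (intro add_left_mono mult_left_mono C t) auto
    finally show ?thesis .
  qed
  then have "?c * cov (return borel 0) B - ?c * cov R B \<le> d * (?c * cov (return borel 0) B) + 2 * A * C"
    by (intro LIMSEQ_le[OF tendsto_diff[OF L0 LR] tendsto_add[OF tendsto_mult_left[OF L0] tendsto_const]]) auto
  then show ?thesis by (simp only: right_diff_distrib)
qed

text \<open>Squaring the Fourier bound gives spectral decay of rate q = d + t. After scaling by r
  the spectrum is at most c^2 r^(2d) (1 + r |k|)^(-q), and away from the origin this is r^(2d - q) =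
  r^(d - t) times the integrable weight.\<close>

lemma fourier_smooth_cov_estimate:
  assumes W[measurable]: "W \<in> sets borel" and bW: "bounded W" and cW: "convex W"
    and fs: "fourier_smooth W" and d: "0 < d"
  obtains C t where "t > 0" "\<And>r. 1 \<le> r \<Longrightarrow>
    cov (return borel 0) ((\<lambda>x. r *\<^sub>R x) ` W) - cov R ((\<lambda>x. r *\<^sub>R x) ` W)
      \<le> d * cov (return borel 0) ((\<lambda>x. r *\<^sub>R x) ` W) + C * r powr (real DIM('a) - t)"
proof -
  from fs obtain c t where c: "c > 0" and t: "t > 0" and
    ct: "\<And>k. norm (fourier (indicator W) k) \<le> c * (1 + norm k) powr (- (real DIM('a) + t) / 2)"
    unfolding fourier_smooth_def by blast
  define q where "q = real DIM('a) + t"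
  have q: "q > real DIM('a)" "q > 0" using t by (auto simp: q_def add_pos_pos)
  have sW: "spectrum W k \<le> c\<^sup>2 * (1 + norm k) powr (- q)" for k
  proof -
    have "spectrum W k \<le> (c * (1 + norm k) powr (- q / 2))\<^sup>2"
      unfolding spectrum_def q_def by (intro power_mono ct) simp
    also have "\<dots> = c\<^sup>2 * (1 + norm k) powr (- q)"
      by (simp add: power_mult_distrib power2_eq_square flip: powr_add)
    finally show ?thesis .
  qed
  obtain C where C: "\<And>s. 0 < s \<Longrightarrow> (\<integral>k. (1 + norm k) powr (- q) * spec_density s k \<partial>lborel) \<le> C"
    using powr_spec_density_le[OF q(1)] by blast
  obtain e where e: "0 < e" and rho: "\<And>k. norm k \<le> e \<Longrightarrow> 1 - (\<integral>w. cos (k \<bullet> w) \<partial>R) \<le> d"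
    using cos_mean_near_1[OF R sets_R d] by blast
  \<comment> \<open>The minimum of |k| / (1 + |k|) over |k| \<ge> e, so that 1 + r |k| is at least r
    m (1 + |k|) at high frequencies.\<close>
  define m where "m = e / (1 + e)"
  have m: "m > 0" using e by (simp add: m_def)
  define C' where "C' = 2 * (c\<^sup>2 * m powr (- q)) * C / (2 * pi) ^ DIM('a)"
  show ?thesis
  proof (rule that[OF t])
    fix r :: real assume r1: "1 \<le> r"
    then have r: "r > 0" by simp
    let ?B = "(\<lambda>x. r *\<^sub>R x) ` W"
    have B: "?B \<in> sets borel" by (rule scaleR_image_sets[OF W r])
    have bB: "bounded ?B" by (rule bounded_scaling[OF bW])
    have fr: "frontier ?B \<in> null_sets lborel" by (rule frontier_convex_null[OF convex_scaling[OF cW]])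
    have sB: "spectrum ?B k \<le> r ^ (2 * DIM('a)) * (c\<^sup>2 * (1 + r * norm k) powr (- q))" for k
    proof -
      have "spectrum W (r *\<^sub>R k) \<le> c\<^sup>2 * (1 + r * norm k) powr (- q)" using sW[of "r *\<^sub>R k"] r by simp
      then show ?thesis unfolding spectrum_scaleR[OF W bW r B] using r by (intro mult_left_mono) auto
    qed
    have i: "integrable lborel (spectrum ?B)"
    proof (rule Bochner_Integration.integrable_bound)
      show "integrable lborel (\<lambda>k::'a. r ^ (2 * DIM('a)) * (c\<^sup>2 * (1 + norm k) powr (- q)))"
        by (intro integrable_mult_right integrable_powr_decay q)
      show "spectrum ?B \<in> borel_measurable lborel" using spectrum_measurable[OF B bB] by simp
      show "AE k in lborel. norm (spectrum ?B k) \<le> norm (r ^ (2 * DIM('a)) * (c\<^sup>2 * (1 + norm k) powr (- q)))"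
      proof (rule AE_I2)
        fix k :: 'a
        have "norm k \<le> r * norm k" using r1 mult_right_mono[of 1 r "norm k"] by simp
        then have "(1 + r * norm k) powr (- q) \<le> (1 + norm k) powr (- q)"
          using q by (intro powr_mono2') (auto simp: add_pos_nonneg)
        then have "r ^ (2 * DIM('a)) * (c\<^sup>2 * (1 + r * norm k) powr (- q)) \<le> r ^ (2 * DIM('a)) * (c\<^sup>2 * (1 + norm k) powr (- q))"
          using r by (intro mult_left_mono) auto
        from order_trans[OF sB this] show "norm (spectrum ?B k) \<le> norm (r ^ (2 * DIM('a)) * (c\<^sup>2 * (1 + norm k) powr (- q)))"
          using spectrum_nonneg[of ?B k] unfolding real_norm_def by linarith
      qed
    qed
    define A where "A = c\<^sup>2 * m powr (- q) * r powr (real DIM('a) - t)"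
    have A: "spectrum ?B k \<le> A * (1 + norm k) powr (- q)" if k: "e < norm k" for k
    proof -
      have "m * (1 + norm k) \<le> norm k"
        using e k by (simp add: m_def field_simps)
      then have "r * (m * (1 + norm k)) \<le> 1 + r * norm k"
        using mult_left_mono[of "m * (1 + norm k)" "norm k" r] r by linarith
      moreover have "0 < r * (m * (1 + norm k))" using r m by (simp add: add_pos_nonneg)
      ultimately have "(1 + r * norm k) powr (- q) \<le> (r * (m * (1 + norm k))) powr (- q)"
        using q by (intro powr_mono2') auto
      also have "\<dots> = r powr (- q) * (m powr (- q) * (1 + norm k) powr (- q))"
        using r m by (simp add: powr_mult)
      finally have "r ^ (2 * DIM('a)) * (c\<^sup>2 * (1 + r * norm k) powr (- q))
        \<le> r ^ (2 * DIM('a)) * (c\<^sup>2 * (r powr (- q) * (m powr (- q) * (1 + norm k) powr (- q))))"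
        using r by (intro mult_left_mono) auto
      also have "\<dots> = c\<^sup>2 * m powr (- q) * (r ^ (2 * DIM('a)) * r powr (- q)) * (1 + norm k) powr (- q)"
        by (simp only: ac_simps)
      also have "r ^ (2 * DIM('a)) * r powr (- q) = r powr (real DIM('a) - t)"
      proof -
        have "r ^ (2 * DIM('a)) = r powr (2 * real DIM('a))"
          using r by (subst powr_realpow[symmetric]) simp_all
        then have "r ^ (2 * DIM('a)) * r powr (- q) = r powr (2 * real DIM('a) + - q)"
          by (simp only: powr_add)
        then show ?thesis by (simp add: q_def)
      qed
      finally show ?thesis using sB[of k] unfolding A_def by linarith
    qed
    have A0: "A \<ge> 0" by (simp add: A_def)
    have "(2 * pi) ^ DIM('a) * (cov (return borel 0) ?B - cov R ?B)
      \<le> d * ((2 * pi) ^ DIM('a) * cov (return borel 0) ?B) + 2 * A * C"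
      by (rule cov_difference_le[OF B bB fr i q(1) C less_imp_le[OF d] rho A0 A])
    also have "2 * A * C = (2 * pi) ^ DIM('a) * (C' * r powr (real DIM('a) - t))"
      by (simp add: A_def C'_def)
    finally have "(2 * pi) ^ DIM('a) * (cov (return borel 0) ?B - cov R ?B)
      \<le> (2 * pi) ^ DIM('a) * (d * cov (return borel 0) ?B + C' * r powr (real DIM('a) - t))"
      by (simp only: distrib_left mult.left_commute)
    then show "cov (return borel 0) ?B - cov R ?B \<le> d * cov (return borel 0) ?B + C' * r powr (real DIM('a) - t)"
      by (subst (asm) mult_le_cancel_left_pos) auto
  qed
qed

end

end

section \<open>Covariance measures of finite total variation\<close>

text \<open>Rescaling the window to \<open>W\<close> turns the fixed shift z into z / r, which tends
  to 0; there the overlap is continuous with value the volume of \<open>W\<close>.\<close>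

lemma normalized_overlap_tendsto:
  fixes W :: "'a::euclidean_space set"
  assumes W[measurable]: "W \<in> sets borel" and bW: "bounded W" and cW: "convex W" and W0: "measure lborel W > 0"
    and r: "\<And>n. 0 < r n" "filterlim r at_top sequentially"
  shows "(\<lambda>n. overlap ((\<lambda>x. r n *\<^sub>R x) ` W) z / measure lborel ((\<lambda>x. r n *\<^sub>R x) ` W)) \<longlonglongrightarrow> 1"
proof -
  have "(\<lambda>n. inverse (r n)) \<longlonglongrightarrow> 0"
    using r(2) by (rule tendsto_inverse_0_at_top)
  then have "(\<lambda>n. z /\<^sub>R r n) \<longlonglongrightarrow> 0 *\<^sub>R z" by (intro tendsto_intros)
  then have "(\<lambda>n. overlap W (z /\<^sub>R r n)) \<longlonglongrightarrow> overlap W 0"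
    by (intro overlap_tendsto[OF W bW frontier_convex_null[OF cW]]) simp
  then have "(\<lambda>n. overlap W (z /\<^sub>R r n) / measure lborel W) \<longlonglongrightarrow> measure lborel W / measure lborel W"
    using W0 by (intro tendsto_intros) (auto simp: overlap_0[OF W bW])
  moreover have "overlap ((\<lambda>x. r n *\<^sub>R x) ` W) z / measure lborel ((\<lambda>x. r n *\<^sub>R x) ` W)
      = overlap W (z /\<^sub>R r n) / measure lborel W" for n
    using r(1)[of n] by (simp add: overlap_scaleR[OF W r(1)] measure_scaleR_image[OF W bW r(1)])
  ultimately show ?thesis using W0 by simp
qed

text \<open>The shift may be any random vector f on any probability space: this is applied both to
  displacements under the two-point Palm law and to those under \<open>R\<close>.\<close>

lemma normalized_mean_overlap_tendsto:
  fixes W :: "'a::euclidean_space set" and R :: "'b measure"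
  assumes W[measurable]: "W \<in> sets borel" and bW: "bounded W" and cW: "convex W" and W0: "measure lborel W > 0"
    and r: "\<And>n. 0 < r n" "filterlim r at_top sequentially"
    and R: "prob_space R" and [measurable]: "f \<in> borel_measurable R"
  shows "(\<lambda>n. (\<integral>w. overlap ((\<lambda>x. r n *\<^sub>R x) ` W) (f w) \<partial>R) / measure lborel ((\<lambda>x. r n *\<^sub>R x) ` W)) \<longlonglongrightarrow> 1"
proof -
  interpret prob_space R by (rule R)
  let ?B = "\<lambda>n. (\<lambda>x. r n *\<^sub>R x) ` W"
  have B[measurable]: "?B n \<in> sets borel" and bB: "bounded (?B n)" for n
    by (rule scaleR_image_sets[OF W r(1)], rule bounded_scaling[OF bW])
  have m: "measure lborel (?B n) > 0" for n
    using r(1)[of n] W0 by (simp add: measure_scaleR_image[OF W bW r(1)])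
  have "(\<lambda>n. \<integral>w. overlap (?B n) (f w) / measure lborel (?B n) \<partial>R) \<longlonglongrightarrow> (\<integral>w. 1 \<partial>R)"
  proof (rule integral_dominated_convergence[where w = "\<lambda>_. 1"])
    show "AE w in R. (\<lambda>n. overlap (?B n) (f w) / measure lborel (?B n)) \<longlonglongrightarrow> 1"
      by (intro AE_I2 normalized_overlap_tendsto W bW cW W0 r)
    show "AE w in R. norm (overlap (?B n) (f w) / measure lborel (?B n)) \<le> 1" for n
      using overlap_le[OF B bB, of n] overlap_nonneg[OF B bB, of n] m[of n]
      by (intro AE_I2) (simp add: abs_of_nonneg)
    show "(\<lambda>w. overlap (?B n) (f w) / measure lborel (?B n)) \<in> borel_measurable R" for n by measurable
  qed auto
  then show ?thesis by (simp add: prob_space)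
qed

lemma sum_of_measures:
  fixes \<mu> \<nu> :: "'b measure"
  assumes s: "sets \<nu> = sets \<mu>"
  obtains m where "sets m = sets \<mu>" "\<And>A. A \<in> sets \<mu> \<Longrightarrow> emeasure m A = emeasure \<mu> A + emeasure \<nu> A"
proof
  define m where "m = measure_of (space \<mu>) (sets \<mu>) (\<lambda>A. emeasure \<mu> A + emeasure \<nu> A)"
  show sm: "sets m = sets \<mu>" by (simp add: m_def)
  fix A assume A: "A \<in> sets \<mu>"
  show "emeasure m A = emeasure \<mu> A + emeasure \<nu> A"
  proof (rule emeasure_measure_of[OF m_def])
    show "countably_additive (sets m) (\<lambda>A. emeasure \<mu> A + emeasure \<nu> A)"
    proof (rule countably_additiveI)
      fix F :: "nat \<Rightarrow> _" assume F: "range F \<subseteq> sets m" "disjoint_family F"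
      then show "(\<Sum>i. emeasure \<mu> (F i) + emeasure \<nu> (F i)) = emeasure \<mu> (\<Union> (range F)) + emeasure \<nu> (\<Union> (range F))"
        using suminf_emeasure[of F \<mu>] suminf_emeasure[of F \<nu>] s sm
        by (subst suminf_add[symmetric]) auto
    qed
  qed (use A sets.sets_into_space in \<open>auto simp: positive_def sm\<close>)
qed

text \<open>Domination gives absolute continuity, and \<sigma>-finiteness of \<mu> makes the
  Radon-Nikodym derivative finite almost everywhere, so a real-valued version exists and densities
  can be subtracted.\<close>

lemma density_real:
  assumes m: "sigma_finite_measure m" and \<mu>: "sigma_finite_measure \<mu>" and s: "sets \<mu> = sets m"
    and le: "\<And>A. A \<in> sets m \<Longrightarrow> emeasure \<mu> A \<le> emeasure m A"
  obtains D :: "'b \<Rightarrow> real" where "D \<in> borel_measurable m" "\<And>x. 0 \<le> D x" "\<mu> = density m (\<lambda>x. ennreal (D x))"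
proof -
  interpret sigma_finite_measure m by (rule m)
  have ac: "absolutely_continuous m \<mu>"
    unfolding absolutely_continuous_def
  proof
    fix A assume A: "A \<in> null_sets m"
    have "emeasure \<mu> A = 0" using le[OF null_setsD2[OF A]] null_setsD1[OF A] by simp
    then show "A \<in> null_sets \<mu>" using A s by (auto simp: null_sets_def)
  qed
  have fin: "AE x in m. RN_deriv m \<mu> x \<noteq> \<infinity>" by (rule RN_deriv_finite[OF \<mu> ac s])
  have "density m (\<lambda>x. ennreal (enn2real (RN_deriv m \<mu> x))) = density m (RN_deriv m \<mu>)"
    by (rule density_cong) (use fin in \<open>auto simp: less_top\<close>)
  also have "\<dots> = \<mu>" by (rule density_RN_deriv[OF ac s])
  finally show ?thesis by (intro that[of "\<lambda>x. enn2real (RN_deriv m \<mu> x)"]) auto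
qed

context second_order_measure
begin

text \<open>A replacement for the Jordan decomposition of a set function known on bounded sets only.
  Both \<alpha> and g * Lebesgue have real densities a and l with respect to their sum m, and D = a
  - l. Testing the variation on the positive and negative part of a ball bounds the integral of |D|
  over it; the balls exhaust the space.\<close>

lemma total_variation_density:
  assumes tv: "total_variation (\<lambda>B. measure \<alpha> B - g * measure lborel B) < \<infinity>"
  obtains m D where "sets m = sets borel" "integrable m D"
    "\<And>f. f \<in> borel_measurable borel \<Longrightarrow> integrable \<alpha> f \<Longrightarrow> integrable lborel f \<Longrightarrow>
      cint f = (\<integral>z. D z * f z \<partial>m)"
proof -
  define \<nu> where "\<nu> = density lborel (\<lambda>_::'a. ennreal g)"
  have s\<nu>[measurable_cong]: "sets \<nu> = sets borel" by (simp add: \<nu>_def)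
  have e\<nu>: "emeasure \<nu> A = ennreal g * emeasure lborel A" if "A \<in> sets borel" for A
    using that by (simp add: \<nu>_def emeasure_density_const)
  obtain m where sm0: "sets m = sets \<alpha>"
    and em0: "\<And>A. A \<in> sets \<alpha> \<Longrightarrow> emeasure m A = emeasure \<alpha> A + emeasure \<nu> A"
    using sum_of_measures[of \<nu> \<alpha>] by (auto simp: sets_\<alpha> s\<nu>)
  have sm[measurable_cong]: "sets m = sets borel" using sm0 sets_\<alpha> by simp
  have em: "emeasure m A = emeasure \<alpha> A + emeasure \<nu> A" if "A \<in> sets borel" for A
    using em0 that by (simp add: sets_\<alpha>)
  have sp[simp]: "space m = UNIV" "space \<nu> = UNIV"
    using sets_eq_imp_space_eq[OF sm] sets_eq_imp_space_eq[OF s\<nu>] by simp_all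
  have bf: "emeasure \<alpha> A < \<infinity>" "emeasure \<nu> A < \<infinity>" "emeasure m A < \<infinity>" if "A \<in> sets borel" "bounded A" for A
    using finite_\<alpha>[OF that] emeasure_bounded_finite[OF that(2)] that
    by (simp_all add: e\<nu> em ennreal_mult_less_top)
  have sfm: "sigma_finite_measure m" by (rule sigma_finite_if_bounded_finite[OF sm bf(3)])
  have sf\<nu>: "sigma_finite_measure \<nu>" by (rule sigma_finite_if_bounded_finite[OF s\<nu> bf(2)])
  obtain a where a[measurable]: "a \<in> borel_measurable m" and a0: "\<And>x. 0 \<le> a x"
    and \<alpha>a: "\<alpha> = density m (\<lambda>x. ennreal (a x))"
    using density_real[OF sfm sigma_finite_\<alpha>] em by (auto simp: sm sets_\<alpha>)
  obtain l where l[measurable]: "l \<in> borel_measurable m" and l0: "\<And>x. 0 \<le> l x"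
    and \<nu>l: "\<nu> = density m (\<lambda>x. ennreal (l x))"
    using density_real[OF sfm sf\<nu>] em by (auto simp: sm s\<nu>)
  have ia: "integral\<^sup>L \<alpha> f = (\<integral>x. a x * f x \<partial>m)" "integrable \<alpha> f \<Longrightarrow> integrable m (\<lambda>x. a x * f x)"
    if [measurable]: "f \<in> borel_measurable borel" for f :: "'a \<Rightarrow> real"
    unfolding \<alpha>a using a0 by (simp_all add: integral_density integrable_density)
  have il: "g * integral\<^sup>L lborel f = (\<integral>x. l x * f x \<partial>m)" "integrable lborel f \<Longrightarrow> integrable m (\<lambda>x. l x * f x)"
    if [measurable]: "f \<in> borel_measurable borel" for f :: "'a \<Rightarrow> real"
  proof -
    have "integral\<^sup>L \<nu> f = g * integral\<^sup>L lborel f"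
      unfolding \<nu>_def using g_nonneg by (simp add: integral_density)
    moreover have "integral\<^sup>L \<nu> f = (\<integral>x. l x * f x \<partial>m)"
      unfolding \<nu>l using l0 by (simp add: integral_density)
    ultimately show "g * integral\<^sup>L lborel f = (\<integral>x. l x * f x \<partial>m)" by simp
    assume "integrable lborel f"
    then have "integrable \<nu> f" unfolding \<nu>_def using g_nonneg by (simp add: integrable_density)
    then show "integrable m (\<lambda>x. l x * f x)" unfolding \<nu>l using l0 by (simp add: integrable_density)
  qed
  let ?D = "\<lambda>x. a x - l x"
  have cint: "cint f = (\<integral>z. ?D z * f z \<partial>m)"
    if f: "f \<in> borel_measurable borel" "integrable \<alpha> f" "integrable lborel f" for f
    unfolding cint_def ia(1)[OF f(1)] il(1)[OF f(1)] left_diff_distrib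
    by (rule Bochner_Integration.integral_diff[OF ia(2)[OF f(1,2)] il(2)[OF f(1,3)], symmetric])
  let ?\<beta> = "\<lambda>B. measure \<alpha> B - g * measure lborel B"
  have \<beta>: "?\<beta> B = (\<integral>z. ?D z * indicator B z \<partial>m)" "integrable m (\<lambda>z. ?D z * indicator B z)"
    if B: "B \<in> sets borel" "bounded B" for B
  proof -
    have i: "integrable \<alpha> (indicat_real B)" "integrable lborel (indicat_real B)"
      using B bf(1)[OF B] emeasure_bounded_finite[OF B(2)] by (simp_all add: sets_\<alpha>)
    have f: "indicat_real B \<in> borel_measurable borel" using B by simp
    show "?\<beta> B = (\<integral>z. ?D z * indicator B z \<partial>m)"
      using cint[OF f i] B by (simp add: cint_def sets_\<alpha>)
    show "integrable m (\<lambda>z. ?D z * indicator B z)"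
      unfolding left_diff_distrib
      by (rule Bochner_Integration.integrable_diff[OF ia(2)[OF f i(1)] il(2)[OF f i(2)]])
  qed
  have "(\<integral>\<^sup>+z. ennreal \<bar>?D z\<bar> * indicator (cball 0 (real n)) z \<partial>m) \<le> total_variation ?\<beta>" for n
  proof -
    \<comment> \<open>X and Y are the Hahn sets of D inside a ball: bounded, Borel and disjoint,
      hence an admissible family in \<open>total_variation\<close>.\<close>
    define X where "X = cball 0 (real n) \<inter> {z \<in> space m. 0 \<le> ?D z}"
    define Y where "Y = cball 0 (real n) \<inter> {z \<in> space m. ?D z < 0}"
    have "{z \<in> space m. 0 \<le> ?D z} \<in> sets m" "{z \<in> space m. ?D z < 0} \<in> sets m" by measurable
    then have XY: "X \<in> sets borel" "Y \<in> sets borel" "bounded X" "bounded Y" "X \<inter> Y = {}"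
      by (auto simp: X_def Y_def sm intro: bounded_subset[OF bounded_cball])
    have "(\<integral>\<^sup>+z. ennreal \<bar>?D z\<bar> * indicator (cball 0 (real n)) z \<partial>m)
       = (\<integral>\<^sup>+z. ennreal (?D z * indicator X z) + ennreal (- (?D z * indicator Y z)) \<partial>m)"
      by (intro nn_integral_cong) (auto simp: X_def Y_def split: split_indicator)
    also have "\<dots> = (\<integral>\<^sup>+z. ennreal (?D z * indicator X z) \<partial>m) + (\<integral>\<^sup>+z. ennreal (- (?D z * indicator Y z)) \<partial>m)"
      using \<beta>(2)[OF XY(1,3)] \<beta>(2)[OF XY(2,4)] by (intro nn_integral_add) auto
    also have "(\<integral>\<^sup>+z. ennreal (?D z * indicator X z) \<partial>m) = ennreal (?\<beta> X)"
      unfolding \<beta>(1)[OF XY(1,3)]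
      by (rule nn_integral_eq_integral[OF \<beta>(2)[OF XY(1,3)]]) (auto simp: X_def split: split_indicator)
    also have "(\<integral>\<^sup>+z. ennreal (- (?D z * indicator Y z)) \<partial>m) = ennreal (- ?\<beta> Y)"
      unfolding \<beta>(1)[OF XY(2,4)] Bochner_Integration.integral_minus[symmetric]
      by (rule nn_integral_eq_integral[OF Bochner_Integration.integrable_minus[OF \<beta>(2)[OF XY(2,4)]]])
        (auto simp: Y_def split: split_indicator)
    also have "ennreal (?\<beta> X) + ennreal (- ?\<beta> Y) \<le> (\<Sum>B\<in>{X, Y}. ennreal \<bar>?\<beta> B\<bar>)"
    \<comment> \<open>If X = Y the family has a single member and the sum a single term;
      disjointness then makes both sets empty.\<close>
    proof (cases "X = Y")
      case True
      then have "X = {}" "Y = {}" using XY(5) by auto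
      then show ?thesis by simp
    next
      case False
      then show ?thesis by (simp add: add_mono ennreal_leI)
    qed
    also have "\<dots> \<le> total_variation ?\<beta>"
      unfolding total_variation_def
      by (rule SUP_upper) (use XY in \<open>auto simp: disjoint_def\<close>)
    finally show ?thesis .
  qed
  then have "(SUP n. \<integral>\<^sup>+z. ennreal \<bar>?D z\<bar> * indicator (cball 0 (real n)) z \<partial>m) \<le> total_variation ?\<beta>"
    by (intro SUP_least)
  also have "(SUP n. \<integral>\<^sup>+z. ennreal \<bar>?D z\<bar> * indicator (cball 0 (real n)) z \<partial>m)
     = (\<integral>\<^sup>+z. (SUP n. ennreal \<bar>?D z\<bar> * indicator (cball 0 (real n)) z) \<partial>m)"
  proof (rule nn_integral_monotone_convergence_SUP[symmetric])
    have [measurable]: "cball 0 (real n) \<in> sets m" for n by (simp add: sm)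
    show "(\<lambda>z. ennreal \<bar>?D z\<bar> * indicator (cball 0 (real n)) z) \<in> borel_measurable m" for n by measurable
  qed (auto simp: incseq_def le_fun_def split: split_indicator)
  also have "\<dots> = (\<integral>\<^sup>+z. ennreal \<bar>?D z\<bar> \<partial>m)"
  proof (intro nn_integral_cong antisym SUP_least)
    fix z :: 'a
    obtain n where "norm z \<le> real n" using real_arch_simple by blast
    then show "ennreal \<bar>?D z\<bar> \<le> (SUP n. ennreal \<bar>?D z\<bar> * indicator (cball 0 (real n)) z)"
      by (intro SUP_upper2[of n]) auto
  qed (auto split: split_indicator)
  finally have "(\<integral>\<^sup>+z. ennreal (norm (?D z)) \<partial>m) < \<infinity>" using tv by simp
  then have "integrable m ?D" by (intro integrableI_bounded) auto
  with sm show ?thesis using cint by (rule that[of m ?D])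
qed

text \<open>Both normalised mean overlaps lie in [0, 1] and tend to 1 pointwise. Their difference,
  integrated against the integrable D, vanishes in the limit with dominating function 2 |D|.\<close>

lemma total_variation_cov_tendsto:
  assumes tv: "total_variation (\<lambda>B. measure \<alpha> B - g * measure lborel B) < \<infinity>"
    and R: "prob_space R" and sets_R[measurable_cong]: "sets R = sets borel"
    and W[measurable]: "W \<in> sets borel" and bW: "bounded W" and cW: "convex W" and W0: "measure lborel W > 0"
    and r: "\<And>n. 0 < r n" "filterlim r at_top sequentially"
  shows "(\<lambda>n. (cov (return borel 0) ((\<lambda>x. r n *\<^sub>R x) ` W) - cov R ((\<lambda>x. r n *\<^sub>R x) ` W))
      / measure lborel ((\<lambda>x. r n *\<^sub>R x) ` W)) \<longlonglongrightarrow> 0"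
proof -
  obtain m D where sm[measurable_cong]: "sets m = sets borel" and D: "integrable m D"
    and cD: "\<And>f. f \<in> borel_measurable borel \<Longrightarrow> integrable \<alpha> f \<Longrightarrow> integrable lborel f \<Longrightarrow>
      cint f = (\<integral>z. D z * f z \<partial>m)"
    using total_variation_density[OF tv] by blast
  interpret R: prob_space R by (rule R)
  let ?B = "\<lambda>n. (\<lambda>x. r n *\<^sub>R x) ` W"
  let ?l = "\<lambda>n. measure lborel (?B n)"
  let ?o = "\<lambda>S n z. \<integral>w. overlap (?B n) (z + w) \<partial>S"
  have B[measurable]: "?B n \<in> sets borel" and bB: "bounded (?B n)" for n
    by (rule scaleR_image_sets[OF W r(1)], rule bounded_scaling[OF bW])
  have l: "?l n > 0" for n
    using r(1)[of n] W0 by (simp add: measure_scaleR_image[OF W bW r(1)])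
  let ?\<delta> = "return borel (0::'a)"
  have \<delta>: "prob_space ?\<delta>" "sets ?\<delta> = sets borel" by (auto intro: prob_space_return)
  have eq: "cov S (?B n) = (\<integral>z. D z * ?o S n z \<partial>m)" and meas: "?o S n \<in> borel_measurable m"
    and lt: "(\<lambda>n. ?o S n z / ?l n) \<longlonglongrightarrow> 1" and bd: "\<bar>?o S n z / ?l n\<bar> \<le> 1"
    and iD: "integrable m (\<lambda>z. D z * ?o S n z)"
    if S: "prob_space S" "sets S = sets borel" for S n z
  proof -
    interpret S: prob_space S by (rule S)
    note [measurable_cong] = S(2)
    show mm: "?o S n \<in> borel_measurable m" by measurable
    show "cov S (?B n) = (\<integral>z. D z * ?o S n z \<partial>m)"
      unfolding cov_eq_cint[OF S B bB]
      by (rule cD[OF mean_overlap_measurable[OF S B bB] integrable_mean_overlap_\<alpha>[OF S B bB]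
        integrable_mean_overlap_lborel[OF S B bB]])
    show "(\<lambda>n. ?o S n z / ?l n) \<longlonglongrightarrow> 1"
      by (rule normalized_mean_overlap_tendsto[OF W bW cW W0 r S(1)]) measurable
    have le: "?o S n z \<le> ?l n" for z
    proof -
      have "?o S n z \<le> (\<integral>w. ?l n \<partial>S)"
        by (intro integral_mono overlap_shift_integrable_R[OF S B bB] overlap_le[OF B bB]) simp
      then show ?thesis by (simp add: S.prob_space)
    qed
    note nn = mean_overlap_nonneg[OF S B bB, of n]
    show "\<bar>?o S n z / ?l n\<bar> \<le> 1" using le[of z] nn[of z] l[of n] by simp
    show "integrable m (\<lambda>z. D z * ?o S n z)"
    proof (rule Bochner_Integration.integrable_bound[OF integrable_mult_left[OF D, of "?l n"]])
      show "(\<lambda>z. D z * ?o S n z) \<in> borel_measurable m"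
        using borel_measurable_integrable[OF D] mm by measurable
      show "AE z in m. norm (D z * ?o S n z) \<le> norm (D z * ?l n)"
        using le nn by (intro AE_I2) (auto simp: abs_mult intro!: mult_left_mono)
    qed
  qed
  have "(\<lambda>n. \<integral>z. D z * (?o ?\<delta> n z / ?l n - ?o R n z / ?l n) \<partial>m) \<longlonglongrightarrow> (\<integral>z. 0 \<partial>m)"
  proof (rule integral_dominated_convergence[where w = "\<lambda>z. 2 * \<bar>D z\<bar>"])
    show "(\<lambda>z. D z * (?o ?\<delta> n z / ?l n - ?o R n z / ?l n)) \<in> borel_measurable m" for n
      using borel_measurable_integrable[OF D] meas[OF \<delta>, of n] meas[OF R sets_R, of n] by measurable
    show "AE z in m. (\<lambda>n. D z * (?o ?\<delta> n z / ?l n - ?o R n z / ?l n)) \<longlonglongrightarrow> 0"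
    proof (rule AE_I2)
      fix z
      have "(\<lambda>n. D z * (?o ?\<delta> n z / ?l n - ?o R n z / ?l n)) \<longlonglongrightarrow> D z * (1 - 1)"
        by (intro tendsto_intros lt \<delta> R sets_R)
      then show "(\<lambda>n. D z * (?o ?\<delta> n z / ?l n - ?o R n z / ?l n)) \<longlonglongrightarrow> 0" by simp
    qed
    show "AE z in m. norm (D z * (?o ?\<delta> n z / ?l n - ?o R n z / ?l n)) \<le> 2 * \<bar>D z\<bar>" for n
    proof (rule AE_I2)
      fix z
      have "\<bar>?o ?\<delta> n z / ?l n - ?o R n z / ?l n\<bar> \<le> 2"
        using bd[OF \<delta>, of n z] bd[OF R sets_R, of n z] by linarith
      from mult_right_mono[OF this, of "\<bar>D z\<bar>"]
      show "norm (D z * (?o ?\<delta> n z / ?l n - ?o R n z / ?l n)) \<le> 2 * \<bar>D z\<bar>"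
        by (simp only: real_norm_def abs_mult mult.commute[of "\<bar>D z\<bar>"] abs_ge_zero)
    qed
  qed (use D in auto)
  moreover have "(\<integral>z. D z * (?o ?\<delta> n z / ?l n - ?o R n z / ?l n) \<partial>m)
     = (cov ?\<delta> (?B n) - cov R (?B n)) / ?l n" for n
  proof -
    have "(\<integral>z. D z * (?o ?\<delta> n z / ?l n - ?o R n z / ?l n) \<partial>m) = (\<integral>z. (D z * ?o ?\<delta> n z - D z * ?o R n z) / ?l n \<partial>m)"
      by (intro Bochner_Integration.integral_cong refl) (simp only: right_diff_distrib diff_divide_distrib times_divide_eq_right)
    also have "\<dots> = ((\<integral>z. D z * ?o ?\<delta> n z \<partial>m) - (\<integral>z. D z * ?o R n z \<partial>m)) / ?l n"
      unfolding integral_divide_zero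
      by (subst Bochner_Integration.integral_diff[OF iD[OF \<delta>] iD[OF R sets_R]]) (rule refl)
    finally show ?thesis unfolding eq[OF \<delta>] eq[OF R sets_R] .
  qed
  ultimately show ?thesis by simp
qed

end

section \<open>Random measures\<close>

lemma space_measure_algebra: "space (measure_algebra N) = {\<mu>. sets \<mu> = sets N}"
  by (auto simp add: measure_algebra_def space_Sup_eq_UN)

lemma measurable_emeasure_measure_algebra:
  "A \<in> sets N \<Longrightarrow> (\<lambda>\<mu>. emeasure \<mu> A) \<in> borel_measurable (measure_algebra N)"
  by (auto intro!: measurable_Sup1 measurable_vimage_algebra1 simp: measure_algebra_def)

lemma measurable_measure_algebra:
  "(\<And>x. x \<in> space M \<Longrightarrow> sets (k x) = sets N) \<Longrightarrow>
   (\<And>A. A \<in> sets N \<Longrightarrow> (\<lambda>x. emeasure (k x) A) \<in> borel_measurable M) \<Longrightarrow>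
   k \<in> M \<rightarrow>\<^sub>M measure_algebra N"
  by (auto intro!: measurable_Sup2 measurable_vimage_algebra2 simp: measure_algebra_def)

lemma random_measure_sets: "random_measure M \<Phi> \<Longrightarrow> \<omega> \<in> space M \<Longrightarrow> sets (\<Phi> \<omega>) = sets borel"
  unfolding random_measure_def using measurable_space[of \<Phi> M "measure_algebra borel" \<omega>]
  by (auto simp: space_measure_algebra)

lemma random_measure_emeasure:
  "random_measure M \<Phi> \<Longrightarrow> A \<in> sets borel \<Longrightarrow> (\<lambda>\<omega>. emeasure (\<Phi> \<omega>) A) \<in> borel_measurable M"
  unfolding random_measure_def
  by (auto intro: measurable_compose[OF _ measurable_emeasure_measure_algebra])

lemma random_measure_finite:
  "random_measure M \<Phi> \<Longrightarrow> \<omega> \<in> space M \<Longrightarrow> A \<in> sets borel \<Longrightarrow> bounded A \<Longrightarrow> emeasure (\<Phi> \<omega>) A < \<infinity>"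
  unfolding random_measure_def locally_finite_def by blast

lemma random_measure_sigma_finite:
  assumes "random_measure M \<Phi>" "\<omega> \<in> space M"
  shows "sigma_finite_measure (\<Phi> \<omega>)"
  by (rule sigma_finite_if_bounded_finite[OF random_measure_sets[OF assms] random_measure_finite[OF assms]])

lemma random_measure_compose:
  assumes r: "random_measure M \<Phi>" and f: "f \<in> N \<rightarrow>\<^sub>M M"
  shows "random_measure N (\<lambda>x. \<Phi> (f x))"
  using assms measurable_space[OF f] unfolding random_measure_def by (auto intro: measurable_compose)

text \<open>
  The measure is cut into countably many pieces, each of which becomes a sub-probability kernel
  after division by \<open>1 + emeasure (\<Phi> \<omega>) (A n)\<close>.
\<close>

lemma nn_integral_random_measure_measurable:
  fixes \<Phi> :: "'w \<Rightarrow> 'a::euclidean_space measure"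
  assumes r: "random_measure M \<Phi>" and f[measurable]: "(\<lambda>(\<omega>, x). f \<omega> x) \<in> borel_measurable (M \<Otimes>\<^sub>M borel)"
  shows "(\<lambda>\<omega>. \<integral>\<^sup>+x. f \<omega> x \<partial>\<Phi> \<omega>) \<in> borel_measurable M"
proof -
  define A where "A = disjointed (\<lambda>n. cball (0::'a) (real n))"
  have A[measurable]: "A n \<in> sets borel" for n
    unfolding A_def disjointed_def by (intro sets.Diff sets.finite_UN) auto
  have bA: "bounded (A n)" for n
    unfolding A_def using disjointed_subset by (rule bounded_subset[OF bounded_cball])
  have dA: "disjoint_family A" unfolding A_def by (rule disjoint_family_disjointed)
  have uA: "(\<Union>n. A n) = UNIV"
    unfolding A_def UN_disjointed_eq by (auto intro: real_arch_simple)
  \<comment> \<open>The summand 1 keeps the divisor away from 0, local finiteness keeps it finite,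
    so it cancels when the pieces are put together again.\<close>
  define c where "c n \<omega> = 1 + emeasure (\<Phi> \<omega>) (A n)" for n \<omega>
  have cm[measurable]: "c n \<in> borel_measurable M" for n
    unfolding c_def[abs_def] using random_measure_emeasure[OF r A] by measurable
  have c: "c n \<omega> \<noteq> 0" "c n \<omega> \<noteq> \<top>" if "\<omega> \<in> space M" for n \<omega>
    using random_measure_finite[OF r that A bA, of n] by (auto simp: c_def)
  define \<nu> where "\<nu> n \<omega> = density (\<Phi> \<omega>) (\<lambda>x. indicator (A n) x / c n \<omega>)" for n \<omega>
  have ev: "emeasure (\<nu> n \<omega>) B = emeasure (\<Phi> \<omega>) (A n \<inter> B) / c n \<omega>"
    if "\<omega> \<in> space M" "B \<in> sets borel" for n \<omega> B
  proof -
    note [measurable_cong] = random_measure_sets[OF r that(1)]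
    have "emeasure (\<nu> n \<omega>) B = (\<integral>\<^sup>+x. indicator (A n) x / c n \<omega> * indicator B x \<partial>\<Phi> \<omega>)"
    proof -
      have "B \<in> sets (\<Phi> \<omega>)" using that random_measure_sets[OF r that(1)] by simp
      moreover have "(\<lambda>x. indicator (A n) x / c n \<omega>) \<in> borel_measurable (\<Phi> \<omega>)" by measurable
      ultimately show ?thesis unfolding \<nu>_def by (intro emeasure_density)
    qed
    also have "\<dots> = (\<integral>\<^sup>+x. indicator (A n \<inter> B) x / c n \<omega> \<partial>\<Phi> \<omega>)"
      by (intro nn_integral_cong) (auto split: split_indicator)
    also have "\<dots> = emeasure (\<Phi> \<omega>) (A n \<inter> B) / c n \<omega>"
    proof -
      have AB: "A n \<inter> B \<in> sets (\<Phi> \<omega>)"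
        using sets.Int[OF A that(2)] random_measure_sets[OF r that(1)] by simp
      show ?thesis by (subst nn_integral_divide) (use AB in simp_all)
    qed
    finally show ?thesis .
  qed
  have \<nu>: "\<nu> n \<in> M \<rightarrow>\<^sub>M subprob_algebra borel" for n
  proof (rule measurable_subprob_algebra)
    fix \<omega> assume w: "\<omega> \<in> space M"
    note s = random_measure_sets[OF r w]
    show sb: "sets (\<nu> n \<omega>) = sets borel" by (simp add: \<nu>_def s)
    show "subprob_space (\<nu> n \<omega>)"
    proof
      have "emeasure (\<Phi> \<omega>) (A n) \<le> c n \<omega>" by (simp add: c_def)
      then have "emeasure (\<Phi> \<omega>) (A n) / c n \<omega> \<le> c n \<omega> / c n \<omega>" by (rule divide_right_mono_ennreal)
      also have "\<dots> = 1" using c[OF w, of n] by (intro ennreal_divide_self) (auto simp flip: less_top)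
      finally show "emeasure (\<nu> n \<omega>) (space (\<nu> n \<omega>)) \<le> 1"
        using sets_eq_imp_space_eq[OF sb] by (simp add: ev[OF w])
      show "space (\<nu> n \<omega>) \<noteq> {}" using sets_eq_imp_space_eq[OF sb] by simp
    qed
  next
    fix B :: "'a set" assume "B \<in> sets borel"
    then have "A n \<inter> B \<in> sets borel" by simp
    from random_measure_emeasure[OF r this]
    have "(\<lambda>\<omega>. emeasure (\<Phi> \<omega>) (A n \<inter> B) / c n \<omega>) \<in> borel_measurable M" by measurable
    then show "(\<lambda>\<omega>. emeasure (\<nu> n \<omega>) B) \<in> borel_measurable M"
      using ev[OF _ \<open>B \<in> sets borel\<close>] by (subst measurable_cong) auto
  qed
  have "(\<integral>\<^sup>+x. f \<omega> x \<partial>\<Phi> \<omega>) = (\<Sum>n. c n \<omega> * (\<integral>\<^sup>+x. f \<omega> x \<partial>\<nu> n \<omega>))" if w: "\<omega> \<in> space M" for \<omega>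
  proof -
    note [measurable_cong] = random_measure_sets[OF r w]
    have [measurable]: "f \<omega> \<in> borel_measurable borel"
      using measurable_compose[OF measurable_Pair1'[OF w] f] by simp
    have "c n \<omega> * (\<integral>\<^sup>+x. f \<omega> x \<partial>\<nu> n \<omega>) = (\<integral>\<^sup>+x. indicator (A n) x * f \<omega> x \<partial>\<Phi> \<omega>)" for n
    proof -
      have "(\<integral>\<^sup>+x. f \<omega> x \<partial>\<nu> n \<omega>) = (\<integral>\<^sup>+x. indicator (A n) x / c n \<omega> * f \<omega> x \<partial>\<Phi> \<omega>)"
        unfolding \<nu>_def by (rule nn_integral_density) measurable
      also have "c n \<omega> * \<dots> = (\<integral>\<^sup>+x. c n \<omega> * (indicator (A n) x / c n \<omega> * f \<omega> x) \<partial>\<Phi> \<omega>)"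
        by (rule nn_integral_cmult[symmetric]) measurable
      also have "\<dots> = (\<integral>\<^sup>+x. indicator (A n) x * f \<omega> x \<partial>\<Phi> \<omega>)"
        using c[OF w, of n] by (intro nn_integral_cong) (simp add: ennreal_times_divide ennreal_divide_times mult.commute[of "c n \<omega>"] ennreal_mult_divide_eq split: split_indicator)
      finally show ?thesis .
    qed
    then have "(\<Sum>n. c n \<omega> * (\<integral>\<^sup>+x. f \<omega> x \<partial>\<nu> n \<omega>)) = (\<Sum>n. \<integral>\<^sup>+x. indicator (A n) x * f \<omega> x \<partial>\<Phi> \<omega>)"
      by simp
    also have "\<dots> = (\<integral>\<^sup>+x. (\<Sum>n. indicator (A n) x * f \<omega> x) \<partial>\<Phi> \<omega>)"
      by (rule nn_integral_suminf[symmetric]) measurable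
    also have "\<dots> = (\<integral>\<^sup>+x. f \<omega> x \<partial>\<Phi> \<omega>)"
    proof (rule nn_integral_cong)
      fix x :: 'a
      have "(\<Sum>n. indicator (A n) x * f \<omega> x) = (\<Sum>n. indicator (A n) x) * f \<omega> x"
        by (rule ennreal_suminf_multc)
      also have "(\<Sum>n. indicator (A n) x :: ennreal) = indicator (\<Union>n. A n) x"
        by (rule suminf_indicator[OF dA])
      finally show "(\<Sum>n. indicator (A n) x * f \<omega> x) = f \<omega> x" by (simp add: uA)
    qed
    finally show ?thesis by simp
  qed
  moreover have "(\<lambda>\<omega>. \<Sum>n. c n \<omega> * (\<integral>\<^sup>+x. f \<omega> x \<partial>\<nu> n \<omega>)) \<in> borel_measurable M"
  proof -
    have [measurable]: "(\<lambda>\<omega>. \<integral>\<^sup>+x. f \<omega> x \<partial>\<nu> n \<omega>) \<in> borel_measurable M" for n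
      by (rule nn_integral_measurable_subprob_algebra2[OF f \<nu>])
    show ?thesis by measurable
  qed
  ultimately show ?thesis by (subst measurable_cong) auto
qed

text \<open>The random measure is regarded as one on the product space that depends on the first
  coordinate only.\<close>

lemma nn_integral_random_measure_measurable_param:
  fixes \<Phi> :: "'w \<Rightarrow> 'a::euclidean_space measure"
  assumes r: "random_measure M \<Phi>" and f: "(\<lambda>((\<omega>, y), x). f \<omega> y x) \<in> borel_measurable ((M \<Otimes>\<^sub>M N) \<Otimes>\<^sub>M borel)"
  shows "(\<lambda>(\<omega>, y). \<integral>\<^sup>+x. f \<omega> y x \<partial>\<Phi> \<omega>) \<in> borel_measurable (M \<Otimes>\<^sub>M N)"
  using nn_integral_random_measure_measurable[OF random_measure_compose[OF r measurable_fst], of "\<lambda>(\<omega>, y). f \<omega> y" N] f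
  by (simp add: case_prod_beta')

section \<open>Invariant random measures and their second moments\<close>

locale flow_random_measure = prob_space M
  for M :: "'w measure" +
  fixes \<theta> :: "'a::euclidean_space \<Rightarrow> 'w \<Rightarrow> 'w" and \<Phi> :: "'w \<Rightarrow> 'a measure"
  assumes flow: "measurable_flow M \<theta>" and rm: "random_measure M \<Phi>"
    and inv: "invariant_random_measure M \<theta> \<Phi>"
begin

lemma flow_measurable: "(\<lambda>(\<omega>, x). \<theta> x \<omega>) \<in> M \<Otimes>\<^sub>M borel \<rightarrow>\<^sub>M M"
  using flow unfolding measurable_flow_def by blast

lemma flow_measurable'[measurable (raw)]:
  assumes "f \<in> N \<rightarrow>\<^sub>M M" "g \<in> N \<rightarrow>\<^sub>M borel"
  shows "(\<lambda>x. \<theta> (g x) (f x)) \<in> N \<rightarrow>\<^sub>M M"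
  using measurable_compose[OF measurable_Pair[OF assms] flow_measurable] by simp

lemma flow_space[simp]: "\<omega> \<in> space M \<Longrightarrow> \<theta> x \<omega> \<in> space M"
  using measurable_space[OF flow_measurable, of "(\<omega>, x)"] by (simp add: space_pair_measure)

lemma flow_add: "\<omega> \<in> space M \<Longrightarrow> \<theta> x (\<theta> y \<omega>) = \<theta> (x + y) \<omega>"
  and flow_0: "\<omega> \<in> space M \<Longrightarrow> \<theta> 0 \<omega> = \<omega>"
  using flow unfolding measurable_flow_def by blast+

text \<open>The flow axiom speaks of images of events. Since \<open>\<theta> (- x)\<close> inverts
  \<open>\<theta> x\<close>, preimages under one are images under the other.\<close>

lemma distr_flow: "distr M M (\<theta> x) = M"
proof (rule measure_eqI)
  fix A assume "A \<in> sets (distr M M (\<theta> x))"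
  then have A: "A \<in> sets M" by simp
  have "\<theta> x -` A \<inter> space M = \<theta> (- x) ` A"
  proof (intro equalityI subsetI)
    fix \<omega> assume "\<omega> \<in> \<theta> x -` A \<inter> space M"
    then show "\<omega> \<in> \<theta> (- x) ` A" by (intro image_eqI[of _ _ "\<theta> x \<omega>"]) (simp_all add: flow_add flow_0)
  next
    fix \<omega> assume "\<omega> \<in> \<theta> (- x) ` A"
    then obtain \<omega>' where w: "\<omega>' \<in> A" "\<omega> = \<theta> (- x) \<omega>'" by blast
    then have "\<omega>' \<in> space M" using sets.sets_into_space[OF A] by blast
    then show "\<omega> \<in> \<theta> x -` A \<inter> space M" using w by (simp add: flow_add flow_0)
  qed
  then show "emeasure (distr M M (\<theta> x)) A = emeasure M A"
    using flow A by (subst emeasure_distr) (auto simp: measurable_flow_def)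
qed simp

lemma nn_integral_flow:
  assumes [measurable]: "f \<in> borel_measurable M"
  shows "(\<integral>\<^sup>+\<omega>. f (\<theta> x \<omega>) \<partial>M) = (\<integral>\<^sup>+\<omega>. f \<omega> \<partial>M)"
  by (subst (2) distr_flow[of x, symmetric]) (simp add: nn_integral_distr)

lemma \<Phi>_sets: "\<omega> \<in> space M \<Longrightarrow> sets (\<Phi> \<omega>) = sets borel"
  by (rule random_measure_sets[OF rm])

lemma \<Phi>_sigma_finite: "\<omega> \<in> space M \<Longrightarrow> sigma_finite_measure (\<Phi> \<omega>)"
  by (rule random_measure_sigma_finite[OF rm])

lemma \<Phi>_flow:
  assumes w: "\<omega> \<in> space M"
  shows "\<Phi> (\<theta> s \<omega>) = distr (\<Phi> \<omega>) borel (\<lambda>z. z - s)"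
proof (rule measure_eqI)
  note [measurable_cong] = \<Phi>_sets[OF w]
  fix A assume "A \<in> sets (\<Phi> (\<theta> s \<omega>))"
  then have A: "A \<in> sets borel" using \<Phi>_sets[of "\<theta> s \<omega>"] w by simp
  have "(\<lambda>b. b + s) ` A = (\<lambda>z. z - s) -` A \<inter> space (\<Phi> \<omega>)"
    using sets_eq_imp_space_eq[OF \<Phi>_sets[OF w]] by (auto simp: image_iff intro!: bexI[of _ "_ - s"])
  then show "emeasure (\<Phi> (\<theta> s \<omega>)) A = emeasure (distr (\<Phi> \<omega>) borel (\<lambda>z. z - s)) A"
  proof -
    assume im: "(\<lambda>b. b + s) ` A = (\<lambda>z. z - s) -` A \<inter> space (\<Phi> \<omega>)"
    have "emeasure (\<Phi> \<omega>) ((\<lambda>b. b + s) ` A) = emeasure (\<Phi> (\<theta> s \<omega>)) A"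
      using inv w A unfolding invariant_random_measure_def by blast
    then show ?thesis using A unfolding im by (subst emeasure_distr) auto
  qed
qed (use w in \<open>simp add: \<Phi>_sets\<close>)

lemma nn_integral_\<Phi>_flow:
  assumes w: "\<omega> \<in> space M" and [measurable]: "f \<in> borel_measurable borel"
  shows "(\<integral>\<^sup>+z. f z \<partial>\<Phi> (\<theta> s \<omega>)) = (\<integral>\<^sup>+z. f (z - s) \<partial>\<Phi> \<omega>)"
proof -
  note [measurable_cong] = \<Phi>_sets[OF w]
  show ?thesis unfolding \<Phi>_flow[OF w] by (rule nn_integral_distr) measurable
qed

lemma nn_integral_cube_shift: "(\<integral>\<^sup>+s. indicator (cbox 0 One) (x - s) \<partial>lborel) = (1::ennreal)"
  for x :: 'a
proof -
  have "(\<integral>\<^sup>+s. indicator (cbox 0 One) (x - s) \<partial>lborel) = (\<integral>\<^sup>+s. indicator (cbox 0 One) (s::'a) \<partial>lborel)"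
    using nn_integral_lborel_affine[of "\<lambda>s::'a. indicator (cbox 0 One) s" "-1" x] by simp
  also have "\<dots> = emeasure lborel (cbox 0 (One::'a))" by simp
  also have "\<dots> = 1" by (subst emeasure_lborel_cbox) auto
  finally show ?thesis .
qed

context
  fixes h :: "'a \<Rightarrow> 'w \<Rightarrow> ennreal"
  assumes h: "(\<lambda>(x, \<omega>). h x \<omega>) \<in> borel_measurable (borel \<Otimes>\<^sub>M M)"
begin

private lemma h_compose:
  "u \<in> N \<rightarrow>\<^sub>M borel \<Longrightarrow> v \<in> N \<rightarrow>\<^sub>M M \<Longrightarrow> (\<lambda>z. h (u z) (v z)) \<in> borel_measurable N"
  using measurable_compose[OF measurable_Pair h, of u N v] by simp

text \<open>Averaging over the shift of the cube turns the refined Campbell formula into a statement without Palm measures.\<close>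

lemma campbell:
  "(\<integral>\<^sup>+\<omega>. \<integral>\<^sup>+x. h x (\<theta> x \<omega>) \<partial>\<Phi> \<omega> \<partial>M)
    = (\<integral>\<^sup>+\<omega>. \<integral>\<^sup>+x. indicator (cbox 0 One) x * (\<integral>\<^sup>+s. h s (\<theta> x \<omega>) \<partial>lborel) \<partial>\<Phi> \<omega> \<partial>M)"
proof -
  let ?c = "indicator (cbox 0 One) :: 'a \<Rightarrow> ennreal"
  interpret P: pair_sigma_finite M "lborel :: 'a measure" ..
  note [measurable (raw)] = h_compose
  \<comment> \<open>The factor 1 is inserted as the integral over s of the cube indicator at x -
    s.\<close>
  have "(\<integral>\<^sup>+\<omega>. \<integral>\<^sup>+x. h x (\<theta> x \<omega>) \<partial>\<Phi> \<omega> \<partial>M)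
    = (\<integral>\<^sup>+\<omega>. \<integral>\<^sup>+s. \<integral>\<^sup>+x. ?c (x - s) * h x (\<theta> x \<omega>) \<partial>\<Phi> \<omega> \<partial>lborel \<partial>M)"
  proof (rule nn_integral_cong)
    fix \<omega> assume w[measurable]: "\<omega> \<in> space M"
    note [measurable_cong] = \<Phi>_sets[OF w]
    interpret \<Phi>: sigma_finite_measure "\<Phi> \<omega>" by (rule \<Phi>_sigma_finite[OF w])
    interpret Q: pair_sigma_finite "lborel :: 'a measure" "\<Phi> \<omega>" ..
    have "(\<integral>\<^sup>+x. h x (\<theta> x \<omega>) \<partial>\<Phi> \<omega>) = (\<integral>\<^sup>+x. (\<integral>\<^sup>+s. ?c (x - s) \<partial>lborel) * h x (\<theta> x \<omega>) \<partial>\<Phi> \<omega>)"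
      by (simp add: nn_integral_cube_shift)
    also have "\<dots> = (\<integral>\<^sup>+x. \<integral>\<^sup>+s. ?c (x - s) * h x (\<theta> x \<omega>) \<partial>lborel \<partial>\<Phi> \<omega>)"
      by (intro nn_integral_cong nn_integral_multc[symmetric]) measurable
    also have "\<dots> = (\<integral>\<^sup>+s. \<integral>\<^sup>+x. ?c (x - s) * h x (\<theta> x \<omega>) \<partial>\<Phi> \<omega> \<partial>lborel)"
      by (rule Q.Fubini') measurable
    finally show "(\<integral>\<^sup>+x. h x (\<theta> x \<omega>) \<partial>\<Phi> \<omega>) = (\<integral>\<^sup>+s. \<integral>\<^sup>+x. ?c (x - s) * h x (\<theta> x \<omega>) \<partial>\<Phi> \<omega> \<partial>lborel)" .
  qed
  also have "\<dots> = (\<integral>\<^sup>+s. \<integral>\<^sup>+\<omega>. \<integral>\<^sup>+x. ?c (x - s) * h x (\<theta> x \<omega>) \<partial>\<Phi> \<omega> \<partial>M \<partial>lborel)"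
  proof (rule P.Fubini'[symmetric])
    show "(\<lambda>(\<omega>, s). \<integral>\<^sup>+x. ?c (x - s) * h x (\<theta> x \<omega>) \<partial>\<Phi> \<omega>) \<in> borel_measurable (M \<Otimes>\<^sub>M lborel)"
      by (rule nn_integral_random_measure_measurable_param[OF rm, of "\<lambda>\<omega> s x. ?c (x - s) * h x (\<theta> x \<omega>)"])
        (simp only: case_prod_beta', measurable)
  qed
  \<comment> \<open>Invariance under \<open>\<theta> s\<close> moves the cube back to the origin; s
    survives only in the first argument of h, where Lebesgue translation can remove y.\<close>
  also have "\<dots> = (\<integral>\<^sup>+s. \<integral>\<^sup>+\<omega>. \<integral>\<^sup>+y. ?c y * h (y + s) (\<theta> y \<omega>) \<partial>\<Phi> \<omega> \<partial>M \<partial>lborel)"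
  proof (rule nn_integral_cong)
    fix s :: 'a
    have m: "(\<lambda>\<omega>. \<integral>\<^sup>+y. ?c y * h (y + s) (\<theta> y \<omega>) \<partial>\<Phi> \<omega>) \<in> borel_measurable M"
      by (rule nn_integral_random_measure_measurable[OF rm]) measurable
    have "(\<integral>\<^sup>+\<omega>. \<integral>\<^sup>+y. ?c y * h (y + s) (\<theta> y \<omega>) \<partial>\<Phi> \<omega> \<partial>M)
      = (\<integral>\<^sup>+\<omega>. \<integral>\<^sup>+y. ?c y * h (y + s) (\<theta> y (\<theta> s \<omega>)) \<partial>\<Phi> (\<theta> s \<omega>) \<partial>M)"
      by (rule nn_integral_flow[OF m, symmetric])
    also have "\<dots> = (\<integral>\<^sup>+\<omega>. \<integral>\<^sup>+x. ?c (x - s) * h x (\<theta> x \<omega>) \<partial>\<Phi> \<omega> \<partial>M)"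
    proof (rule nn_integral_cong)
      fix \<omega> assume w[measurable]: "\<omega> \<in> space M"
      have "(\<lambda>y. ?c y * h (y + s) (\<theta> y (\<theta> s \<omega>))) \<in> borel_measurable borel" by measurable
      from nn_integral_\<Phi>_flow[OF w this, of s]
      show "(\<integral>\<^sup>+y. ?c y * h (y + s) (\<theta> y (\<theta> s \<omega>)) \<partial>\<Phi> (\<theta> s \<omega>)) = (\<integral>\<^sup>+x. ?c (x - s) * h x (\<theta> x \<omega>) \<partial>\<Phi> \<omega>)"
        using w by (simp add: flow_add)
    qed
    finally show "(\<integral>\<^sup>+\<omega>. \<integral>\<^sup>+x. ?c (x - s) * h x (\<theta> x \<omega>) \<partial>\<Phi> \<omega> \<partial>M)
      = (\<integral>\<^sup>+\<omega>. \<integral>\<^sup>+y. ?c y * h (y + s) (\<theta> y \<omega>) \<partial>\<Phi> \<omega> \<partial>M)" by simp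
  qed
  also have "\<dots> = (\<integral>\<^sup>+\<omega>. \<integral>\<^sup>+s. \<integral>\<^sup>+y. ?c y * h (y + s) (\<theta> y \<omega>) \<partial>\<Phi> \<omega> \<partial>lborel \<partial>M)"
  proof (rule P.Fubini')
    show "(\<lambda>(\<omega>, s). \<integral>\<^sup>+y. ?c y * h (y + s) (\<theta> y \<omega>) \<partial>\<Phi> \<omega>) \<in> borel_measurable (M \<Otimes>\<^sub>M lborel)"
      by (rule nn_integral_random_measure_measurable_param[OF rm, of "\<lambda>\<omega> s y. ?c y * h (y + s) (\<theta> y \<omega>)"])
        (simp only: case_prod_beta', measurable)
  qed
  also have "\<dots> = (\<integral>\<^sup>+\<omega>. \<integral>\<^sup>+x. ?c x * (\<integral>\<^sup>+s. h s (\<theta> x \<omega>) \<partial>lborel) \<partial>\<Phi> \<omega> \<partial>M)"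
  proof (rule nn_integral_cong)
    fix \<omega> assume w[measurable]: "\<omega> \<in> space M"
    note [measurable_cong] = \<Phi>_sets[OF w]
    interpret \<Phi>: sigma_finite_measure "\<Phi> \<omega>" by (rule \<Phi>_sigma_finite[OF w])
    interpret Q: pair_sigma_finite "lborel :: 'a measure" "\<Phi> \<omega>" ..
    have "(\<integral>\<^sup>+s. \<integral>\<^sup>+y. ?c y * h (y + s) (\<theta> y \<omega>) \<partial>\<Phi> \<omega> \<partial>lborel) = (\<integral>\<^sup>+y. \<integral>\<^sup>+s. ?c y * h (y + s) (\<theta> y \<omega>) \<partial>lborel \<partial>\<Phi> \<omega>)"
      by (rule Q.Fubini'[symmetric]) measurable
    also have "\<dots> = (\<integral>\<^sup>+y. ?c y * (\<integral>\<^sup>+s. h (y + s) (\<theta> y \<omega>) \<partial>lborel) \<partial>\<Phi> \<omega>)"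
      by (intro nn_integral_cong nn_integral_cmult) measurable
    also have "\<dots> = (\<integral>\<^sup>+y. ?c y * (\<integral>\<^sup>+s. h s (\<theta> y \<omega>) \<partial>lborel) \<partial>\<Phi> \<omega>)"
    proof (rule nn_integral_cong)
      fix y
      have "(\<integral>\<^sup>+s. h (y + s) (\<theta> y \<omega>) \<partial>lborel) = (\<integral>\<^sup>+s. h s (\<theta> y \<omega>) \<partial>lborel)"
        by (rule nn_integral_lborel_translate) measurable
      then show "?c y * (\<integral>\<^sup>+s. h (y + s) (\<theta> y \<omega>) \<partial>lborel) = ?c y * (\<integral>\<^sup>+s. h s (\<theta> y \<omega>) \<partial>lborel)" by simp
    qed
    finally show "(\<integral>\<^sup>+s. \<integral>\<^sup>+y. ?c y * h (y + s) (\<theta> y \<omega>) \<partial>\<Phi> \<omega> \<partial>lborel)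
      = (\<integral>\<^sup>+x. ?c x * (\<integral>\<^sup>+s. h s (\<theta> x \<omega>) \<partial>lborel) \<partial>\<Phi> \<omega>)" .
  qed
  finally show ?thesis .
qed

end

text \<open>The case of \<open>campbell\<close> in which h ignores the random element: the first
  moment measure is a multiple of Lebesgue measure.\<close>

lemma nn_integral_\<Phi>:
  assumes [measurable]: "h \<in> borel_measurable borel"
  shows "(\<integral>\<^sup>+\<omega>. \<integral>\<^sup>+x. h x \<partial>\<Phi> \<omega> \<partial>M) = intensity M \<Phi> * (\<integral>\<^sup>+x. h x \<partial>lborel)"
proof -
  have "(\<integral>\<^sup>+\<omega>. \<integral>\<^sup>+x. h x \<partial>\<Phi> \<omega> \<partial>M)
    = (\<integral>\<^sup>+\<omega>. \<integral>\<^sup>+x. indicator (cbox 0 One) x * (\<integral>\<^sup>+s. h s \<partial>lborel) \<partial>\<Phi> \<omega> \<partial>M)"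
    by (rule campbell[of "\<lambda>x \<omega>. h x"]) measurable
  also have "\<dots> = (\<integral>\<^sup>+\<omega>. emeasure (\<Phi> \<omega>) (cbox 0 One) * (\<integral>\<^sup>+s. h s \<partial>lborel) \<partial>M)"
  proof (rule nn_integral_cong)
    fix \<omega> assume w: "\<omega> \<in> space M"
    note [measurable_cong] = \<Phi>_sets[OF w]
    have [measurable]: "cbox 0 One \<in> sets (\<Phi> \<omega>)" by (simp add: \<Phi>_sets[OF w])
    show "(\<integral>\<^sup>+x. indicator (cbox 0 One) x * (\<integral>\<^sup>+s. h s \<partial>lborel) \<partial>\<Phi> \<omega>) = emeasure (\<Phi> \<omega>) (cbox 0 One) * (\<integral>\<^sup>+s. h s \<partial>lborel)"
      by (subst nn_integral_multc) simp_all
  qed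
  also have "\<dots> = intensity M \<Phi> * (\<integral>\<^sup>+x. h x \<partial>lborel)"
    unfolding intensity_def by (intro nn_integral_multc random_measure_emeasure[OF rm]) simp
  finally show ?thesis .
qed

end

locale palm_setting = flow_random_measure M \<theta> \<Phi>
  for M :: "'w measure" and \<theta> :: "'a::euclidean_space \<Rightarrow> 'w \<Rightarrow> 'w" and \<Phi> :: "'w \<Rightarrow> 'a measure" +
  fixes P2 :: "'a \<Rightarrow> 'w measure"
  assumes lsi: "locally_square_integrable M \<Phi>" and intensity_finite: "intensity M \<Phi> < \<infinity>"
    and palm2: "two_point_palm M \<theta> \<Phi> P2"
begin

abbreviation \<alpha> :: "'a measure" where "\<alpha> \<equiv> reduced_second_moment M \<Phi>"

definition \<gamma> :: real where "\<gamma> = enn2real (intensity M \<Phi>)"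

lemma \<gamma>: "intensity M \<Phi> = ennreal \<gamma>" "0 \<le> \<gamma>"
  using intensity_finite by (simp_all add: \<gamma>_def)

lemma sets_\<alpha>[measurable_cong, simp]: "sets \<alpha> = sets borel"
  using sets.sigma_sets_eq[of "borel :: 'a measure"] by (simp add: reduced_second_moment_def)

lemma space_\<alpha>[simp]: "space \<alpha> = UNIV"
  by (simp add: reduced_second_moment_def)

lemma P2: "P2 z \<in> space (prob_algebra M)"
  using palm2 measurable_space[of P2 borel "prob_algebra M" z] unfolding two_point_palm_def by simp

lemma P2_prob: "prob_space (P2 z)" and P2_sets[measurable_cong]: "sets (P2 z) = sets M"
  using P2[of z] by (auto simp: space_prob_algebra)

lemma P2_measurable: "P2 \<in> borel \<rightarrow>\<^sub>M prob_algebra M"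
  using palm2 unfolding two_point_palm_def by simp

lemma two_point:
  assumes f[measurable]: "(\<lambda>(x, y, \<omega>). f x y \<omega>) \<in> borel_measurable (borel \<Otimes>\<^sub>M borel \<Otimes>\<^sub>M M)"
  shows "(\<integral>\<^sup>+\<omega>. \<integral>\<^sup>+x. \<integral>\<^sup>+y. f x (y - x) (\<theta> x \<omega>) \<partial>\<Phi> \<omega> \<partial>\<Phi> \<omega> \<partial>M)
    = (\<integral>\<^sup>+x. \<integral>\<^sup>+y. \<integral>\<^sup>+\<omega>. f x y \<omega> \<partial>P2 y \<partial>\<alpha> \<partial>lborel)"
proof -
  have "(\<integral>\<^sup>+\<omega>. \<integral>\<^sup>+x. \<integral>\<^sup>+y. f x (y - x) (\<theta> x \<omega>) \<partial>\<Phi> \<omega> \<partial>\<Phi> \<omega> \<partial>M)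
    = (\<integral>\<^sup>+\<omega>. \<integral>\<^sup>+p. (case p of (x, y) \<Rightarrow> f x (y - x) (\<theta> x \<omega>)) \<partial>(\<Phi> \<omega> \<Otimes>\<^sub>M \<Phi> \<omega>) \<partial>M)"
  proof (rule nn_integral_cong)
    fix \<omega> assume w[measurable]: "\<omega> \<in> space M"
    note [measurable_cong] = \<Phi>_sets[OF w]
    interpret \<Phi>: sigma_finite_measure "\<Phi> \<omega>" by (rule \<Phi>_sigma_finite[OF w])
    have "(\<lambda>p. (fst p, snd p - fst p, \<theta> (fst p) \<omega>)) \<in> \<Phi> \<omega> \<Otimes>\<^sub>M \<Phi> \<omega> \<rightarrow>\<^sub>M borel \<Otimes>\<^sub>M borel \<Otimes>\<^sub>M M" by measurable
    from measurable_compose[OF this f]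
    have "(\<lambda>p. case p of (x, y) \<Rightarrow> f x (y - x) (\<theta> x \<omega>)) \<in> borel_measurable (\<Phi> \<omega> \<Otimes>\<^sub>M \<Phi> \<omega>)"
      by (simp add: case_prod_beta')
    from \<Phi>.nn_integral_fst[OF this]
    show "(\<integral>\<^sup>+x. \<integral>\<^sup>+y. f x (y - x) (\<theta> x \<omega>) \<partial>\<Phi> \<omega> \<partial>\<Phi> \<omega>)
      = (\<integral>\<^sup>+p. (case p of (x, y) \<Rightarrow> f x (y - x) (\<theta> x \<omega>)) \<partial>(\<Phi> \<omega> \<Otimes>\<^sub>M \<Phi> \<omega>))" by simp
  qed
  also have "\<dots> = (\<integral>\<^sup>+x. \<integral>\<^sup>+y. \<integral>\<^sup>+\<omega>. f x y \<omega> \<partial>P2 y \<partial>\<alpha> \<partial>lborel)"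
    using palm2 f unfolding two_point_palm_def by (auto dest!: spec[of _ "\<lambda>(x, y, \<omega>). f x y \<omega>"])
  finally show ?thesis .
qed

text \<open>If f ignores the random element, the probability kernel P2 integrates out. Values of
  \<alpha> are accessed through this identity instead of through countable additivity of the set
  function inside \<open>measure_of\<close>.\<close>

lemma second_moment_formula:
  assumes [measurable]: "(\<lambda>(x, y). f x y) \<in> borel_measurable (borel \<Otimes>\<^sub>M borel)"
  shows "(\<integral>\<^sup>+\<omega>. \<integral>\<^sup>+x. \<integral>\<^sup>+y. f x (y - x) \<partial>\<Phi> \<omega> \<partial>\<Phi> \<omega> \<partial>M) = (\<integral>\<^sup>+x. \<integral>\<^sup>+y. f x y \<partial>\<alpha> \<partial>lborel)"
proof -
  have "(\<integral>\<^sup>+\<omega>. f x y \<partial>P2 y) = f x y" for x y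
    using prob_space.emeasure_space_1[OF P2_prob, of y] by simp
  moreover have "(\<lambda>p::'a \<times> 'a \<times> 'w. (fst p, fst (snd p))) \<in> borel \<Otimes>\<^sub>M borel \<Otimes>\<^sub>M M \<rightarrow>\<^sub>M borel \<Otimes>\<^sub>M borel" by measurable
  from measurable_compose[OF this assms]
  have "(\<lambda>(x, y, \<omega>). f x y) \<in> borel_measurable (borel \<Otimes>\<^sub>M borel \<Otimes>\<^sub>M M)" by (simp add: case_prod_beta')
  ultimately show ?thesis using two_point[of "\<lambda>x y \<omega>. f x y"] by simp
qed

lemma square_finite: "B \<in> sets borel \<Longrightarrow> bounded B \<Longrightarrow> (\<integral>\<^sup>+\<omega>. (emeasure (\<Phi> \<omega>) B)\<^sup>2 \<partial>M) < \<infinity>"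
  using lsi unfolding locally_square_integrable_def by blast

lemma nn_integral_indicators:
  assumes w: "\<omega> \<in> space M" and "A \<in> sets borel" "B \<in> sets borel"
  shows "(\<integral>\<^sup>+x. \<integral>\<^sup>+y. indicator A x * indicator B y \<partial>\<Phi> \<omega> \<partial>\<Phi> \<omega>) = emeasure (\<Phi> \<omega>) A * emeasure (\<Phi> \<omega>) B"
proof -
  note [measurable_cong] = \<Phi>_sets[OF w]
  have [measurable]: "A \<in> sets (\<Phi> \<omega>)" "B \<in> sets (\<Phi> \<omega>)" using assms by (simp_all add: \<Phi>_sets[OF w])
  show ?thesis by (simp add: nn_integral_cmult nn_integral_multc)
qed

text \<open>The unit cube has volume 1, so \<open>second_moment_formula\<close> expresses
  \<alpha>(B) through pairs with x in the cube and y - x in B. Both points then lie in the ball D,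
  and the second moment of \<open>\<Phi>\<close> on D is finite.\<close>

lemma \<alpha>_finite:
  assumes B[measurable]: "B \<in> sets borel" and bB: "bounded B"
  shows "emeasure \<alpha> B < \<infinity>"
proof -
  obtain r where r: "\<forall>x\<in>B. norm x \<le> r" using bB unfolding bounded_iff by blast
  obtain s where s: "\<forall>x\<in>cbox 0 (One::'a). norm x \<le> s" using bounded_cbox[of 0 "One::'a"] unfolding bounded_iff by blast
  define D where "D = cball (0::'a) (\<bar>r\<bar> + \<bar>s\<bar>)"
  have D: "D \<in> sets borel" "bounded D" by (auto simp: D_def)
  have "emeasure \<alpha> B = (\<integral>\<^sup>+(x::'a). indicator (cbox 0 One) x * emeasure \<alpha> B \<partial>lborel)"
    by (subst nn_integral_multc) (auto simp: emeasure_lborel_cbox)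
  also have "\<dots> = (\<integral>\<^sup>+(x::'a). \<integral>\<^sup>+y. indicator (cbox 0 One) x * indicator B y \<partial>\<alpha> \<partial>lborel)"
    by (intro nn_integral_cong) (simp add: nn_integral_cmult)
  also have "\<dots> = (\<integral>\<^sup>+\<omega>. \<integral>\<^sup>+x. \<integral>\<^sup>+y. indicator (cbox 0 One) x * indicator B (y - x) \<partial>\<Phi> \<omega> \<partial>\<Phi> \<omega> \<partial>M)"
    by (rule second_moment_formula[symmetric]) measurable
  also have "\<dots> \<le> (\<integral>\<^sup>+\<omega>. \<integral>\<^sup>+x. \<integral>\<^sup>+y. indicator D x * indicator D y \<partial>\<Phi> \<omega> \<partial>\<Phi> \<omega> \<partial>M)"
  proof (intro nn_integral_mono)
    fix \<omega> x y
    show "indicator (cbox 0 One) x * indicator B (y - x) \<le> (indicator D x * indicator D y :: ennreal)"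
    proof (cases "x \<in> cbox 0 One \<and> y - x \<in> B")
      case True
      then have "norm x \<le> s" "norm (y - x) \<le> r" using r s by auto
      then have "x \<in> D" "y \<in> D" using norm_triangle_ineq[of x "y - x"] by (auto simp: D_def)
      then show ?thesis by (simp add: indicator_def)
    qed (auto simp: indicator_def)
  qed
  also have "\<dots> = (\<integral>\<^sup>+\<omega>. (emeasure (\<Phi> \<omega>) D)\<^sup>2 \<partial>M)"
    by (intro nn_integral_cong) (simp add: nn_integral_indicators D power2_eq_square)
  also have "\<dots> < \<infinity>" by (rule square_finite[OF D])
  finally show ?thesis .
qed

lemma sigma_finite_\<alpha>: "sigma_finite_measure \<alpha>"
  by (rule sigma_finite_if_bounded_finite[OF sets_\<alpha> \<alpha>_finite])

text \<open>The overlap is the integral over x of indicators of x and x + z + w in B; with z = y - x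
  the second condition reads y + w in B, and the integrals against \<open>\<Phi>\<close>
  separate.\<close>

lemma nn_integral_overlap_\<alpha>:
  assumes B[measurable]: "B \<in> sets borel" and bB: "bounded B"
  shows "(\<integral>\<^sup>+z. ennreal (overlap B (z + w)) \<partial>\<alpha>)
    = (\<integral>\<^sup>+\<omega>. emeasure (\<Phi> \<omega>) B * emeasure (\<Phi> \<omega>) ((\<lambda>y. y + w) -` B) \<partial>M)"
proof -
  interpret \<alpha>: sigma_finite_measure \<alpha> by (rule sigma_finite_\<alpha>)
  interpret Q: pair_sigma_finite "lborel :: 'a measure" \<alpha> ..
  have Bw: "(\<lambda>y. y + w) -` B \<in> sets borel"
    using measurable_sets[of "\<lambda>y. y + w" borel borel B] by simp
  have "(\<integral>\<^sup>+z. ennreal (overlap B (z + w)) \<partial>\<alpha>) = (\<integral>\<^sup>+z. \<integral>\<^sup>+x. indicator B x * indicator B (x + (z + w)) \<partial>lborel \<partial>\<alpha>)"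
    by (simp add: overlap_nn[OF B bB])
  also have "\<dots> = (\<integral>\<^sup>+x. \<integral>\<^sup>+z. indicator B x * indicator B (x + (z + w)) \<partial>\<alpha> \<partial>lborel)"
    by (rule Q.Fubini') measurable
  also have "\<dots> = (\<integral>\<^sup>+\<omega>. \<integral>\<^sup>+x. \<integral>\<^sup>+y. indicator B x * indicator B (x + ((y - x) + w)) \<partial>\<Phi> \<omega> \<partial>\<Phi> \<omega> \<partial>M)"
    by (rule second_moment_formula[symmetric]) measurable
  also have "\<dots> = (\<integral>\<^sup>+\<omega>. \<integral>\<^sup>+x. \<integral>\<^sup>+y. indicator B x * indicator ((\<lambda>y. y + w) -` B) y \<partial>\<Phi> \<omega> \<partial>\<Phi> \<omega> \<partial>M)"
    by (intro nn_integral_cong) (simp add: indicator_def algebra_simps)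
  also have "\<dots> = (\<integral>\<^sup>+\<omega>. emeasure (\<Phi> \<omega>) B * emeasure (\<Phi> \<omega>) ((\<lambda>y. y + w) -` B) \<partial>M)"
    by (intro nn_integral_cong nn_integral_indicators B Bw)
  finally show ?thesis .
qed

lemma nn_integral_overlap_\<alpha>_0:
  assumes B: "B \<in> sets borel" "bounded B"
  shows "(\<integral>\<^sup>+z. ennreal (overlap B z) \<partial>\<alpha>) = (\<integral>\<^sup>+\<omega>. (emeasure (\<Phi> \<omega>) B)\<^sup>2 \<partial>M)"
  using nn_integral_overlap_\<alpha>[OF B, of 0] by (simp add: vimage_def power2_eq_square)

text \<open>From 2 X Y \<le> X^2 + Y^2, where Y is X composed with the flow and so has the same
  second moment.\<close>

lemma overlap_shift_\<alpha>:
  assumes B: "B \<in> sets borel" "bounded B"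
  shows "(\<integral>\<^sup>+z. ennreal (overlap B (z + w)) \<partial>\<alpha>) \<le> (\<integral>\<^sup>+z. ennreal (overlap B z) \<partial>\<alpha>)"
proof -
  let ?X = "\<lambda>\<omega>. emeasure (\<Phi> \<omega>) B" and ?Y = "\<lambda>\<omega>. emeasure (\<Phi> \<omega>) ((\<lambda>y. y + w) -` B)"
  have Bw: "(\<lambda>y. y + w) -` B \<in> sets borel"
    using measurable_sets[of "\<lambda>y. y + w" borel borel B] B by simp
  have [measurable]: "?X \<in> borel_measurable M" "?Y \<in> borel_measurable M"
    using random_measure_emeasure[OF rm] B Bw by blast+
  have "?Y \<omega> = ?X (\<theta> (- w) \<omega>)" if w: "\<omega> \<in> space M" for \<omega>
  proof -
    note [measurable_cong] = \<Phi>_sets[OF w]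
    show ?thesis unfolding \<Phi>_flow[OF w] using B sets_eq_imp_space_eq[OF \<Phi>_sets[OF w]]
      by (subst emeasure_distr) auto
  qed
  then have "(\<integral>\<^sup>+\<omega>. (?Y \<omega>)\<^sup>2 \<partial>M) = (\<integral>\<^sup>+\<omega>. (?X (\<theta> (- w) \<omega>))\<^sup>2 \<partial>M)"
    by (intro nn_integral_cong) simp
  also have "\<dots> = (\<integral>\<^sup>+\<omega>. (?X \<omega>)\<^sup>2 \<partial>M)"
    by (rule nn_integral_flow[of "\<lambda>\<omega>. (?X \<omega>)\<^sup>2"]) measurable
  finally have Y: "(\<integral>\<^sup>+\<omega>. (?Y \<omega>)\<^sup>2 \<partial>M) = (\<integral>\<^sup>+\<omega>. (?X \<omega>)\<^sup>2 \<partial>M)" .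
  have "2 * (a * b) \<le> a\<^sup>2 + b\<^sup>2" for a b :: ennreal
  proof (cases "a = \<top> \<or> b = \<top>")
    case True then show ?thesis by (auto simp: power2_eq_square ennreal_top_mult)
  next
    case False
    then obtain x y where xy: "a = ennreal x" "b = ennreal y" "0 \<le> x" "0 \<le> y"
      by (cases a; cases b) auto
    have "2 * (a * b) = ennreal (2 * (x * y))" using xy by (simp add: ennreal_mult ennreal_numeral)
    also have "\<dots> \<le> ennreal (x\<^sup>2 + y\<^sup>2)" using sum_squares_bound[of x y] by (intro ennreal_leI) (simp add: mult.assoc)
    also have "\<dots> = a\<^sup>2 + b\<^sup>2" using xy by (simp add: ennreal_power)
    finally show ?thesis .
  qed
  then have "2 * (\<integral>\<^sup>+\<omega>. ?X \<omega> * ?Y \<omega> \<partial>M) \<le> (\<integral>\<^sup>+\<omega>. (?X \<omega>)\<^sup>2 + (?Y \<omega>)\<^sup>2 \<partial>M)"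
    by (subst nn_integral_cmult[symmetric]) (auto intro!: nn_integral_mono)
  also have "\<dots> = 2 * (\<integral>\<^sup>+\<omega>. (?X \<omega>)\<^sup>2 \<partial>M)"
    by (subst nn_integral_add) (auto simp: Y mult_2)
  finally have "(\<integral>\<^sup>+\<omega>. ?X \<omega> * ?Y \<omega> \<partial>M) \<le> (\<integral>\<^sup>+\<omega>. (?X \<omega>)\<^sup>2 \<partial>M)"
    by (subst (asm) ennreal_mult_le_mult_iff) auto
  then show ?thesis unfolding nn_integral_overlap_\<alpha>[OF B] nn_integral_overlap_\<alpha>_0[OF B] .
qed

sublocale \<alpha>: shift_bounded_measure \<alpha>
  by (unfold_locales, rule sets_\<alpha>, rule \<alpha>_finite, assumption+, rule overlap_shift_\<alpha>)

end

section \<open>Variances of nonnegative extended real variables\<close>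

lemma (in prob_space) AE_finite_of_square:
  fixes Y :: "'a \<Rightarrow> ennreal"
  assumes [measurable]: "Y \<in> borel_measurable M" and f: "(\<integral>\<^sup>+\<omega>. (Y \<omega>)\<^sup>2 \<partial>M) < \<infinity>"
  shows "AE \<omega> in M. Y \<omega> = ennreal (enn2real (Y \<omega>))"
proof -
  have "AE \<omega> in M. (Y \<omega>)\<^sup>2 \<noteq> \<infinity>" using f by (intro nn_integral_PInf_AE) auto
  then show ?thesis by eventually_elim (auto simp: power2_eq_square ennreal_mult_eq_top_iff less_top)
qed

text \<open>\<open>enn2real\<close> sends infinity to 0, which affects only the null set where Y is
  infinite. Such a set may be nonempty for the transported measure.\<close>

lemma (in prob_space) square_integrable_enn2real:
  fixes Y :: "'a \<Rightarrow> ennreal"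
  assumes Y[measurable]: "Y \<in> borel_measurable M" and f: "(\<integral>\<^sup>+\<omega>. (Y \<omega>)\<^sup>2 \<partial>M) < \<infinity>"
  shows "integrable M (\<lambda>\<omega>. (enn2real (Y \<omega>))\<^sup>2)" "integrable M (\<lambda>\<omega>. enn2real (Y \<omega>))"
    and "(\<integral>\<omega>. (enn2real (Y \<omega>))\<^sup>2 \<partial>M) = enn2real (\<integral>\<^sup>+\<omega>. (Y \<omega>)\<^sup>2 \<partial>M)"
    and "(\<integral>\<omega>. enn2real (Y \<omega>) \<partial>M) = enn2real (\<integral>\<^sup>+\<omega>. Y \<omega> \<partial>M)"
proof -
  note ae = AE_finite_of_square[OF Y f]
  have e2: "(\<integral>\<^sup>+\<omega>. ennreal ((enn2real (Y \<omega>))\<^sup>2) \<partial>M) = (\<integral>\<^sup>+\<omega>. (Y \<omega>)\<^sup>2 \<partial>M)"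
    by (rule nn_integral_cong_AE, use ae in eventually_elim) (metis ennreal_power enn2real_nonneg)
  have e1: "(\<integral>\<^sup>+\<omega>. ennreal (enn2real (Y \<omega>)) \<partial>M) = (\<integral>\<^sup>+\<omega>. Y \<omega> \<partial>M)"
    by (rule nn_integral_cong_AE, use ae in eventually_elim) metis
  show i2: "integrable M (\<lambda>\<omega>. (enn2real (Y \<omega>))\<^sup>2)"
    using f by (intro integrableI_nonneg) (auto simp: e2)
  show "integrable M (\<lambda>\<omega>. enn2real (Y \<omega>))"
    by (rule square_integrable_imp_integrable[OF _ i2]) measurable
  show "(\<integral>\<omega>. (enn2real (Y \<omega>))\<^sup>2 \<partial>M) = enn2real (\<integral>\<^sup>+\<omega>. (Y \<omega>)\<^sup>2 \<partial>M)"
    by (subst integral_eq_nn_integral) (auto simp: e2)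
  show "(\<integral>\<omega>. enn2real (Y \<omega>) \<partial>M) = enn2real (\<integral>\<^sup>+\<omega>. Y \<omega> \<partial>M)"
    by (subst integral_eq_nn_integral) (auto simp: e1)
qed

lemma (in prob_space) variance_enn2real:
  fixes Y :: "'a \<Rightarrow> ennreal"
  assumes Y: "Y \<in> borel_measurable M" and f: "(\<integral>\<^sup>+\<omega>. (Y \<omega>)\<^sup>2 \<partial>M) < \<infinity>"
  shows "variance (\<lambda>\<omega>. enn2real (Y \<omega>)) = enn2real (\<integral>\<^sup>+\<omega>. (Y \<omega>)\<^sup>2 \<partial>M) - (enn2real (\<integral>\<^sup>+\<omega>. Y \<omega> \<partial>M))\<^sup>2"
  using square_integrable_enn2real[OF Y f] by (subst variance_eq) simp_all

context palm_setting
begin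

section \<open>Positive definiteness of the covariance measure\<close>

text \<open>Completing the square: 2s |x|^2 + 2s |x + z|^2 = 4s |x + z/2|^2 + s |z|^2, and the first
  term integrates to a constant over x. The function u will be 1 and 1 + cos, whence the bounds 0
  and 2.\<close>

lemma gaussian_second_moment:
  assumes s: "0 < s" and [measurable]: "u \<in> borel_measurable borel" and u: "\<And>z. 0 \<le> u z" "\<And>z. u z \<le> 2"
  shows "(\<integral>\<^sup>+\<omega>. \<integral>\<^sup>+x. \<integral>\<^sup>+y. ennreal (exp (- (2 * s) * (norm x)\<^sup>2) * exp (- (2 * s) * (norm y)\<^sup>2) * u (y - x)) \<partial>\<Phi> \<omega> \<partial>\<Phi> \<omega> \<partial>M)
    = ennreal (sqrt (pi / (4 * s)) ^ DIM('a) * (\<integral>z. exp (- s * (norm z)\<^sup>2) * u z \<partial>\<alpha>))"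
proof -
  let ?g = "\<lambda>x::'a. exp (- (2 * s) * (norm x)\<^sup>2)"
  interpret \<alpha>': sigma_finite_measure \<alpha> by (rule sigma_finite_\<alpha>)
  interpret Q: pair_sigma_finite "lborel :: 'a measure" \<alpha> ..
  have w: "(\<integral>\<^sup>+x. ennreal (?g x * ?g (x + z) * u z) \<partial>lborel)
      = ennreal (sqrt (pi / (4 * s)) ^ DIM('a) * (exp (- s * (norm z)\<^sup>2) * u z))" for z
  proof -
    have e: "?g x * ?g (x + z) * u z = exp (- (4 * s) * (norm (z /\<^sub>R 2 + x))\<^sup>2) * (exp (- s * (norm z)\<^sup>2) * u z)" for x
    proof -
      have "- (2 * s) * (norm x)\<^sup>2 + - (2 * s) * (norm (x + z))\<^sup>2 = - (4 * s) * (norm (z /\<^sub>R 2 + x))\<^sup>2 + - s * (norm z)\<^sup>2"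
        unfolding power2_norm_eq_inner
        by (simp add: inner_add_left inner_add_right inner_commute[of z x] algebra_simps)
      then show ?thesis by (simp only: exp_add[symmetric] mult.assoc[symmetric])
    qed
    have "(\<integral>\<^sup>+x. ennreal (?g x * ?g (x + z) * u z) \<partial>lborel)
      = (\<integral>\<^sup>+x. ennreal (exp (- (4 * s) * (norm (z /\<^sub>R 2 + x))\<^sup>2)) * ennreal (exp (- s * (norm z)\<^sup>2) * u z) \<partial>lborel)"
      unfolding e using u by (intro nn_integral_cong ennreal_mult) auto
    also have "\<dots> = (\<integral>\<^sup>+x. ennreal (exp (- (4 * s) * (norm (z /\<^sub>R 2 + x))\<^sup>2)) \<partial>lborel) * ennreal (exp (- s * (norm z)\<^sup>2) * u z)"
      by (rule nn_integral_multc) measurable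
    also have "(\<integral>\<^sup>+x. ennreal (exp (- (4 * s) * (norm (z /\<^sub>R 2 + x))\<^sup>2)) \<partial>lborel)
       = (\<integral>\<^sup>+(x::'a). ennreal (exp (- (4 * s) * (norm x)\<^sup>2)) \<partial>lborel)"
      by (rule nn_integral_lborel_translate) measurable
    also have "\<dots> = ennreal (sqrt (pi / (4 * s)) ^ DIM('a))"
      using s by (subst nn_integral_eq_integral[OF integrable_gaussian]) (auto simp: integral_gaussian[of "4 * s", simplified])
    finally show ?thesis using s u by (simp add: ennreal_mult)
  qed
  have i: "integrable \<alpha> (\<lambda>z. exp (- s * (norm z)\<^sup>2) * u z)"
  proof (rule Bochner_Integration.integrable_bound[OF integrable_mult_right[OF \<alpha>.integrable_gaussian_\<alpha>[OF s], of 2]])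
    show "AE z in \<alpha>. norm (exp (- s * (norm z)\<^sup>2) * u z) \<le> norm (2 * exp (- s * (norm z)\<^sup>2))"
      using u by (intro AE_I2) (auto simp: abs_mult)
  qed measurable
  have "(\<integral>\<^sup>+\<omega>. \<integral>\<^sup>+x. \<integral>\<^sup>+y. ennreal (?g x * ?g y * u (y - x)) \<partial>\<Phi> \<omega> \<partial>\<Phi> \<omega> \<partial>M)
      = (\<integral>\<^sup>+\<omega>. \<integral>\<^sup>+x. \<integral>\<^sup>+y. ennreal (?g x * ?g (x + (y - x)) * u (y - x)) \<partial>\<Phi> \<omega> \<partial>\<Phi> \<omega> \<partial>M)"
    by simp
  also have "\<dots> = (\<integral>\<^sup>+x. \<integral>\<^sup>+z. ennreal (?g x * ?g (x + z) * u z) \<partial>\<alpha> \<partial>lborel)"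
    by (rule second_moment_formula[of "\<lambda>x z. ennreal (?g x * ?g (x + z) * u z)"]) measurable
  also have "\<dots> = (\<integral>\<^sup>+z. \<integral>\<^sup>+x. ennreal (?g x * ?g (x + z) * u z) \<partial>lborel \<partial>\<alpha>)"
    by (rule Q.Fubini'[symmetric]) measurable
  also have "\<dots> = ennreal (\<integral>z. sqrt (pi / (4 * s)) ^ DIM('a) * (exp (- s * (norm z)\<^sup>2) * u z) \<partial>\<alpha>)"
    unfolding w using u s by (intro nn_integral_eq_integral integrable_mult_right i AE_I2) auto
  finally show ?thesis by simp
qed

text \<open>Jensen's inequality for the cosine integral X of the Gaussian g against
  \<open>\<Phi>\<close>: its mean is the intensity times a Lebesgue integral, and X^2 is at most the
  squared modulus of the complex exponential integral, whose mean is an integral against \<alpha>.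
  The moment formulas need nonnegative integrands, so 1 + cos is used in place of cos and the
  contribution of 1 is subtracted afterwards.\<close>

lemma positive_definite:
  assumes s: "0 < s"
  shows "\<gamma>\<^sup>2 * (\<integral>z. exp (- s * (norm z)\<^sup>2) * cos (k \<bullet> z) \<partial>lborel) \<le> (\<integral>z. exp (- s * (norm z)\<^sup>2) * cos (k \<bullet> z) \<partial>\<alpha>)"
proof -
  define g where "g x = exp (- (2 * s) * (norm x)\<^sup>2)" for x :: 'a
  have [measurable]: "g \<in> borel_measurable borel" unfolding g_def[abs_def] by measurable
  have g0: "0 < g x" for x by (simp add: g_def)
  have c1: "0 \<le> 1 + cos t" for t :: real using cos_ge_minus_one[of t] by linarith
  define c where "c = sqrt (pi / (4 * s)) ^ DIM('a)"
  have c: "c > 0" using s by (simp add: c_def)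
  define Y where "Y \<omega> = (\<integral>\<^sup>+x. ennreal (g x) \<partial>\<Phi> \<omega>)" for \<omega>
  define H where "H \<omega> = (\<integral>\<^sup>+x. ennreal (g x * (1 + cos (k \<bullet> x))) \<partial>\<Phi> \<omega>)" for \<omega>
  have Y[measurable]: "Y \<in> borel_measurable M" unfolding Y_def[abs_def]
    by (rule nn_integral_random_measure_measurable[OF rm]) measurable
  have H[measurable]: "H \<in> borel_measurable M" unfolding H_def[abs_def]
    by (rule nn_integral_random_measure_measurable[OF rm]) measurable
  let ?A = "\<integral>z. exp (- s * (norm z)\<^sup>2) \<partial>\<alpha>" and ?C = "\<integral>z. exp (- s * (norm z)\<^sup>2) * cos (k \<bullet> z) \<partial>\<alpha>"
  have gi: "integrable \<alpha> (\<lambda>z. exp (- s * (norm z)\<^sup>2))" by (rule \<alpha>.integrable_gaussian_\<alpha>[OF s])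
  have gci: "integrable \<alpha> (\<lambda>z. exp (- s * (norm z)\<^sup>2) * cos (k \<bullet> z))"
    by (rule Bochner_Integration.integrable_bound[OF gi]) (auto simp: abs_mult mult_left_le)
  have Y2: "(\<integral>\<^sup>+\<omega>. (Y \<omega>)\<^sup>2 \<partial>M) = ennreal (c * ?A)"
  proof -
    have "(\<integral>\<^sup>+\<omega>. (Y \<omega>)\<^sup>2 \<partial>M) = (\<integral>\<^sup>+\<omega>. \<integral>\<^sup>+x. \<integral>\<^sup>+y. ennreal (g x * g y * 1) \<partial>\<Phi> \<omega> \<partial>\<Phi> \<omega> \<partial>M)"
    proof (rule nn_integral_cong)
      fix \<omega> assume w: "\<omega> \<in> space M"
      note [measurable_cong] = \<Phi>_sets[OF w]
      show "(Y \<omega>)\<^sup>2 = (\<integral>\<^sup>+x. \<integral>\<^sup>+y. ennreal (g x * g y * 1) \<partial>\<Phi> \<omega> \<partial>\<Phi> \<omega>)"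
        using g0 by (simp add: Y_def ennreal_mult less_imp_le nn_integral_cmult nn_integral_multc power2_eq_square)
    qed
    also have "\<dots> = ennreal (c * ?A)"
      unfolding g_def c_def using gaussian_second_moment[OF s, of "\<lambda>_. 1"] by simp
    finally show ?thesis .
  qed
  have HY: "H \<omega> \<le> 2 * Y \<omega>" if w: "\<omega> \<in> space M" for \<omega>
  proof -
    note [measurable_cong] = \<Phi>_sets[OF w]
    have "H \<omega> \<le> (\<integral>\<^sup>+x. 2 * ennreal (g x) \<partial>\<Phi> \<omega>)"
      unfolding H_def
    proof (rule nn_integral_mono)
      fix x
      have "g x * (1 + cos (k \<bullet> x)) \<le> g x * 2" using g0[of x] by (intro mult_left_mono) auto
      then have "ennreal (g x * (1 + cos (k \<bullet> x))) \<le> ennreal (2 * g x)" by (intro ennreal_leI) simp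
      then show "ennreal (g x * (1 + cos (k \<bullet> x))) \<le> 2 * ennreal (g x)"
        using g0[of x] by (simp add: ennreal_mult ennreal_numeral)
    qed
    also have "\<dots> = 2 * Y \<omega>" unfolding Y_def by (rule nn_integral_cmult) measurable
    finally show ?thesis .
  qed
  have Yfin: "(\<integral>\<^sup>+\<omega>. (Y \<omega>)\<^sup>2 \<partial>M) < \<infinity>" by (simp add: Y2)
  have Hfin: "(\<integral>\<^sup>+\<omega>. (H \<omega>)\<^sup>2 \<partial>M) < \<infinity>"
  proof -
    have "(\<integral>\<^sup>+\<omega>. (H \<omega>)\<^sup>2 \<partial>M) \<le> (\<integral>\<^sup>+\<omega>. 4 * (Y \<omega>)\<^sup>2 \<partial>M)"
    proof (rule nn_integral_mono)
      fix \<omega> assume "\<omega> \<in> space M"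
      from power_mono[OF HY[OF this], of 2] show "(H \<omega>)\<^sup>2 \<le> 4 * (Y \<omega>)\<^sup>2"
        by (simp add: power_mult_distrib)
    qed
    also have "\<dots> = 4 * ennreal (c * ?A)" by (simp add: nn_integral_cmult Y2)
    also have "\<dots> < \<infinity>" by (simp add: ennreal_mult_less_top)
    finally show ?thesis .
  qed
  note Yr = square_integrable_enn2real[OF Y Yfin] and Hr = square_integrable_enn2real[OF H Hfin]
  \<comment> \<open>Almost surely the cosine integral of g against \<open>\<Phi>\<close>; this form
    makes its measurability and integrability evident.\<close>
  define \<xi> where "\<xi> \<omega> = enn2real (H \<omega>) - enn2real (Y \<omega>)" for \<omega>
  have [measurable]: "\<xi> \<in> borel_measurable M" unfolding \<xi>_def[abs_def] by measurable
  have \<xi>i: "integrable M \<xi>" unfolding \<xi>_def[abs_def] using Hr(2) Yr(2) by simp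
  have pointwise: "ennreal ((enn2real (Y \<omega>))\<^sup>2 + (\<xi> \<omega>)\<^sup>2)
      \<le> (\<integral>\<^sup>+x. \<integral>\<^sup>+y. ennreal (g x * g y * (1 + cos (k \<bullet> (y - x)))) \<partial>\<Phi> \<omega> \<partial>\<Phi> \<omega>)"
    if w: "\<omega> \<in> space M" and fin: "Y \<omega> = ennreal (enn2real (Y \<omega>))" for \<omega>
  proof -
    note [measurable_cong] = \<Phi>_sets[OF w]
    have ig: "integrable (\<Phi> \<omega>) g"
    proof (rule integrableI_nonneg)
      show "(\<integral>\<^sup>+x. ennreal (g x) \<partial>\<Phi> \<omega>) < \<infinity>"
        using fin unfolding Y_def[symmetric] by (metis ennreal_less_top infinity_ennreal_def)
    qed (use g0 in \<open>auto simp: less_imp_le\<close>)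
    have ic: "integrable (\<Phi> \<omega>) (\<lambda>x. g x * cos (k \<bullet> x))" and isn: "integrable (\<Phi> \<omega>) (\<lambda>x. g x * sin (k \<bullet> x))"
      by (rule Bochner_Integration.integrable_bound[OF ig]; auto simp: abs_mult mult_left_le)+
    define G where "G = integral\<^sup>L (\<Phi> \<omega>) g"
    define X where "X = (\<integral>x. g x * cos (k \<bullet> x) \<partial>\<Phi> \<omega>)"
    define S where "S = (\<integral>x. g x * sin (k \<bullet> x) \<partial>\<Phi> \<omega>)"
    have G: "enn2real (Y \<omega>) = G"
      unfolding Y_def G_def using g0 by (subst integral_eq_nn_integral) (auto simp: less_imp_le)
    have "enn2real (H \<omega>) = (\<integral>x. g x * (1 + cos (k \<bullet> x)) \<partial>\<Phi> \<omega>)"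
      unfolding H_def using g0 c1 by (subst integral_eq_nn_integral) (auto simp: less_imp_le)
    also have "\<dots> = G + X"
      unfolding G_def X_def distrib_left mult_1_right by (rule Bochner_Integration.integral_add[OF ig ic])
    finally have X: "\<xi> \<omega> = X" by (simp add: \<xi>_def G)
    have e: "g x * g y * (1 + cos (k \<bullet> (y - x)))
      = g x * g y + (g x * cos (k \<bullet> x) * (g y * cos (k \<bullet> y)) + g x * sin (k \<bullet> x) * (g y * sin (k \<bullet> y)))" for x y
      by (simp add: inner_diff_right cos_diff algebra_simps)
    have ii: "integrable (\<Phi> \<omega>) (\<lambda>y. g x * g y * (1 + cos (k \<bullet> (y - x))))" for x
      unfolding e by (intro Bochner_Integration.integrable_add integrable_mult_right ig ic isn)
    have ie: "(\<integral>y. g x * g y * (1 + cos (k \<bullet> (y - x))) \<partial>\<Phi> \<omega>)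
      = g x * G + g x * cos (k \<bullet> x) * X + g x * sin (k \<bullet> x) * S" for x
      unfolding e G_def X_def S_def add.assoc
      by (subst Bochner_Integration.integral_add, intro integrable_mult_right ig,
        intro Bochner_Integration.integrable_add integrable_mult_right ic isn,
        subst Bochner_Integration.integral_add, intro integrable_mult_right ic,
        intro integrable_mult_right isn, simp only: integral_mult_right_zero)
    have inner: "(\<integral>\<^sup>+y. ennreal (g x * g y * (1 + cos (k \<bullet> (y - x)))) \<partial>\<Phi> \<omega>)
       = ennreal (g x * G + g x * cos (k \<bullet> x) * X + g x * sin (k \<bullet> x) * S)" for x
      unfolding ie[symmetric] using g0 c1 by (intro nn_integral_eq_integral[OF ii]) (auto simp: less_imp_le)
    have nonneg: "0 \<le> g x * G + g x * cos (k \<bullet> x) * X + g x * sin (k \<bullet> x) * S" for x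
      unfolding ie[symmetric] using g0 c1 by (intro Bochner_Integration.integral_nonneg) (auto simp: less_imp_le)
    have "(\<integral>\<^sup>+x. \<integral>\<^sup>+y. ennreal (g x * g y * (1 + cos (k \<bullet> (y - x)))) \<partial>\<Phi> \<omega> \<partial>\<Phi> \<omega>)
      = ennreal (\<integral>x. g x * G + g x * cos (k \<bullet> x) * X + g x * sin (k \<bullet> x) * S \<partial>\<Phi> \<omega>)"
      unfolding inner using nonneg
      by (intro nn_integral_eq_integral Bochner_Integration.integrable_add integrable_mult_left ig ic isn) auto
    also have "(\<integral>x. g x * G + g x * cos (k \<bullet> x) * X + g x * sin (k \<bullet> x) * S \<partial>\<Phi> \<omega>) = G * G + X * X + S * S"
      by (subst Bochner_Integration.integral_add, intro Bochner_Integration.integrable_add integrable_mult_left ig ic,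
          intro integrable_mult_left isn,
          subst Bochner_Integration.integral_add, intro integrable_mult_left ig, intro integrable_mult_left ic)
        (simp only: integral_mult_left_zero G_def[symmetric] X_def[symmetric] S_def[symmetric])
    \<comment> \<open>The squared sine integral S * S is dropped, which turns the identity into the
      stated inequality.\<close>
    finally show ?thesis unfolding G X by (simp add: power2_eq_square ennreal_leI)
  qed
  have "(\<integral>\<^sup>+\<omega>. ennreal ((enn2real (Y \<omega>))\<^sup>2 + (\<xi> \<omega>)\<^sup>2) \<partial>M)
    \<le> (\<integral>\<^sup>+\<omega>. \<integral>\<^sup>+x. \<integral>\<^sup>+y. ennreal (g x * g y * (1 + cos (k \<bullet> (y - x)))) \<partial>\<Phi> \<omega> \<partial>\<Phi> \<omega> \<partial>M)"
    by (rule nn_integral_mono_AE, rule AE_mp[OF AE_finite_of_square[OF Y Yfin]], intro AE_I2 impI pointwise)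
  also have "\<dots> = ennreal (c * (\<integral>z. exp (- s * (norm z)\<^sup>2) * (1 + cos (k \<bullet> z)) \<partial>\<alpha>))"
    unfolding g_def c_def by (rule gaussian_second_moment[OF s]) (use c1 in auto)
  also have "(\<integral>z. exp (- s * (norm z)\<^sup>2) * (1 + cos (k \<bullet> z)) \<partial>\<alpha>) = ?A + ?C"
    unfolding distrib_left mult_1_right by (rule Bochner_Integration.integral_add[OF gi gci])
  finally have b: "(\<integral>\<^sup>+\<omega>. ennreal ((enn2real (Y \<omega>))\<^sup>2 + (\<xi> \<omega>)\<^sup>2) \<partial>M) \<le> ennreal (c * (?A + ?C))" .
  have AC: "0 \<le> ?A + ?C"
  proof -
    have "0 \<le> (\<integral>z. exp (- s * (norm z)\<^sup>2) * (1 + cos (k \<bullet> z)) \<partial>\<alpha>)"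
      using c1 by (intro Bochner_Integration.integral_nonneg) auto
    also have "\<dots> = ?A + ?C"
      unfolding distrib_left mult_1_right by (rule Bochner_Integration.integral_add[OF gi gci])
    finally show ?thesis .
  qed
  have i: "integrable M (\<lambda>\<omega>. (enn2real (Y \<omega>))\<^sup>2 + (\<xi> \<omega>)\<^sup>2)"
    using b by (intro integrableI_nonneg) (auto intro: le_less_trans)
  have \<xi>2: "integrable M (\<lambda>\<omega>. (\<xi> \<omega>)\<^sup>2)"
    using Bochner_Integration.integrable_diff[OF i Yr(1)] by simp
  have "(\<integral>\<omega>. (enn2real (Y \<omega>))\<^sup>2 + (\<xi> \<omega>)\<^sup>2 \<partial>M) \<le> c * (?A + ?C)"
  proof -
    have "ennreal (\<integral>\<omega>. (enn2real (Y \<omega>))\<^sup>2 + (\<xi> \<omega>)\<^sup>2 \<partial>M) \<le> ennreal (c * (?A + ?C))"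
      using b by (subst nn_integral_eq_integral[OF i, symmetric]) auto
    then show ?thesis using c AC by (subst (asm) ennreal_le_iff) auto
  qed
  also have "(\<integral>\<omega>. (enn2real (Y \<omega>))\<^sup>2 + (\<xi> \<omega>)\<^sup>2 \<partial>M) = c * ?A + (\<integral>\<omega>. (\<xi> \<omega>)\<^sup>2 \<partial>M)"
    using c by (subst Bochner_Integration.integral_add[OF Yr(1) \<xi>2]) (simp add: Yr(3) Y2 Bochner_Integration.integral_nonneg)
  finally have E2: "(\<integral>\<omega>. (\<xi> \<omega>)\<^sup>2 \<partial>M) \<le> c * ?C" by (simp add: distrib_left)
  have s2: "2 * s > 0" using s by simp
  have gl: "integrable lborel g" "integrable lborel (\<lambda>x. g x * cos (k \<bullet> x))"
    unfolding g_def[abs_def] by (rule integrable_gaussian[OF s2], rule integrable_gaussian_cos[OF s2])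
  have "(\<integral>\<omega>. \<xi> \<omega> \<partial>M) = \<gamma> * (\<integral>x. g x * cos (k \<bullet> x) \<partial>lborel)"
  proof -
    have "(\<integral>\<omega>. enn2real (Y \<omega>) \<partial>M) = \<gamma> * (\<integral>x. g x \<partial>lborel)"
      unfolding Yr(4) unfolding Y_def using g0 \<gamma>
      by (subst nn_integral_\<Phi>, measurable, subst nn_integral_eq_integral[OF gl(1)])
        (auto simp: less_imp_le enn2real_mult)
    moreover have "(\<integral>\<omega>. enn2real (H \<omega>) \<partial>M) = \<gamma> * (\<integral>x. g x * (1 + cos (k \<bullet> x)) \<partial>lborel)"
    proof -
      have "integrable lborel (\<lambda>x. g x * (1 + cos (k \<bullet> x)))"
        unfolding distrib_left mult_1_right by (rule Bochner_Integration.integrable_add[OF gl])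
      then show ?thesis
        unfolding Hr(4) unfolding H_def using g0 \<gamma> c1
        by (subst nn_integral_\<Phi>, measurable, subst nn_integral_eq_integral)
          (auto simp: less_imp_le enn2real_mult)
    qed
    moreover have "(\<integral>x. g x * (1 + cos (k \<bullet> x)) \<partial>lborel) = (\<integral>x. g x \<partial>lborel) + (\<integral>x. g x * cos (k \<bullet> x) \<partial>lborel)"
      unfolding distrib_left mult_1_right by (rule Bochner_Integration.integral_add[OF gl])
    ultimately show ?thesis
      unfolding \<xi>_def by (subst Bochner_Integration.integral_diff[OF Hr(2) Yr(2)]) (simp add: distrib_left)
  qed
  moreover have "(\<integral>\<omega>. \<xi> \<omega> \<partial>M)\<^sup>2 \<le> (\<integral>\<omega>. (\<xi> \<omega>)\<^sup>2 \<partial>M)"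
    using variance_positive[of \<xi>] variance_eq[OF \<xi>i \<xi>2] by simp
  ultimately have "\<gamma>\<^sup>2 * (\<integral>x. g x * cos (k \<bullet> x) \<partial>lborel)\<^sup>2 \<le> c * ?C"
    using E2 by (simp add: power_mult_distrib)
  \<comment> \<open>g is even, so its Fourier transform is this cosine integral, and the square is
    the transform of the autocorrelation of g, namely c times the Gaussian with parameter s.\<close>
  also have "(\<integral>x. g x * cos (k \<bullet> x) \<partial>lborel)\<^sup>2 = c * (\<integral>z. exp (- s * (norm z)\<^sup>2) * cos (k \<bullet> z) \<partial>lborel)"
  proof -
    have "(\<integral>x. g x * cos (k \<bullet> x) \<partial>lborel)\<^sup>2 = (sqrt (pi / (2 * s)) * sqrt (pi / (2 * s))) ^ DIM('a)
       * exp (- (norm k)\<^sup>2 / (4 * (2 * s)) + - (norm k)\<^sup>2 / (4 * (2 * s)))"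
      unfolding g_def integral_gaussian_cos[OF s2] by (simp only: power2_eq_square power_mult_distrib exp_add ac_simps)
    also have "sqrt (pi / (2 * s)) * sqrt (pi / (2 * s)) = sqrt (pi / (4 * s)) * sqrt (pi / s)"
      using s by (simp add: real_sqrt_divide real_sqrt_mult)
    also have "- (norm k)\<^sup>2 / (4 * (2 * s)) + - (norm k)\<^sup>2 / (4 * (2 * s)) = - (norm k)\<^sup>2 / (4 * s)"
      using s by (simp add: field_simps)
    finally show ?thesis unfolding integral_gaussian_cos[OF s] c_def by (simp add: power_mult_distrib)
  qed
  finally have "c * (\<gamma>\<^sup>2 * (\<integral>z. exp (- s * (norm z)\<^sup>2) * cos (k \<bullet> z) \<partial>lborel)) \<le> c * ?C"
    by (simp only: mult.left_commute)
  then show ?thesis using c by (subst (asm) mult_le_cancel_left_pos) auto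
qed

sublocale \<alpha>: second_order_measure \<alpha> "\<gamma>\<^sup>2"
  by (unfold_locales, simp, rule positive_definite)

lemma variance_\<Phi>:
  assumes B: "B \<in> sets borel" "bounded B"
  shows "variance (\<lambda>\<omega>. measure (\<Phi> \<omega>) B) = \<alpha>.cov (return borel 0) B"
proof -
  have m: "(\<lambda>\<omega>. emeasure (\<Phi> \<omega>) B) \<in> borel_measurable M" by (rule random_measure_emeasure[OF rm B(1)])
  have "(\<integral>\<^sup>+\<omega>. emeasure (\<Phi> \<omega>) B \<partial>M) = (\<integral>\<^sup>+\<omega>. \<integral>\<^sup>+x. indicator B x \<partial>\<Phi> \<omega> \<partial>M)"
    using B by (intro nn_integral_cong) (simp add: \<Phi>_sets)
  also have "\<dots> = ennreal \<gamma> * emeasure lborel B" using B by (subst nn_integral_\<Phi>) (auto simp: \<gamma>)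
  finally have "enn2real (\<integral>\<^sup>+\<omega>. emeasure (\<Phi> \<omega>) B \<partial>M) = \<gamma> * measure lborel B"
    by (simp add: enn2real_mult measure_def \<gamma>)
  moreover have "enn2real (\<integral>\<^sup>+\<omega>. (emeasure (\<Phi> \<omega>) B)\<^sup>2 \<partial>M) = (\<integral>z. overlap B z \<partial>\<alpha>)"
    unfolding nn_integral_overlap_\<alpha>_0[OF B, symmetric]
    using overlap_measurable[OF B(1)] by (subst integral_eq_nn_integral) (auto simp: overlap_nonneg[OF B])
  ultimately show ?thesis
    using variance_enn2real[OF m square_finite[OF B]] B(1)
    by (simp add: measure_def[of "\<Phi> _"] \<alpha>.cov_return_0 power_mult_distrib)
qed

end

section \<open>Transport by an invariant kernel\<close>

locale kernel_setting = palm_setting M \<theta> \<Phi> P2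
  for M :: "'w measure" and \<theta> :: "'a::euclidean_space \<Rightarrow> 'w \<Rightarrow> 'w" and \<Phi> :: "'w \<Rightarrow> 'a measure"
    and P2 :: "'a \<Rightarrow> 'w measure" +
  fixes K :: "'w \<Rightarrow> 'a \<Rightarrow> 'a measure"
  assumes intensity_pos: "0 < intensity M \<Phi>" and kernel: "invariant_prob_kernel M \<theta> K"
begin

abbreviation K\<Phi> :: "'w \<Rightarrow> 'a measure" where "K\<Phi> \<equiv> kernel_transform K \<Phi>"

lemma K_measurable: "(\<lambda>(\<omega>, x). K \<omega> x) \<in> M \<Otimes>\<^sub>M borel \<rightarrow>\<^sub>M prob_algebra borel"
  using kernel unfolding invariant_prob_kernel_def by blast

lemma K_prob: "\<omega> \<in> space M \<Longrightarrow> prob_space (K \<omega> x)"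
  and K_sets: "\<omega> \<in> space M \<Longrightarrow> sets (K \<omega> x) = sets borel"
  using measurable_space[OF K_measurable, of "(\<omega>, x)"] by (simp_all add: space_pair_measure space_prob_algebra)

lemma K_emeasure:
  "\<omega> \<in> space M \<Longrightarrow> B \<in> sets borel \<Longrightarrow> emeasure (K \<omega> x) ((\<lambda>b. b + x) ` B) = emeasure (K (\<theta> x \<omega>) 0) B"
  using kernel unfolding invariant_prob_kernel_def by blast

text \<open>By invariance the kernel is determined by its value at the origin moved along the flow
  (\<open>Kstar_eq\<close>), so a single random displacement law suffices.\<close>

definition L :: "'w \<Rightarrow> 'a measure" where "L \<omega> = K \<omega> 0"

lemma L_measurable: "L \<in> M \<rightarrow>\<^sub>M prob_algebra borel"
  unfolding L_def[abs_def] using measurable_compose[OF _ K_measurable, of "\<lambda>\<omega>. (\<omega>, 0)" M] by simp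

lemma L_subprob[measurable]: "L \<in> M \<rightarrow>\<^sub>M subprob_algebra borel"
  by (rule measurable_prob_algebraD[OF L_measurable])

lemma L_prob: "\<omega> \<in> space M \<Longrightarrow> prob_space (L \<omega>)" and L_sets: "\<omega> \<in> space M \<Longrightarrow> sets (L \<omega>) = sets borel"
  by (simp_all add: L_def K_prob K_sets)

lemma Kstar_eq:
  assumes w: "\<omega> \<in> space M"
  shows "Kstar K \<omega> x = L (\<theta> x \<omega>)"
proof (rule measure_eqI)
  fix A assume "A \<in> sets (Kstar K \<omega> x)"
  then have A: "A \<in> sets borel" by (simp add: Kstar_def)
  note [measurable_cong] = K_sets[OF w]
  have im: "(\<lambda>b. b + x) ` A = (\<lambda>z. z - x) -` A \<inter> space (K \<omega> x)"
    using sets_eq_imp_space_eq[OF K_sets[OF w]] by (auto simp: image_iff intro!: bexI[of _ "_ - x"])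
  show "emeasure (Kstar K \<omega> x) A = emeasure (L (\<theta> x \<omega>)) A"
    unfolding Kstar_def L_def K_emeasure[OF w A, symmetric] im using A by (intro emeasure_distr) auto
qed (use w in \<open>simp add: Kstar_def L_sets\<close>)

lemma K_emeasure_L:
  assumes w: "\<omega> \<in> space M" and B: "B \<in> sets borel"
  shows "emeasure (K \<omega> x) B = (\<integral>\<^sup>+u. indicator B (x + u) \<partial>L (\<theta> x \<omega>))"
proof -
  have w': "\<theta> x \<omega> \<in> space M" using w by simp
  note [measurable_cong] = L_sets[OF w']
  have B': "(\<lambda>u. x + u) -` B \<in> sets borel"
    using measurable_sets[of "\<lambda>u. x + u" borel borel B] B by simp
  have "B = (\<lambda>b. b + x) ` ((\<lambda>u. x + u) -` B)"
    by (auto simp: image_iff add.commute intro!: bexI[of _ "_ - x"])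
  then have "emeasure (K \<omega> x) B = emeasure (K (\<theta> x \<omega>) 0) ((\<lambda>u. x + u) -` B)"
    using K_emeasure[OF w B', of x] by simp
  also have "\<dots> = (\<integral>\<^sup>+u. indicator ((\<lambda>u. x + u) -` B) u \<partial>L (\<theta> x \<omega>))"
    unfolding L_def using B' K_sets[OF w'] by simp
  finally show ?thesis by (simp add: indicator_def)
qed

text \<open>The mass sent into B by a unit mass at x that is displaced according to
  \<open>L \<omega>\<close>. Evaluated at \<open>\<theta> x \<omega>\<close> it is the mass that the
  kernel at x gives to B; separating position and environment matches the form of the Campbell
  formulas.\<close>

definition hit :: "'a set \<Rightarrow> 'a \<Rightarrow> 'w \<Rightarrow> ennreal" where
  "hit B x \<omega> = (\<integral>\<^sup>+u. indicator B (x + u) \<partial>L \<omega>)"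

lemma hit_measurable:
  assumes [measurable]: "B \<in> sets borel"
  shows "(\<lambda>(x, \<omega>). hit B x \<omega>) \<in> borel_measurable (borel \<Otimes>\<^sub>M M)"
proof -
  have "(\<lambda>(p, u). indicator B (fst p + u) :: ennreal) \<in> borel_measurable ((borel \<Otimes>\<^sub>M M) \<Otimes>\<^sub>M borel)"
    by measurable
  from nn_integral_measurable_subprob_algebra2[OF this measurable_compose[OF measurable_snd L_subprob]]
  show ?thesis by (simp add: hit_def case_prod_beta')
qed

lemma hit_measurable':
  assumes B: "B \<in> sets borel" and m: "f \<in> N \<rightarrow>\<^sub>M borel" "g \<in> N \<rightarrow>\<^sub>M M"
  shows "(\<lambda>x. hit B (f x) (g x)) \<in> borel_measurable N"
  using measurable_compose[OF measurable_Pair[OF m] hit_measurable[OF B]] by simp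

lemma K\<Phi>_sets: "\<omega> \<in> space M \<Longrightarrow> sets (K\<Phi> \<omega>) = sets borel"
  and emeasure_K\<Phi>: "\<omega> \<in> space M \<Longrightarrow> B \<in> sets borel \<Longrightarrow> emeasure (K\<Phi> \<omega>) B = (\<integral>\<^sup>+x. hit B x (\<theta> x \<omega>) \<partial>\<Phi> \<omega>)"
proof -
  assume w: "\<omega> \<in> space M"
  have sp: "space (\<Phi> \<omega>) \<noteq> {}" using sets_eq_imp_space_eq[OF \<Phi>_sets[OF w]] by simp
  have "K \<omega> \<in> borel \<rightarrow>\<^sub>M subprob_algebra borel"
    using measurable_prob_algebraD[OF measurable_compose[OF measurable_Pair1'[OF w] K_measurable]] by simp
  then have m: "K \<omega> \<in> \<Phi> \<omega> \<rightarrow>\<^sub>M subprob_algebra borel"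
    by (simp cong: measurable_cong_sets add: \<Phi>_sets[OF w])
  show "sets (K\<Phi> \<omega>) = sets borel"
    unfolding kernel_transform_def by (rule sets_bind[OF _ sp]) (rule K_sets[OF w])
  assume B: "B \<in> sets borel"
  show "emeasure (K\<Phi> \<omega>) B = (\<integral>\<^sup>+x. hit B x (\<theta> x \<omega>) \<partial>\<Phi> \<omega>)"
    unfolding kernel_transform_def emeasure_bind[OF sp m B] hit_def K_emeasure_L[OF w B] ..
qed

lemma emeasure_K\<Phi>_measurable:
  assumes B: "B \<in> sets borel"
  shows "(\<lambda>\<omega>. emeasure (K\<Phi> \<omega>) B) \<in> borel_measurable M"
proof -
  have "(\<lambda>\<omega>. \<integral>\<^sup>+x. hit B x (\<theta> x \<omega>) \<partial>\<Phi> \<omega>) \<in> borel_measurable M"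
  proof (rule nn_integral_random_measure_measurable[OF rm])
    have "(\<lambda>p. hit B (snd p) (\<theta> (snd p) (fst p))) \<in> borel_measurable (M \<Otimes>\<^sub>M borel)"
      by (rule hit_measurable'[OF B]) measurable
    then show "(\<lambda>(\<omega>, x). hit B x (\<theta> x \<omega>)) \<in> borel_measurable (M \<Otimes>\<^sub>M borel)" by (simp add: case_prod_beta')
  qed
  then show ?thesis by (subst measurable_cong[OF emeasure_K\<Phi>[OF _ B]])
qed

lemma K\<Phi>_measurable: "K\<Phi> \<in> M \<rightarrow>\<^sub>M measure_algebra borel"
  by (rule measurable_measure_algebra) (erule K\<Phi>_sets, erule emeasure_K\<Phi>_measurable)

text \<open>Invariance passes to the transported measure: hitting A from x - s is hitting A + s from
  x, in the same environment. Stationarity follows since the flow preserves the probability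
  measure.\<close>

lemma K\<Phi>_flow:
  assumes w: "\<omega> \<in> space M"
  shows "K\<Phi> (\<theta> s \<omega>) = distr (K\<Phi> \<omega>) borel (\<lambda>z. z - s)"
proof (rule measure_eqI)
  have w': "\<theta> s \<omega> \<in> space M" using w by simp
  note [measurable_cong] = K\<Phi>_sets[OF w]
  fix A assume "A \<in> sets (K\<Phi> (\<theta> s \<omega>))"
  then have A: "A \<in> sets borel" by (simp add: K\<Phi>_sets[OF w'])
  have A': "(\<lambda>z. z - s) -` A \<in> sets borel"
    using measurable_sets[of "\<lambda>z. z - s" borel borel A] A by simp
  have m: "(\<lambda>y. hit A y (\<theta> y (\<theta> s \<omega>))) \<in> borel_measurable borel"
    by (rule hit_measurable'[OF A]) (use w' in measurable)
  have "emeasure (K\<Phi> (\<theta> s \<omega>)) A = (\<integral>\<^sup>+y. hit A y (\<theta> y (\<theta> s \<omega>)) \<partial>\<Phi> (\<theta> s \<omega>))"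
    by (rule emeasure_K\<Phi>[OF w' A])
  also have "\<dots> = (\<integral>\<^sup>+x. hit A (x - s) (\<theta> (x - s) (\<theta> s \<omega>)) \<partial>\<Phi> \<omega>)"
    by (rule nn_integral_\<Phi>_flow[OF w m])
  also have "\<dots> = (\<integral>\<^sup>+x. hit ((\<lambda>z. z - s) -` A) x (\<theta> x \<omega>) \<partial>\<Phi> \<omega>)"
    using w by (intro nn_integral_cong) (simp add: flow_add hit_def indicator_def algebra_simps)
  also have "\<dots> = emeasure (K\<Phi> \<omega>) ((\<lambda>z. z - s) -` A)"
    by (rule emeasure_K\<Phi>[OF w A', symmetric])
  also have "\<dots> = emeasure (distr (K\<Phi> \<omega>) borel (\<lambda>z. z - s)) A"
    using A sets_eq_imp_space_eq[OF K\<Phi>_sets[OF w]] by (subst emeasure_distr) auto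
  finally show "emeasure (K\<Phi> (\<theta> s \<omega>)) A = emeasure (distr (K\<Phi> \<omega>) borel (\<lambda>z. z - s)) A" .
qed (use w in \<open>simp add: K\<Phi>_sets\<close>)

lemma K\<Phi>_stationary: "stationary M K\<Phi>"
  unfolding stationary_def
proof
  fix x
  have "distr M (measure_algebra borel) (\<lambda>\<omega>. distr (K\<Phi> \<omega>) borel (\<lambda>z. z - x)) = distr M (measure_algebra borel) (\<lambda>\<omega>. K\<Phi> (\<theta> x \<omega>))"
    by (rule distr_cong) (simp_all add: K\<Phi>_flow)
  also have "\<dots> = distr (distr M M (\<theta> x)) (measure_algebra borel) K\<Phi>"
    by (subst distr_distr[OF K\<Phi>_measurable]) (measurable, simp add: comp_def)
  finally show "distr M (measure_algebra borel) (\<lambda>\<omega>. distr (K\<Phi> \<omega>) borel (\<lambda>z. z - x)) = distr M (measure_algebra borel) K\<Phi>"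
    by (simp only: distr_flow)
qed

text \<open>Mass transport: after \<open>campbell\<close> the position is integrated over Lebesgue
  measure, which gives the volume of B for any probability law of the displacement. The intensity is
  therefore preserved.\<close>

lemma mean_K\<Phi>:
  assumes B[measurable]: "B \<in> sets borel"
  shows "(\<integral>\<^sup>+\<omega>. emeasure (K\<Phi> \<omega>) B \<partial>M) = ennreal \<gamma> * emeasure lborel B"
proof -
  have "(\<integral>\<^sup>+\<omega>. emeasure (K\<Phi> \<omega>) B \<partial>M) = (\<integral>\<^sup>+\<omega>. \<integral>\<^sup>+x. hit B x (\<theta> x \<omega>) \<partial>\<Phi> \<omega> \<partial>M)"
    by (intro nn_integral_cong emeasure_K\<Phi> B)
  also have "\<dots> = (\<integral>\<^sup>+\<omega>. \<integral>\<^sup>+x. indicator (cbox 0 One) x * (\<integral>\<^sup>+s. hit B s (\<theta> x \<omega>) \<partial>lborel) \<partial>\<Phi> \<omega> \<partial>M)"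
    by (rule campbell[OF hit_measurable[OF B]])
  also have "\<dots> = (\<integral>\<^sup>+\<omega>. \<integral>\<^sup>+x. indicator (cbox 0 One) x * emeasure lborel B \<partial>\<Phi> \<omega> \<partial>M)"
  proof (rule nn_integral_cong, rule nn_integral_cong)
    fix \<omega> x assume "\<omega> \<in> space M"
    then have w: "\<theta> x \<omega> \<in> space M" by simp
    interpret L: prob_space "L (\<theta> x \<omega>)" by (rule L_prob[OF w])
    note [measurable_cong] = L_sets[OF w]
    interpret P: pair_sigma_finite "lborel :: 'a measure" "L (\<theta> x \<omega>)" ..
    have "(\<integral>\<^sup>+s. hit B s (\<theta> x \<omega>) \<partial>lborel) = (\<integral>\<^sup>+u. \<integral>\<^sup>+s. indicator B (s + u) \<partial>lborel \<partial>L (\<theta> x \<omega>))"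
      unfolding hit_def by (rule P.Fubini'[symmetric]) measurable
    also have "\<dots> = (\<integral>\<^sup>+u. emeasure lborel B \<partial>L (\<theta> x \<omega>))"
    proof (rule nn_integral_cong)
      fix u
      have "(\<integral>\<^sup>+s. indicator B (u + s) \<partial>lborel) = (\<integral>\<^sup>+s. indicator B s \<partial>(lborel :: 'a measure))"
        by (rule nn_integral_lborel_translate) measurable
      then show "(\<integral>\<^sup>+s. indicator B (s + u) \<partial>lborel) = emeasure lborel B" by (simp add: add.commute)
    qed
    finally show "indicator (cbox 0 One) x * (\<integral>\<^sup>+s. hit B s (\<theta> x \<omega>) \<partial>lborel) = indicator (cbox 0 One) x * emeasure lborel B"
      by (simp add: L.emeasure_space_1)
  qed
  also have "\<dots> = intensity M \<Phi> * (\<integral>\<^sup>+x. indicator (cbox 0 (One::'a)) x * emeasure lborel B \<partial>lborel)"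
    by (rule nn_integral_\<Phi>) measurable
  also have "(\<integral>\<^sup>+x. indicator (cbox 0 (One::'a)) x * emeasure lborel B \<partial>lborel) = emeasure lborel B"
    by (subst nn_integral_multc) (auto simp: emeasure_lborel_cbox)
  finally show ?thesis by (simp add: \<gamma>)
qed

section \<open>The second moment of the transported measure\<close>

text \<open>\<open>pair_palm z\<close> is the setwise expectation of \<open>K\<^sup>*\<^sub>z \<otimes> K\<^sup>*\<^sub>0\<close> under the two-point Palm measure.\<close>

definition pair_palm :: "'a \<Rightarrow> ('a \<times> 'a) measure" where
  "pair_palm z = P2 z \<bind> (\<lambda>\<omega>. Kstar K \<omega> z \<Otimes>\<^sub>M Kstar K \<omega> 0)"

lemma pair_palm_eq: "pair_palm z = P2 z \<bind> (\<lambda>\<omega>. L (\<theta> z \<omega>) \<Otimes>\<^sub>M L \<omega>)"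
  unfolding pair_palm_def
proof (rule bind_cong[OF refl])
  fix \<omega> assume "\<omega> \<in> space (P2 z)"
  then have "\<omega> \<in> space M" using sets_eq_imp_space_eq[OF P2_sets[of z]] by simp
  then show "Kstar K \<omega> z \<Otimes>\<^sub>M Kstar K \<omega> 0 = L (\<theta> z \<omega>) \<Otimes>\<^sub>M L \<omega>"
    by (simp add: Kstar_eq flow_0)
qed

lemma L_pair_measurable: "(\<lambda>\<omega>. L (\<theta> z \<omega>) \<Otimes>\<^sub>M L \<omega>) \<in> M \<rightarrow>\<^sub>M prob_algebra (borel \<Otimes>\<^sub>M borel)"
proof (rule measurable_prob_algebraI)
  show "(\<lambda>\<omega>. L (\<theta> z \<omega>) \<Otimes>\<^sub>M L \<omega>) \<in> M \<rightarrow>\<^sub>M subprob_algebra (borel \<Otimes>\<^sub>M borel)"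
    by (rule measurable_pair_measure) measurable
  fix \<omega> assume w: "\<omega> \<in> space M"
  interpret A: prob_space "L (\<theta> z \<omega>)" using w by (intro L_prob) simp
  interpret B: prob_space "L \<omega>" using w by (rule L_prob)
  interpret AB: pair_prob_space "L (\<theta> z \<omega>)" "L \<omega>" ..
  show "prob_space (L (\<theta> z \<omega>) \<Otimes>\<^sub>M L \<omega>)" by (rule AB.P.prob_space_axioms)
qed

lemma pair_palm_prob: "prob_space (pair_palm z)" and pair_palm_sets: "sets (pair_palm z) = sets (borel \<Otimes>\<^sub>M borel)"
  unfolding pair_palm_eq
  by (rule prob_space_bind'[OF P2 L_pair_measurable], rule sets_bind'[OF P2 L_pair_measurable])

lemma nn_integral_pair_palm:
  assumes f: "f \<in> borel_measurable (borel \<Otimes>\<^sub>M borel)"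
  shows "(\<integral>\<^sup>+p. f p \<partial>pair_palm z) = (\<integral>\<^sup>+\<omega>. \<integral>\<^sup>+p. f p \<partial>(L (\<theta> z \<omega>) \<Otimes>\<^sub>M L \<omega>) \<partial>P2 z)"
proof -
  have "(\<lambda>\<omega>. L (\<theta> z \<omega>) \<Otimes>\<^sub>M L \<omega>) \<in> P2 z \<rightarrow>\<^sub>M subprob_algebra (borel \<Otimes>\<^sub>M borel)"
    using measurable_prob_algebraD[OF L_pair_measurable] by (simp cong: measurable_cong_sets add: P2_sets)
  from nn_integral_bind[OF f this] show ?thesis by (simp add: pair_palm_eq)
qed

text \<open>Two kernel integrals are composed: one over the displacement pair, jointly measurable in
  z and the random element, and one over \<open>P2 z\<close>.\<close>

lemma nn_integral_pair_palm_measurable: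
  assumes f[measurable]: "(\<lambda>(z, p). f z p) \<in> borel_measurable (borel \<Otimes>\<^sub>M (borel \<Otimes>\<^sub>M borel))"
  shows "(\<lambda>z. \<integral>\<^sup>+p. f z p \<partial>pair_palm z) \<in> borel_measurable borel"
proof -
  have fz: "f z \<in> borel_measurable (borel \<Otimes>\<^sub>M borel)" for z
    using measurable_compose[OF measurable_Pair1'[of z borel] f] by simp
  have k: "(\<lambda>q. L (\<theta> (fst q) (snd q)) \<Otimes>\<^sub>M L (snd q)) \<in> borel \<Otimes>\<^sub>M M \<rightarrow>\<^sub>M subprob_algebra (borel \<Otimes>\<^sub>M borel)"
    by (rule measurable_pair_measure) measurable
  have "(\<lambda>q. ((fst (fst q)), snd q)) \<in> (borel \<Otimes>\<^sub>M M) \<Otimes>\<^sub>M (borel \<Otimes>\<^sub>M borel) \<rightarrow>\<^sub>M borel \<Otimes>\<^sub>M (borel \<Otimes>\<^sub>M borel)"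
    by measurable
  from measurable_compose[OF this f]
  have "(\<lambda>(q, p). f (fst q) p) \<in> borel_measurable ((borel \<Otimes>\<^sub>M M) \<Otimes>\<^sub>M (borel \<Otimes>\<^sub>M borel))"
    by (simp add: case_prod_beta')
  from nn_integral_measurable_subprob_algebra2[OF this k]
  have "(\<lambda>(z, \<omega>). \<integral>\<^sup>+p. f z p \<partial>(L (\<theta> z \<omega>) \<Otimes>\<^sub>M L \<omega>)) \<in> borel_measurable (borel \<Otimes>\<^sub>M M)"
    by (simp add: case_prod_beta')
  from nn_integral_measurable_subprob_algebra2[OF this measurable_prob_algebraD[OF P2_measurable]]
  show ?thesis unfolding nn_integral_pair_palm[OF fz] .
qed

text \<open>Points x and x + z are sent to x + v and x + z + u, with v drawn from
  \<open>L \<omega>\<close> and u from \<open>L (\<theta> z \<omega>)\<close>, independently given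
  the environment. The two-point formula applies to the product of the hitting masses, and
  integrating the position x leaves the overlap at z + u - v.\<close>

lemma second_moment_K\<Phi>:
  assumes B[measurable]: "B \<in> sets borel" and bB: "bounded B"
  shows "(\<integral>\<^sup>+\<omega>. (emeasure (K\<Phi> \<omega>) B)\<^sup>2 \<partial>M)
    = (\<integral>\<^sup>+z. \<integral>\<^sup>+p. ennreal (overlap B (z + (fst p - snd p))) \<partial>pair_palm z \<partial>\<alpha>)"
proof -
  interpret \<alpha>': sigma_finite_measure \<alpha> by (rule sigma_finite_\<alpha>)
  interpret Q: pair_sigma_finite "lborel :: 'a measure" \<alpha> ..
  let ?f = "\<lambda>x z \<omega>. hit B x \<omega> * hit B (x + z) (\<theta> z \<omega>)"
  have fm: "(\<lambda>(x, z, \<omega>). ?f x z \<omega>) \<in> borel_measurable (borel \<Otimes>\<^sub>M borel \<Otimes>\<^sub>M M)"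
    unfolding case_prod_beta' by (intro borel_measurable_times_ennreal hit_measurable'[OF B]; measurable)
  have "(\<integral>\<^sup>+\<omega>. (emeasure (K\<Phi> \<omega>) B)\<^sup>2 \<partial>M) = (\<integral>\<^sup>+\<omega>. \<integral>\<^sup>+x. \<integral>\<^sup>+y. ?f x (y - x) (\<theta> x \<omega>) \<partial>\<Phi> \<omega> \<partial>\<Phi> \<omega> \<partial>M)"
  proof (rule nn_integral_cong)
    fix \<omega> assume w[measurable]: "\<omega> \<in> space M"
    note [measurable_cong] = \<Phi>_sets[OF w]
    have m: "(\<lambda>x. hit B x (\<theta> x \<omega>)) \<in> borel_measurable (\<Phi> \<omega>)"
      by (rule hit_measurable'[OF B]) measurable
    have "(\<integral>\<^sup>+x. \<integral>\<^sup>+y. ?f x (y - x) (\<theta> x \<omega>) \<partial>\<Phi> \<omega> \<partial>\<Phi> \<omega>) = (\<integral>\<^sup>+x. \<integral>\<^sup>+y. hit B x (\<theta> x \<omega>) * hit B y (\<theta> y \<omega>) \<partial>\<Phi> \<omega> \<partial>\<Phi> \<omega>)"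
      using w by (simp add: flow_add)
    also have "\<dots> = (emeasure (K\<Phi> \<omega>) B)\<^sup>2"
      using m by (simp add: nn_integral_cmult nn_integral_multc emeasure_K\<Phi>[OF w B] power2_eq_square)
    finally show "(emeasure (K\<Phi> \<omega>) B)\<^sup>2 = (\<integral>\<^sup>+x. \<integral>\<^sup>+y. ?f x (y - x) (\<theta> x \<omega>) \<partial>\<Phi> \<omega> \<partial>\<Phi> \<omega>)" ..
  qed
  also have "\<dots> = (\<integral>\<^sup>+x. \<integral>\<^sup>+z. \<integral>\<^sup>+\<omega>. ?f x z \<omega> \<partial>P2 z \<partial>\<alpha> \<partial>lborel)"
    by (rule two_point[OF fm])
  also have "\<dots> = (\<integral>\<^sup>+z. \<integral>\<^sup>+x. \<integral>\<^sup>+\<omega>. ?f x z \<omega> \<partial>P2 z \<partial>lborel \<partial>\<alpha>)"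
  proof (rule Q.Fubini'[symmetric])
    have k: "(\<lambda>q. P2 (snd q)) \<in> borel \<Otimes>\<^sub>M borel \<rightarrow>\<^sub>M subprob_algebra M"
      by (rule measurable_compose[OF measurable_snd measurable_prob_algebraD[OF P2_measurable]])
    have "(\<lambda>q. (fst (fst q), snd (fst q), snd q)) \<in> (borel \<Otimes>\<^sub>M borel) \<Otimes>\<^sub>M M \<rightarrow>\<^sub>M borel \<Otimes>\<^sub>M borel \<Otimes>\<^sub>M M"
      by measurable
    from measurable_compose[OF this fm]
    have "(\<lambda>(q, \<omega>). ?f (fst q) (snd q) \<omega>) \<in> borel_measurable ((borel \<Otimes>\<^sub>M borel) \<Otimes>\<^sub>M M)"
      by (simp add: case_prod_beta')
    from nn_integral_measurable_subprob_algebra2[OF this k]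
    have "(\<lambda>(x, z). \<integral>\<^sup>+\<omega>. ?f x z \<omega> \<partial>P2 z) \<in> borel_measurable (borel \<Otimes>\<^sub>M borel)"
      by (simp add: case_prod_beta')
    then show "(\<lambda>(x, z). \<integral>\<^sup>+\<omega>. ?f x z \<omega> \<partial>P2 z) \<in> borel_measurable (lborel \<Otimes>\<^sub>M \<alpha>)"
      by (simp cong: measurable_cong_sets sets_pair_measure_cong)
  qed
  also have "\<dots> = (\<integral>\<^sup>+z. \<integral>\<^sup>+p. ennreal (overlap B (z + (fst p - snd p))) \<partial>pair_palm z \<partial>\<alpha>)"
  proof (rule nn_integral_cong)
    fix z
    interpret P2: prob_space "P2 z" by (rule P2_prob)
    interpret P: pair_sigma_finite "lborel :: 'a measure" "P2 z" ..
    have "(\<integral>\<^sup>+x. \<integral>\<^sup>+\<omega>. ?f x z \<omega> \<partial>P2 z \<partial>lborel) = (\<integral>\<^sup>+\<omega>. \<integral>\<^sup>+x. ?f x z \<omega> \<partial>lborel \<partial>P2 z)"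
      by (rule P.Fubini'[symmetric])
        (unfold case_prod_beta', intro borel_measurable_times_ennreal hit_measurable'[OF B]; measurable)
    also have "\<dots> = (\<integral>\<^sup>+\<omega>. \<integral>\<^sup>+p. ennreal (overlap B (z + (fst p - snd p))) \<partial>(L (\<theta> z \<omega>) \<Otimes>\<^sub>M L \<omega>) \<partial>P2 z)"
    proof (rule nn_integral_cong)
      fix \<omega> assume "\<omega> \<in> space (P2 z)"
      then have w: "\<omega> \<in> space M" using sets_eq_imp_space_eq[OF P2_sets[of z]] by simp
      then have w': "\<theta> z \<omega> \<in> space M" by simp
      note [measurable_cong] = L_sets[OF w] L_sets[OF w']
      interpret L1: prob_space "L (\<theta> z \<omega>)" by (rule L_prob[OF w'])
      interpret L2: prob_space "L \<omega>" by (rule L_prob[OF w])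
      interpret LL: pair_prob_space "L (\<theta> z \<omega>)" "L \<omega>" ..
      interpret R: pair_sigma_finite "lborel :: 'a measure" "L (\<theta> z \<omega>) \<Otimes>\<^sub>M L \<omega>" ..
      have "?f x z \<omega> = (\<integral>\<^sup>+p. indicator B (x + snd p) * indicator B (x + z + fst p) \<partial>(L (\<theta> z \<omega>) \<Otimes>\<^sub>M L \<omega>))" for x
      proof -
        have "(\<integral>\<^sup>+p. indicator B (x + snd p) * indicator B (x + z + fst p) \<partial>(L (\<theta> z \<omega>) \<Otimes>\<^sub>M L \<omega>))
          = (\<integral>\<^sup>+u. \<integral>\<^sup>+v. indicator B (x + v) * indicator B (x + z + u) \<partial>L \<omega> \<partial>L (\<theta> z \<omega>))"
          by (subst L2.nn_integral_fst[symmetric]) auto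
        also have "\<dots> = (\<integral>\<^sup>+u. hit B x \<omega> * indicator B (x + z + u) \<partial>L (\<theta> z \<omega>))"
          unfolding hit_def by (intro nn_integral_cong nn_integral_multc) measurable
        also have "\<dots> = ?f x z \<omega>"
          unfolding hit_def by (rule nn_integral_cmult) measurable
        finally show ?thesis ..
      qed
      then have "(\<integral>\<^sup>+x. ?f x z \<omega> \<partial>lborel)
        = (\<integral>\<^sup>+x. \<integral>\<^sup>+p. indicator B (x + snd p) * indicator B (x + z + fst p) \<partial>(L (\<theta> z \<omega>) \<Otimes>\<^sub>M L \<omega>) \<partial>lborel)"
        by simp
      also have "\<dots> = (\<integral>\<^sup>+p. \<integral>\<^sup>+x. indicator B (x + snd p) * indicator B (x + z + fst p) \<partial>lborel \<partial>(L (\<theta> z \<omega>) \<Otimes>\<^sub>M L \<omega>))"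
        by (rule R.Fubini'[symmetric]) measurable
      \<comment> \<open>Translating x by the displacement of the first point leaves only the
        difference of the two displacements.\<close>
      also have "\<dots> = (\<integral>\<^sup>+p. ennreal (overlap B (z + (fst p - snd p))) \<partial>(L (\<theta> z \<omega>) \<Otimes>\<^sub>M L \<omega>))"
      proof (rule nn_integral_cong)
        fix p :: "'a \<times> 'a"
        have "(\<integral>\<^sup>+x. indicator B (snd p + x) * indicator B (snd p + x + (z + (fst p - snd p))) \<partial>lborel)
          = (\<integral>\<^sup>+x. indicator B x * indicator B (x + (z + (fst p - snd p))) \<partial>lborel)"
          by (rule nn_integral_lborel_translate) measurable
        then show "(\<integral>\<^sup>+x. indicator B (x + snd p) * indicator B (x + z + fst p) \<partial>lborel) = ennreal (overlap B (z + (fst p - snd p)))"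
          unfolding overlap_nn[OF B bB] by (simp add: algebra_simps)
      qed
      finally show "(\<integral>\<^sup>+x. ?f x z \<omega> \<partial>lborel) = (\<integral>\<^sup>+p. ennreal (overlap B (z + (fst p - snd p))) \<partial>(L (\<theta> z \<omega>) \<Otimes>\<^sub>M L \<omega>))" .
    qed
    also have "\<dots> = (\<integral>\<^sup>+p. ennreal (overlap B (z + (fst p - snd p))) \<partial>pair_palm z)"
      by (rule nn_integral_pair_palm[symmetric]) measurable
    finally show "(\<integral>\<^sup>+x. \<integral>\<^sup>+\<omega>. ?f x z \<omega> \<partial>P2 z \<partial>lborel) = (\<integral>\<^sup>+p. ennreal (overlap B (z + (fst p - snd p))) \<partial>pair_palm z)" .
  qed
  finally show ?thesis .
qed

end

section \<open>Replacing the two-point law by the product law\<close>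

lemma abs_integral_le_1:
  assumes "prob_space \<mu>" and "f \<in> borel_measurable \<mu>" and "\<And>z. f z \<in> {-1..1::real}"
  shows "\<bar>\<integral>z. f z \<partial>\<mu>\<bar> \<le> 1"
proof -
  interpret prob_space \<mu> by fact
  have f: "\<bar>f z\<bar> \<le> 1" for z using assms(3)[of z] by auto
  have "integrable \<mu> f" by (rule integrable_const_bound[where B = 1]) (use f assms(2) in auto)
  then have "(\<integral>z. \<bar>f z\<bar> \<partial>\<mu>) \<le> (\<integral>z. 1 \<partial>\<mu>)"
    by (intro integral_mono) (use f in auto)
  also have "\<dots> = 1" by (simp add: prob_space)
  finally show ?thesis using integral_abs_bound[of \<mu> f] by linarith
qed

text \<open>The real-valued \<open>SUP\<close> can be compared with its members only for a set
  bounded above; here each integral is at most 1 in modulus, which gives the bound 2.\<close>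

lemma diff_norm_upper:
  assumes \<mu>: "prob_space \<mu>" and \<nu>: "prob_space \<nu>" and s: "sets \<nu> = sets \<mu>"
    and f: "f \<in> borel_measurable \<mu>" "\<And>z. f z \<in> {-1..1::real}"
  shows "\<bar>(\<integral>z. f z \<partial>\<mu>) - (\<integral>z. f z \<partial>\<nu>)\<bar> \<le> diff_norm \<mu> \<nu>"
  unfolding diff_norm_def
proof (rule cSUP_upper)
  show "f \<in> {f \<in> borel_measurable \<mu>. \<forall>z. f z \<in> {-1..1::real}}" using f by simp
  show "bdd_above ((\<lambda>f. \<bar>(\<integral>z. f z \<partial>\<mu>) - (\<integral>z. f z \<partial>\<nu>)\<bar>) ` {f \<in> borel_measurable \<mu>. \<forall>z. f z \<in> {-1..1::real}})"
    unfolding bdd_above_def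
  proof (intro exI[of _ "2::real"] ballI)
    fix y assume "y \<in> (\<lambda>f. \<bar>(\<integral>z. f z \<partial>\<mu>) - (\<integral>z. f z \<partial>\<nu>)\<bar>) ` {f \<in> borel_measurable \<mu>. \<forall>z. f z \<in> {-1..1::real}}"
    then obtain h where h: "h \<in> borel_measurable \<mu>" "\<And>z. h z \<in> {-1..1::real}"
      and y: "y = \<bar>(\<integral>z. h z \<partial>\<mu>) - (\<integral>z. h z \<partial>\<nu>)\<bar>" by blast
    have h\<nu>: "h \<in> borel_measurable \<nu>" using h(1) by (simp cong: measurable_cong_sets add: s)
    show "y \<le> 2"
      unfolding y using abs_integral_le_1[OF \<mu> h] abs_integral_le_1[OF \<nu> h\<nu> h(2)] by linarith
  qed
qed

context kernel_setting
begin

text \<open>Only the total mass is evaluated, but \<open>measure_of\<close> agrees with the given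
  set function only once countable additivity has been shown.\<close>

lemma palm_measure_prob: "prob_space (palm_measure M \<theta> \<Phi>)"
  and palm_measure_sets: "sets (palm_measure M \<theta> \<Phi>) = sets M"
proof -
  let ?e = "\<lambda>A. \<integral>\<^sup>+\<omega>. \<integral>\<^sup>+x. indicator (cbox 0 One) x * indicator A (\<theta> x \<omega>) \<partial>\<Phi> \<omega> \<partial>M"
  let ?\<mu> = "\<lambda>A. ?e A / intensity M \<Phi>"
  have sp: "sets M \<subseteq> Pow (space M)" using sets.sets_into_space by blast
  show s: "sets (palm_measure M \<theta> \<Phi>) = sets M"
    unfolding palm_measure_def using sets.sigma_sets_eq[of M] sp by simp
  have spp: "space (palm_measure M \<theta> \<Phi>) = space M"
    unfolding palm_measure_def using sp by simp
  have "emeasure (palm_measure M \<theta> \<Phi>) (space M) = ?\<mu> (space M)"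
  proof (rule emeasure_measure_of[OF palm_measure_def sp])
    show "positive (sets (palm_measure M \<theta> \<Phi>)) ?\<mu>" by (simp add: positive_def)
    show "countably_additive (sets (palm_measure M \<theta> \<Phi>)) ?\<mu>"
    proof (rule countably_additiveI)
      fix F :: "nat \<Rightarrow> 'w set" assume F: "range F \<subseteq> sets (palm_measure M \<theta> \<Phi>)" "disjoint_family F"
      then have Fm[measurable]: "F i \<in> sets M" for i using s by auto
      have m: "(\<lambda>(\<omega>, x). indicator (cbox 0 One) x * indicator (F i) (\<theta> x \<omega>) :: ennreal) \<in> borel_measurable (M \<Otimes>\<^sub>M borel)" for i
        by measurable
      have "(\<Sum>i. ?e (F i)) = (\<integral>\<^sup>+\<omega>. (\<Sum>i. \<integral>\<^sup>+x. indicator (cbox 0 One) x * indicator (F i) (\<theta> x \<omega>) \<partial>\<Phi> \<omega>) \<partial>M)"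
        by (rule nn_integral_suminf[symmetric]) (rule nn_integral_random_measure_measurable[OF rm m])
      also have "\<dots> = ?e (\<Union> (range F))"
      proof (rule nn_integral_cong)
        fix \<omega> assume w[measurable]: "\<omega> \<in> space M"
        note [measurable_cong] = \<Phi>_sets[OF w]
        have "(\<lambda>x. indicator (F i) (\<theta> x \<omega>) :: ennreal) \<in> borel_measurable (\<Phi> \<omega>)" for i by measurable
        moreover have "(indicator (cbox 0 One) :: _ \<Rightarrow> ennreal) \<in> borel_measurable (\<Phi> \<omega>)" by measurable
        ultimately have "(\<Sum>i. \<integral>\<^sup>+x. indicator (cbox 0 One) x * indicator (F i) (\<theta> x \<omega>) \<partial>\<Phi> \<omega>)
          = (\<integral>\<^sup>+x. (\<Sum>i. indicator (cbox 0 One) x * indicator (F i) (\<theta> x \<omega>)) \<partial>\<Phi> \<omega>)"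
          by (intro nn_integral_suminf[symmetric]) measurable
        also have "\<dots> = (\<integral>\<^sup>+x. indicator (cbox 0 One) x * indicator (\<Union> (range F)) (\<theta> x \<omega>) \<partial>\<Phi> \<omega>)"
          by (simp add: suminf_indicator[OF F(2)])
        finally show "(\<Sum>i. \<integral>\<^sup>+x. indicator (cbox 0 One) x * indicator (F i) (\<theta> x \<omega>) \<partial>\<Phi> \<omega>)
          = (\<integral>\<^sup>+x. indicator (cbox 0 One) x * indicator (\<Union> (range F)) (\<theta> x \<omega>) \<partial>\<Phi> \<omega>)" .
      qed
      finally show "(\<Sum>i. ?\<mu> (F i)) = ?\<mu> (\<Union> (range F))" by simp
    qed
    show "space M \<in> sets (palm_measure M \<theta> \<Phi>)" by (simp add: s)
  qed
  also have "?e (space M) = intensity M \<Phi>"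
  proof -
    have "?e (space M) = (\<integral>\<^sup>+\<omega>. emeasure (\<Phi> \<omega>) (cbox 0 One) \<partial>M)"
    proof (rule nn_integral_cong)
      fix \<omega> assume w: "\<omega> \<in> space M"
      have "(\<integral>\<^sup>+x. indicator (cbox 0 One) x * indicator (space M) (\<theta> x \<omega>) \<partial>\<Phi> \<omega>) = (\<integral>\<^sup>+x. indicator (cbox 0 One) x \<partial>\<Phi> \<omega>)"
        using w by simp
      also have "\<dots> = emeasure (\<Phi> \<omega>) (cbox 0 One)" by (rule nn_integral_indicator) (simp add: \<Phi>_sets[OF w])
      finally show "(\<integral>\<^sup>+x. indicator (cbox 0 One) x * indicator (space M) (\<theta> x \<omega>) \<partial>\<Phi> \<omega>) = emeasure (\<Phi> \<omega>) (cbox 0 One)" .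
    qed
    then show ?thesis by (simp add: intensity_def)
  qed
  also have "intensity M \<Phi> / intensity M \<Phi> = 1"
    using intensity_pos intensity_finite by (intro ennreal_divide_self) auto
  finally show "prob_space (palm_measure M \<theta> \<Phi>)" by (intro prob_spaceI) (simp add: spp)
qed

definition Q :: "'a measure" where "Q = palm_measure M \<theta> \<Phi> \<bind> (\<lambda>\<omega>. Kstar K \<omega> 0)"

lemma Q_prob: "prob_space Q" and Q_sets[measurable_cong]: "sets Q = sets borel"
proof -
  have sp: "space (palm_measure M \<theta> \<Phi>) = space M" by (rule sets_eq_imp_space_eq[OF palm_measure_sets])
  have eq: "Q = palm_measure M \<theta> \<Phi> \<bind> L"
    unfolding Q_def by (rule bind_cong[OF refl]) (simp add: sp Kstar_eq flow_0)
  have P: "palm_measure M \<theta> \<Phi> \<in> space (prob_algebra M)"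
    by (simp add: space_prob_algebra palm_measure_prob palm_measure_sets)
  show "prob_space Q" unfolding eq by (rule prob_space_bind'[OF P L_measurable])
  show "sets Q = sets borel" unfolding eq by (rule sets_bind'[OF P L_measurable])
qed

lemma QQ_prob: "prob_space (Q \<Otimes>\<^sub>M Q)"
proof -
  interpret Q: prob_space Q by (rule Q_prob)
  interpret QQ: pair_prob_space Q Q ..
  show ?thesis by (rule QQ.P.prob_space_axioms)
qed

definition R :: "'a measure" where "R = distr (Q \<Otimes>\<^sub>M Q) borel (\<lambda>p. fst p - snd p)"

lemma QQ_diff_measurable: "(\<lambda>p. fst p - snd p) \<in> Q \<Otimes>\<^sub>M Q \<rightarrow>\<^sub>M borel"
  by measurable

lemma R_prob: "prob_space R"
  unfolding R_def by (rule prob_space.prob_space_distr[OF QQ_prob QQ_diff_measurable])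

lemma R_sets: "sets R = sets borel"
  by (simp add: R_def)

text \<open>The two coordinates of the product law are exchangeable, so u - v and v - u have the
  same distribution.\<close>

lemma R_symmetric: "distr R borel uminus = R"
proof -
  interpret Q: prob_space Q by (rule Q_prob)
  interpret QQ: pair_prob_space Q Q ..
  have u: "uminus \<in> borel \<rightarrow>\<^sub>M (borel :: 'a measure)" by measurable
  have sw: "(\<lambda>(x, y). (y, x)) \<in> Q \<Otimes>\<^sub>M Q \<rightarrow>\<^sub>M Q \<Otimes>\<^sub>M Q" by measurable
  have "distr R borel uminus = distr (Q \<Otimes>\<^sub>M Q) borel (\<lambda>p. snd p - fst p)"
    unfolding R_def distr_distr[OF u QQ_diff_measurable] by (simp add: comp_def)
  also have "\<dots> = distr (distr (Q \<Otimes>\<^sub>M Q) (Q \<Otimes>\<^sub>M Q) (\<lambda>(x, y). (y, x))) borel (\<lambda>p. fst p - snd p)"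
    unfolding distr_distr[OF QQ_diff_measurable sw] by (simp add: comp_def case_prod_beta')
  also have "distr (Q \<Otimes>\<^sub>M Q) (Q \<Otimes>\<^sub>M Q) (\<lambda>(x, y). (y, x)) = Q \<Otimes>\<^sub>M Q"
    by (rule QQ.distr_pair_swap[symmetric])
  finally show ?thesis by (simp only: R_def)
qed

definition kap :: "'a \<Rightarrow> real" where "kap z = kappa M \<theta> \<Phi> P2 K z"

lemma kap_eq: "kap z = diff_norm (pair_palm z) (Q \<Otimes>\<^sub>M Q)"
  unfolding kap_def kappa_def Let_def pair_palm_def Q_def ..

text \<open>
  The normalised difference of the mean overlaps under \<open>pair_palm z\<close> and under the product measure;
  \<open>kap\<close> itself need not be measurable.
\<close>

definition palm_gap :: "'a set \<Rightarrow> 'a \<Rightarrow> real" where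
  "palm_gap B z = ((\<integral>p. overlap B (z + (fst p - snd p)) \<partial>pair_palm z) - (\<integral>w. overlap B (z + w) \<partial>R)) / measure lborel B"

context
  fixes B :: "'a set"
  assumes B[measurable]: "B \<in> sets borel" and bB: "bounded B"
begin

lemma pair_overlap_measurable: "(\<lambda>p. overlap B (z + (fst p - snd p))) \<in> borel_measurable (borel \<Otimes>\<^sub>M borel)"
  by measurable

lemma pair_palm_overlap_measurable: "(\<lambda>p. overlap B (z + (fst p - snd p))) \<in> borel_measurable (pair_palm z)"
  by (simp cong: measurable_cong_sets add: pair_palm_sets pair_overlap_measurable)

lemma pair_palm_overlap_integrable: "integrable (pair_palm z) (\<lambda>p. overlap B (z + (fst p - snd p)))"
proof -
  interpret PP: prob_space "pair_palm z" by (rule pair_palm_prob)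
  show ?thesis
    by (rule PP.integrable_const_bound[where B = "measure lborel B"])
      (auto simp: overlap_nonneg[OF B bB] overlap_le[OF B bB] pair_palm_overlap_measurable)
qed

lemma pair_palm_overlap_nn:
  "(\<integral>\<^sup>+p. ennreal (overlap B (z + (fst p - snd p))) \<partial>pair_palm z) = ennreal (\<integral>p. overlap B (z + (fst p - snd p)) \<partial>pair_palm z)"
  by (rule nn_integral_eq_integral[OF pair_palm_overlap_integrable]) (simp add: overlap_nonneg[OF B bB])

lemma pair_palm_overlap_mean_measurable:
  "(\<lambda>z. \<integral>p. overlap B (z + (fst p - snd p)) \<partial>pair_palm z) \<in> borel_measurable borel"
proof -
  have "(\<lambda>z. \<integral>\<^sup>+p. ennreal (overlap B (z + (fst p - snd p))) \<partial>pair_palm z) \<in> borel_measurable borel"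
    by (rule nn_integral_pair_palm_measurable) measurable
  then have "(\<lambda>z. enn2real (\<integral>\<^sup>+p. ennreal (overlap B (z + (fst p - snd p))) \<partial>pair_palm z)) \<in> borel_measurable borel"
    by measurable
  moreover have "0 \<le> (\<integral>p. overlap B (z + (fst p - snd p)) \<partial>pair_palm z)" for z
    by (intro Bochner_Integration.integral_nonneg overlap_nonneg[OF B bB])
  ultimately show ?thesis unfolding pair_palm_overlap_nn by simp
qed

lemma mean_overlap_R: "(\<integral>w. overlap B (z + w) \<partial>R) = (\<integral>p. overlap B (z + (fst p - snd p)) \<partial>(Q \<Otimes>\<^sub>M Q))"
  unfolding R_def by (subst integral_distr) auto

lemma palm_gap_measurable: "palm_gap B \<in> borel_measurable borel"
  unfolding palm_gap_def[abs_def]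
  using pair_palm_overlap_mean_measurable \<alpha>.mean_overlap_measurable[OF R_prob R_sets B bB] by measurable

lemma pair_palm_overlap_eq:
  "(\<integral>p. overlap B (z + (fst p - snd p)) \<partial>pair_palm z)
    = (\<integral>w. overlap B (z + w) \<partial>R) + measure lborel B * palm_gap B z"
proof (cases "measure lborel B = 0")
  \<comment> \<open>On a null set every overlap vanishes, so the convention x / 0 = 0 inside
    \<open>palm_gap\<close> does no harm.\<close>
  case True
  have "overlap B w = 0" for w using overlap_le[OF B bB, of w] overlap_nonneg[OF B bB, of w] True by simp
  then show ?thesis using True by simp
qed (simp add: palm_gap_def)

text \<open>The overlap divided by the volume of B takes values in [0, 1] and is an admissible test
  function in \<open>diff_norm\<close>. For a null set the zero function is used instead.\<close>

lemma palm_gap_le: "\<bar>palm_gap B z\<bar> \<le> kap z"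
proof (cases "measure lborel B = 0")
  case True
  have "overlap B w = 0" for w using overlap_le[OF B bB, of w] overlap_nonneg[OF B bB, of w] True by simp
  then have "palm_gap B z = (\<integral>p. 0 \<partial>pair_palm z) - (\<integral>p. 0 \<partial>(Q \<Otimes>\<^sub>M Q))" by (simp add: palm_gap_def)
  also have "\<bar>\<dots>\<bar> \<le> kap z"
    unfolding kap_eq by (rule diff_norm_upper[OF pair_palm_prob QQ_prob]) (auto simp: pair_palm_sets Q_sets cong: sets_pair_measure_cong)
  finally show ?thesis .
next
  case False
  then have l: "measure lborel B > 0" by (simp add: zero_less_measure_iff)
  have "palm_gap B z = (\<integral>p. overlap B (z + (fst p - snd p)) / measure lborel B \<partial>pair_palm z)
     - (\<integral>p. overlap B (z + (fst p - snd p)) / measure lborel B \<partial>(Q \<Otimes>\<^sub>M Q))"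
    by (simp add: palm_gap_def mean_overlap_R diff_divide_distrib)
  also have "\<bar>\<dots>\<bar> \<le> kap z"
    unfolding kap_eq
  proof (rule diff_norm_upper[OF pair_palm_prob QQ_prob])
    show "sets (Q \<Otimes>\<^sub>M Q) = sets (pair_palm z)" by (simp add: pair_palm_sets Q_sets cong: sets_pair_measure_cong)
    show "(\<lambda>p. overlap B (z + (fst p - snd p)) / measure lborel B) \<in> borel_measurable (pair_palm z)"
      using pair_palm_overlap_measurable by measurable
    fix p
    have "0 \<le> overlap B (z + (fst p - snd p)) / measure lborel B"
      by (intro divide_nonneg_nonneg overlap_nonneg[OF B bB] measure_nonneg)
    moreover have "overlap B (z + (fst p - snd p)) / measure lborel B \<le> 1"
      using l overlap_le[OF B bB, of "z + (fst p - snd p)"] by simp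
    ultimately show "overlap B (z + (fst p - snd p)) / measure lborel B \<in> {- 1..1}"
      unfolding atLeastAtMost_iff by linarith
  qed
  finally show ?thesis .
qed

end

context
  assumes kap_finite: "(\<integral>\<^sup>+z. ennreal (kap z) \<partial>\<alpha>) < \<infinity>"
begin

lemma palm_gap_integrable:
  assumes B: "B \<in> sets borel" "bounded B"
  shows "integrable \<alpha> (palm_gap B)"
proof (rule integrableI_bounded)
  show "palm_gap B \<in> borel_measurable \<alpha>" using palm_gap_measurable[OF B] by simp
  have "(\<integral>\<^sup>+z. ennreal (norm (palm_gap B z)) \<partial>\<alpha>) \<le> (\<integral>\<^sup>+z. ennreal (kap z) \<partial>\<alpha>)"
    using palm_gap_le[OF B] by (intro nn_integral_mono ennreal_leI) simp
  also note kap_finite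
  finally show "(\<integral>\<^sup>+z. ennreal (norm (palm_gap B z)) \<partial>\<alpha>) < \<infinity>" .
qed

lemma second_moment_K\<Phi>_real:
  assumes B: "B \<in> sets borel" "bounded B"
  shows "(\<integral>\<^sup>+\<omega>. (emeasure (K\<Phi> \<omega>) B)\<^sup>2 \<partial>M)
    = ennreal ((\<integral>z. (\<integral>w. overlap B (z + w) \<partial>R) \<partial>\<alpha>) + measure lborel B * (\<integral>z. palm_gap B z \<partial>\<alpha>))"
proof -
  note eq = pair_palm_overlap_eq[OF B]
  note i = \<alpha>.integrable_mean_overlap_\<alpha>[OF R_prob R_sets B]
  have "(\<integral>\<^sup>+\<omega>. (emeasure (K\<Phi> \<omega>) B)\<^sup>2 \<partial>M) = (\<integral>\<^sup>+z. ennreal (\<integral>p. overlap B (z + (fst p - snd p)) \<partial>pair_palm z) \<partial>\<alpha>)"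
    unfolding second_moment_K\<Phi>[OF B] pair_palm_overlap_nn[OF B] ..
  also have "\<dots> = ennreal (\<integral>z. (\<integral>p. overlap B (z + (fst p - snd p)) \<partial>pair_palm z) \<partial>\<alpha>)"
  proof (rule nn_integral_eq_integral)
    show "integrable \<alpha> (\<lambda>z. \<integral>p. overlap B (z + (fst p - snd p)) \<partial>pair_palm z)"
      unfolding eq by (intro Bochner_Integration.integrable_add integrable_mult_right i palm_gap_integrable[OF B])
    show "AE z in \<alpha>. 0 \<le> (\<integral>p. overlap B (z + (fst p - snd p)) \<partial>pair_palm z)"
      by (intro AE_I2 Bochner_Integration.integral_nonneg overlap_nonneg[OF B])
  qed
  also have "(\<integral>z. (\<integral>p. overlap B (z + (fst p - snd p)) \<partial>pair_palm z) \<partial>\<alpha>)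
     = (\<integral>z. (\<integral>w. overlap B (z + w) \<partial>R) \<partial>\<alpha>) + measure lborel B * (\<integral>z. palm_gap B z \<partial>\<alpha>)"
    unfolding eq
    by (subst Bochner_Integration.integral_add[OF i integrable_mult_right[OF palm_gap_integrable[OF B]]]) simp
  finally show ?thesis .
qed

lemma K\<Phi>_square_finite:
  assumes B: "B \<in> sets borel" "bounded B"
  shows "(\<integral>\<^sup>+\<omega>. (emeasure (K\<Phi> \<omega>) B)\<^sup>2 \<partial>M) < \<infinity>"
  by (simp add: second_moment_K\<Phi>_real[OF B])

text \<open>The transport preserves the intensity, so the same squared mean is subtracted as in
  \<open>cov R B\<close>. What remains is the volume times a gap integral, which vanishes in the
  limit.\<close>

lemma variance_K\<Phi>:
  assumes B: "B \<in> sets borel" "bounded B"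
  shows "variance (\<lambda>\<omega>. measure (K\<Phi> \<omega>) B) = \<alpha>.cov R B + measure lborel B * (\<integral>z. palm_gap B z \<partial>\<alpha>)"
proof -
  let ?s = "(\<integral>z. (\<integral>w. overlap B (z + w) \<partial>R) \<partial>\<alpha>) + measure lborel B * (\<integral>z. palm_gap B z \<partial>\<alpha>)"
  note eq = pair_palm_overlap_eq[OF B]
  have "?s = (\<integral>z. (\<integral>p. overlap B (z + (fst p - snd p)) \<partial>pair_palm z) \<partial>\<alpha>)"
    unfolding eq
    by (subst Bochner_Integration.integral_add[OF \<alpha>.integrable_mean_overlap_\<alpha>[OF R_prob R_sets B] integrable_mult_right[OF palm_gap_integrable[OF B]]]) simp
  also have "\<dots> \<ge> 0" by (intro Bochner_Integration.integral_nonneg overlap_nonneg[OF B])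
  finally have s0: "0 \<le> ?s" .
  have "enn2real (\<integral>\<^sup>+\<omega>. emeasure (K\<Phi> \<omega>) B \<partial>M) = \<gamma> * measure lborel B"
    using B \<gamma>(2) by (simp add: mean_K\<Phi> enn2real_mult measure_def)
  then have "variance (\<lambda>\<omega>. measure (K\<Phi> \<omega>) B) = ?s - (\<gamma> * measure lborel B)\<^sup>2"
    using variance_enn2real[OF emeasure_K\<Phi>_measurable[OF B(1)] K\<Phi>_square_finite[OF B]] s0
    by (simp add: measure_def[of "K\<Phi> _"] second_moment_K\<Phi>_real[OF B])
  then show ?thesis by (simp add: \<alpha>.cov_def power_mult_distrib)
qed

lemma K\<Phi>_lsi: "locally_square_integrable M K\<Phi>"
  unfolding locally_square_integrable_def using K\<Phi>_square_finite by blast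

text \<open>Both normalised means tend to 1 for fixed z. The dominating function is H, the supremum
  of the gaps along the sequence: measurable as a countable supremum, and integrable because it lies
  below \<open>kap\<close>.\<close>

lemma palm_gap_tendsto:
  assumes W: "W \<in> sets borel" "bounded W" "convex W" "measure lborel W > 0"
    and r: "\<And>n. 0 < r n" "filterlim r at_top sequentially"
  shows "(\<lambda>n. \<integral>z. palm_gap ((\<lambda>x. r n *\<^sub>R x) ` W) z \<partial>\<alpha>) \<longlonglongrightarrow> 0"
proof -
  let ?B = "\<lambda>n. (\<lambda>x. r n *\<^sub>R x) ` W"
  have B: "?B n \<in> sets borel" and bB: "bounded (?B n)" for n
    by (rule scaleR_image_sets[OF W(1) r(1)], rule bounded_scaling[OF W(2)])
  note gm = palm_gap_measurable[OF B bB]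
  define H where "H z = (SUP n. ennreal \<bar>palm_gap (?B n) z\<bar>)" for z
  have Hm[measurable]: "H \<in> borel_measurable borel"
    unfolding H_def[abs_def] using gm by measurable
  have Hle: "H z \<le> ennreal (kap z)" for z
    unfolding H_def by (intro SUP_least ennreal_leI palm_gap_le[OF B bB])
  then have Hf: "H z < \<top>" for z by (rule le_less_trans) simp
  have gH: "\<bar>palm_gap (?B n) z\<bar> \<le> enn2real (H z)" for n z
  proof -
    have "ennreal \<bar>palm_gap (?B n) z\<bar> \<le> H z" unfolding H_def by (rule SUP_upper) simp
    also have "H z = ennreal (enn2real (H z))" using Hf[of z] by simp
    finally show ?thesis by (subst (asm) ennreal_le_iff) auto
  qed
  have iH: "integrable \<alpha> (\<lambda>z. enn2real (H z))"
  proof (rule integrableI_nonneg)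
    have "(\<integral>\<^sup>+z. ennreal (enn2real (H z)) \<partial>\<alpha>) \<le> (\<integral>\<^sup>+z. ennreal (kap z) \<partial>\<alpha>)"
      using Hle Hf by (intro nn_integral_mono) simp
    also note kap_finite
    finally show "(\<integral>\<^sup>+z. ennreal (enn2real (H z)) \<partial>\<alpha>) < \<infinity>" .
  qed auto
  have "(\<lambda>n. \<integral>z. palm_gap (?B n) z \<partial>\<alpha>) \<longlonglongrightarrow> (\<integral>z. 0 \<partial>\<alpha>)"
  proof (rule integral_dominated_convergence[OF _ _ iH])
    show "AE z in \<alpha>. (\<lambda>n. palm_gap (?B n) z) \<longlonglongrightarrow> 0"
    proof (rule AE_I2)
      fix z
      have m1: "(\<lambda>p. z + (fst p - snd p)) \<in> borel_measurable (pair_palm z)"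
        by (simp cong: measurable_cong_sets add: pair_palm_sets)
      have m2: "(\<lambda>w. z + w) \<in> borel_measurable R"
        by (simp cong: measurable_cong_sets add: R_sets)
      have "(\<lambda>n. (\<integral>p. overlap (?B n) (z + (fst p - snd p)) \<partial>pair_palm z) / measure lborel (?B n)
          - (\<integral>w. overlap (?B n) (z + w) \<partial>R) / measure lborel (?B n)) \<longlonglongrightarrow> 1 - 1"
        by (intro tendsto_diff normalized_mean_overlap_tendsto[OF W r pair_palm_prob m1]
          normalized_mean_overlap_tendsto[OF W r R_prob m2])
      then show "(\<lambda>n. palm_gap (?B n) z) \<longlonglongrightarrow> 0" by (simp add: palm_gap_def diff_divide_distrib)
    qed
    show "AE z in \<alpha>. norm (palm_gap (?B n) z) \<le> enn2real (H z)" for n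
      using gH by (intro AE_I2) simp
    show "(\<lambda>z. palm_gap (?B n) z) \<in> borel_measurable \<alpha>" for n using gm[of n] by simp
  qed simp
  then show ?thesis by simp
qed

end

end

section \<open>Comparison of the asymptotic variances\<close>

text \<open>The scaling results need every member of the sequence to be positive. Replacing r by max
  1 r ensures this without changing the limit.\<close>

lemma tendsto_at_top_positiveI:
  fixes f :: "real \<Rightarrow> real"
  assumes "\<And>X. (\<And>n. 0 < X n) \<Longrightarrow> filterlim X at_top sequentially \<Longrightarrow> (\<lambda>n. f (X n)) \<longlonglongrightarrow> y"
  shows "(f \<longlongrightarrow> y) at_top"
proof -
  have "((\<lambda>r. f (max 1 r)) \<longlongrightarrow> y) at_top"
  proof (rule tendsto_at_topI_sequentially)
    fix X :: "nat \<Rightarrow> real" assume X: "filterlim X at_top sequentially"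
    show "(\<lambda>n. f (max 1 (X n))) \<longlonglongrightarrow> y"
    proof (rule assms)
      show "filterlim (\<lambda>n. max 1 (X n)) at_top sequentially"
        by (rule filterlim_at_top_mono[OF X]) simp
    qed simp
  qed
  also have "?this \<longleftrightarrow> (f \<longlongrightarrow> y) at_top"
    by (intro tendsto_cong) (rule eventually_mono[OF eventually_ge_at_top[of 1]], simp add: max_def)
  finally show ?thesis .
qed

text \<open>The relative error d * a is harmless once a is bounded, since d is arbitrary. A finite
  limit of a bounds a directly; a finite limit of k does so through the choice d = 1/2. For limit
  infinity the two one-sided estimates suffice, and minus infinity is excluded by
  nonnegativity.\<close>

lemma ereal_tendsto_comparison:
  fixes a k :: "'b \<Rightarrow> real"
  assumes F: "F \<noteq> bot" and pos: "\<forall>\<^sub>F x in F. 0 \<le> a x" "\<forall>\<^sub>F x in F. 0 \<le> k x"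
    and up: "\<forall>\<^sub>F x in F. k x \<le> a x + e' x" "(e' \<longlongrightarrow> 0) F"
    and lo: "\<And>d. 0 < d \<Longrightarrow> \<exists>e. (e \<longlongrightarrow> 0) F \<and> (\<forall>\<^sub>F x in F. a x - k x \<le> d * a x + e x)"
  shows "((\<lambda>x. ereal (a x)) \<longlongrightarrow> L) F \<longleftrightarrow> ((\<lambda>x. ereal (k x)) \<longlongrightarrow> L) F"
proof -
  have diff: "((\<lambda>x. a x - k x) \<longlongrightarrow> 0) F" if C: "\<forall>\<^sub>F x in F. a x \<le> C" "0 \<le> C" for C
  proof (rule tendstoI)
    fix \<epsilon> :: real assume eps: "0 < \<epsilon>"
    \<comment> \<open>The relative error is then at most \<epsilon> / 4, which leaves \<epsilon> / 2
      for the error term e.\<close>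
    define d where "d = \<epsilon> / (4 * (C + 1))"
    have d: "0 < d" "d * C \<le> \<epsilon> / 4"
      using eps C(2) by (auto simp: d_def field_simps)
    obtain e where e: "(e \<longlongrightarrow> 0) F" "\<forall>\<^sub>F x in F. a x - k x \<le> d * a x + e x" using lo[OF d(1)] by blast
    have "\<forall>\<^sub>F x in F. dist (e x) 0 < \<epsilon> / 2" "\<forall>\<^sub>F x in F. dist (e' x) 0 < \<epsilon> / 2"
      using tendstoD[OF e(1), of "\<epsilon> / 2"] tendstoD[OF up(2), of "\<epsilon> / 2"] eps by simp_all
    with e(2) up(1) C(1) show "\<forall>\<^sub>F x in F. dist (a x - k x) 0 < \<epsilon>"
    proof eventually_elim
      case (elim x)
      have "d * a x \<le> d * C" using elim d by (intro mult_left_mono) auto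
      then show ?case using elim d(2) eps unfolding dist_real_def by linarith
    qed
  qed
  obtain h where h: "(h \<longlongrightarrow> 0) F" "\<forall>\<^sub>F x in F. a x - k x \<le> (1/2) * a x + h x" using lo[of "1/2"] by auto
  show ?thesis
  proof (cases L)
    case (real l)
    show ?thesis unfolding real lim_ereal
    proof
      assume l: "(a \<longlongrightarrow> l) F"
      have "\<forall>\<^sub>F x in F. a x < \<bar>l\<bar> + 1" by (rule order_tendstoD[OF l]) linarith
      then have "\<forall>\<^sub>F x in F. a x \<le> \<bar>l\<bar> + 1" by eventually_elim simp
      from tendsto_diff[OF l diff[OF this]] show "(k \<longlongrightarrow> l) F" by simp
    next
      assume l: "(k \<longlongrightarrow> l) F"
      \<comment> \<open>Absorbing half of a on the left gives a / 2 \<le> k + h < |l| + 2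
        eventually.\<close>
      have "\<forall>\<^sub>F x in F. k x < \<bar>l\<bar> + 1" "\<forall>\<^sub>F x in F. h x < 1"
        by (rule order_tendstoD[OF l], linarith) (rule order_tendstoD[OF h(1)], simp)
      with h(2) have "\<forall>\<^sub>F x in F. a x \<le> 2 * (\<bar>l\<bar> + 2)" by eventually_elim simp
      from tendsto_add[OF l diff[OF this]] show "(a \<longlongrightarrow> l) F" by simp
    qed
  next
    case PInf
    show ?thesis unfolding PInf tendsto_PInfty_eq_at_top
    proof
      assume l: "filterlim a at_top F"
      have "filterlim (\<lambda>x. (1/2) * a x) at_top F"
        by (rule filterlim_tendsto_pos_mult_at_top[OF tendsto_const _ l]) simp
      from filterlim_tendsto_add_at_top[OF tendsto_minus[OF h(1)] this]
      show "filterlim k at_top F"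
        by (rule filterlim_at_top_mono) (use h(2) in \<open>eventually_elim, simp\<close>)
    next
      assume l: "filterlim k at_top F"
      from filterlim_tendsto_add_at_top[OF tendsto_minus[OF up(2)] l]
      show "filterlim a at_top F"
        by (rule filterlim_at_top_mono) (use up(1) in \<open>eventually_elim, simp\<close>)
    qed
  next
    case MInf
    have "\<not> ((\<lambda>x. ereal (f x)) \<longlongrightarrow> - \<infinity>) F" if f: "\<forall>\<^sub>F x in F. 0 \<le> f x" for f :: "'b \<Rightarrow> real"
    proof
      assume "((\<lambda>x. ereal (f x)) \<longlongrightarrow> - \<infinity>) F"
      then have "\<forall>\<^sub>F x in F. ereal (f x) < ereal 0" unfolding tendsto_MInfty by blast
      with f have "\<forall>\<^sub>F x in F. False" by eventually_elim simp
      then show False using F by (simp add: eventually_False)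
    qed
    then show ?thesis using pos MInf by blast
  qed
qed

section \<open>Normalised variances of scaled windows\<close>

text \<open>The shift inequality averaged over \<open>R\<close>. It is the upper estimate of the
  comparison and requires no regularity of the window.\<close>

lemma (in second_order_measure) cov_le:
  assumes R: "prob_space R" "sets R = sets borel" and B: "B \<in> sets borel" "bounded B"
  shows "cov R B \<le> cov (return borel 0) B"
proof -
  have "(\<integral>z. (\<integral>w. overlap B (z + w) \<partial>R) \<partial>\<alpha>) = enn2real (\<integral>\<^sup>+z. ennreal (\<integral>w. overlap B (z + w) \<partial>R) \<partial>\<alpha>)"
    using borel_measurable_integrable[OF integrable_mean_overlap_\<alpha>[OF R B]] mean_overlap_nonneg[OF R B]
    by (intro integral_eq_nn_integral) auto
  also have "\<dots> \<le> enn2real (\<integral>\<^sup>+z. ennreal (overlap B z) \<partial>\<alpha>)"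
    using nn_integral_mean_overlap_le[OF R B] overlap_\<alpha>_finite[OF B] by (intro enn2real_mono) auto
  also have "\<dots> = (\<integral>z. overlap B z \<partial>\<alpha>)"
    using overlap_measurable[OF B(1)] overlap_nonneg[OF B] by (intro integral_eq_nn_integral[symmetric]) auto
  finally show ?thesis unfolding cov_return_0[OF B(1)] by (simp add: cov_def)
qed

lemma convex_K0_measure_pos:
  assumes W: "W \<in> convex_K0" and B: "(W :: 'a::euclidean_space set) \<in> sets borel"
  shows "0 < measure lborel W"
proof -
  from W obtain e where e: "0 < e" "ball 0 e \<subseteq> W" unfolding convex_K0_def by (auto simp: mem_interior)
  have "measure lborel (ball (0::'a) e) \<le> measure lborel W"
    using W B emeasure_bounded_finite[of W] e(2)
    by (intro measure_mono_fmeasurable) (auto simp: fmeasurable_def convex_K0_def)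
  then show ?thesis using content_ball_pos[OF e(1), of "0::'a"] by linarith
qed

text \<open>A bounded convex set may fail to be Borel, for instance an open disc with a non-Borel
  part of its boundary circle. \<open>measure\<close> is then 0 on all its dilations, and division
  by 0 gives 0.\<close>

lemma normalized_variance_not_borel:
  fixes W :: "'a::euclidean_space set"
  assumes W: "W \<notin> sets borel" and r: "0 < r"
  shows "normalized_variance M \<Psi> W r = 0"
proof -
  have "(\<lambda>x. r *\<^sub>R x) ` W \<notin> sets borel"
  proof
    assume "(\<lambda>x. r *\<^sub>R x) ` W \<in> sets borel"
    then have "(\<lambda>x. (1 / r) *\<^sub>R x) ` (\<lambda>x. r *\<^sub>R x) ` W \<in> sets borel"
      by (rule scaleR_image_sets) (use r in simp)
    moreover have "(\<lambda>x. (1 / r) *\<^sub>R x) ` (\<lambda>x. r *\<^sub>R x) ` W = W" using r by (simp add: image_image)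
    ultimately show False using W by simp
  qed
  then have "measure lborel ((\<lambda>x. r *\<^sub>R x) ` W) = 0" by (intro measure_notin_sets) simp
  then show ?thesis by (simp add: normalized_variance_def)
qed

context kernel_setting
begin

context
  fixes W :: "'a set"
  assumes kap_finite: "(\<integral>\<^sup>+z. ennreal (kap z) \<partial>\<alpha>) < \<infinity>"
    and W: "W \<in> convex_K0" and BW: "W \<in> sets borel"
begin

lemma W_props: "bounded W" "convex W" "0 < measure lborel W"
  using W convex_K0_measure_pos[OF W BW] by (auto simp: convex_K0_def)

abbreviation scaled :: "real \<Rightarrow> 'a set" where "scaled r \<equiv> (\<lambda>x. r *\<^sub>R x) ` W"

lemma scaled: "0 < r \<Longrightarrow> scaled r \<in> sets borel" "0 < r \<Longrightarrow> bounded (scaled r)"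
  by (rule scaleR_image_sets[OF BW], assumption) (rule bounded_scaling[OF W_props(1)])

lemma scaled_measure: "0 < r \<Longrightarrow> 0 < measure lborel (scaled r)"
  using W_props by (simp add: measure_scaleR_image[OF BW])

lemma normalized_variance_\<Phi>:
  "0 < r \<Longrightarrow> normalized_variance M \<Phi> W r = \<alpha>.cov (return borel 0) (scaled r) / measure lborel (scaled r)"
  unfolding normalized_variance_def by (simp only: variance_\<Phi>[OF scaled])

lemma normalized_variance_K\<Phi>:
  assumes r: "0 < r"
  shows "normalized_variance M K\<Phi> W r
    = \<alpha>.cov R (scaled r) / measure lborel (scaled r) + (\<integral>z. palm_gap (scaled r) z \<partial>\<alpha>)"
  using scaled_measure[OF r]
  unfolding normalized_variance_def variance_K\<Phi>[OF kap_finite scaled[OF r]] by (simp add: add_divide_distrib)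

lemma normalized_variance_nonneg: "0 \<le> normalized_variance M \<Psi> W r"
  unfolding normalized_variance_def by (intro divide_nonneg_nonneg variance_positive measure_nonneg)

lemma gap_tendsto: "((\<lambda>r. \<integral>z. palm_gap (scaled r) z \<partial>\<alpha>) \<longlongrightarrow> 0) at_top"
  by (rule tendsto_at_top_positiveI) (rule palm_gap_tendsto[OF kap_finite BW W_props])

lemma normalized_variance_K\<Phi>_le:
  assumes r: "0 < r"
  shows "normalized_variance M K\<Phi> W r \<le> normalized_variance M \<Phi> W r + (\<integral>z. palm_gap (scaled r) z \<partial>\<alpha>)"
  unfolding normalized_variance_K\<Phi>[OF r] normalized_variance_\<Phi>[OF r]
  using \<alpha>.cov_le[OF R_prob R_sets scaled[OF r]] scaled_measure[OF r] by (simp add: divide_right_mono)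

lemma K\<Phi>_variance_tendsto_0:
  assumes "(normalized_variance M \<Phi> W \<longlongrightarrow> 0) at_top"
  shows "(normalized_variance M K\<Phi> W \<longlongrightarrow> 0) at_top"
proof (rule tendsto_sandwich[OF _ _ tendsto_const])
  show "\<forall>\<^sub>F r in at_top. normalized_variance M K\<Phi> W r \<le> normalized_variance M \<Phi> W r + (\<integral>z. palm_gap (scaled r) z \<partial>\<alpha>)"
    using eventually_gt_at_top[of 0] by eventually_elim (rule normalized_variance_K\<Phi>_le)
  show "((\<lambda>r. normalized_variance M \<Phi> W r + (\<integral>z. palm_gap (scaled r) z \<partial>\<alpha>)) \<longlongrightarrow> 0) at_top"
    using tendsto_add[OF assms gap_tendsto] by simp
qed (simp add: normalized_variance_nonneg)

lemma variance_limits: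
  assumes "fourier_smooth W \<or> total_variation (covariance_measure M \<Phi>) < \<infinity>"
  shows "((\<lambda>r. ereal (normalized_variance M \<Phi> W r)) \<longlongrightarrow> l) at_top \<longleftrightarrow>
    ((\<lambda>r. ereal (normalized_variance M K\<Phi> W r)) \<longlongrightarrow> l) at_top"
proof (rule ereal_tendsto_comparison[OF _ _ _ _ gap_tendsto])
  show "\<forall>\<^sub>F r in at_top. normalized_variance M K\<Phi> W r \<le> normalized_variance M \<Phi> W r + (\<integral>z. palm_gap (scaled r) z \<partial>\<alpha>)"
    using eventually_gt_at_top[of 0] by eventually_elim (rule normalized_variance_K\<Phi>_le)
  fix d :: real assume d: "0 < d"
  let ?v = "normalized_variance M \<Phi> W" and ?k = "normalized_variance M K\<Phi> W"
  let ?g = "\<lambda>r. \<integral>z. palm_gap (scaled r) z \<partial>\<alpha>"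
  let ?D = "\<lambda>r. (\<alpha>.cov (return borel 0) (scaled r) - \<alpha>.cov R (scaled r)) / measure lborel (scaled r)"
  have vk: "?v r - ?k r = ?D r - ?g r" if "0 < r" for r
    unfolding normalized_variance_\<Phi>[OF that] normalized_variance_K\<Phi>[OF that] by (simp add: diff_divide_distrib)
  from assms show "\<exists>e. (e \<longlongrightarrow> 0) at_top \<and> (\<forall>\<^sub>F r in at_top. ?v r - ?k r \<le> d * ?v r + e r)"
  proof
    assume "fourier_smooth W"
    then obtain C t where t: "t > 0" and C: "\<And>r. 1 \<le> r \<Longrightarrow>
        \<alpha>.cov (return borel 0) (scaled r) - \<alpha>.cov R (scaled r)
          \<le> d * \<alpha>.cov (return borel 0) (scaled r) + C * r powr (real DIM('a) - t)"
      using \<alpha>.fourier_smooth_cov_estimate[OF R_prob R_sets R_symmetric BW W_props(1,2) _ d] by blast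
    \<comment> \<open>Dividing the absolute error C r^(d - t) by the volume r^d
      \<open>measure lborel W\<close> leaves r^(-t); the gap integral belongs to the transported
      variance and enters with a minus sign.\<close>
    let ?e = "\<lambda>r. C / measure lborel W * r powr (- t) - ?g r"
    have "((\<lambda>r. r powr (- t)) \<longlongrightarrow> 0) at_top"
      using t by (intro tendsto_neg_powr filterlim_ident) auto
    from tendsto_diff[OF tendsto_mult_left[OF this, of "C / measure lborel W"] gap_tendsto]
    have "(?e \<longlongrightarrow> 0) at_top" by simp
    moreover have "\<forall>\<^sub>F r in at_top. ?v r - ?k r \<le> d * ?v r + ?e r"
      using eventually_ge_at_top[of 1]
    proof eventually_elim
      case (elim r)
      then have r: "0 < r" by simp
      have m: "measure lborel (scaled r) = r powr real DIM('a) * measure lborel W"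
        using r by (simp add: measure_scaleR_image[OF BW W_props(1) r] powr_realpow)
      have "?D r \<le> (d * \<alpha>.cov (return borel 0) (scaled r) + C * r powr (real DIM('a) - t)) / measure lborel (scaled r)"
        using C[OF elim] scaled_measure[OF r] by (intro divide_right_mono) auto
      also have "\<dots> = d * ?v r + C * r powr (real DIM('a) - t) / measure lborel (scaled r)"
        unfolding normalized_variance_\<Phi>[OF r] by (simp add: add_divide_distrib)
      also have "C * r powr (real DIM('a) - t) / measure lborel (scaled r) = C / measure lborel W * r powr (- t)"
        unfolding m using r by (simp add: powr_diff powr_minus field_simps)
      finally show ?case using vk[OF r] by linarith
    qed
    ultimately show ?thesis by blast
  next
    assume tv: "total_variation (covariance_measure M \<Phi>) < \<infinity>"
    have "covariance_measure M \<Phi> = (\<lambda>B. measure \<alpha> B - \<gamma>\<^sup>2 * measure lborel B)"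
      unfolding covariance_measure_def \<gamma>_def by (rule ext) simp
    with tv have tv': "total_variation (\<lambda>B. measure \<alpha> B - \<gamma>\<^sup>2 * measure lborel B) < \<infinity>" by simp
    have "(?D \<longlongrightarrow> 0) at_top"
      by (rule tendsto_at_top_positiveI) (rule \<alpha>.total_variation_cov_tendsto[OF tv' R_prob R_sets BW W_props])
    from tendsto_diff[OF this gap_tendsto] have "((\<lambda>r. ?D r - ?g r) \<longlongrightarrow> 0) at_top" by simp
    \<comment> \<open>Here the whole difference tends to 0, and the nonnegative relative term is
      simply added.\<close>
    moreover have "\<forall>\<^sub>F r in at_top. ?v r - ?k r \<le> d * ?v r + (?D r - ?g r)"
      using eventually_gt_at_top[of 0]
    proof eventually_elim
      case (elim r)
      have "0 \<le> d * ?v r" using d normalized_variance_nonneg by simp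
      then show ?case using vk[OF elim] by linarith
    qed
    ultimately show ?thesis by blast
  qed
qed (auto simp: normalized_variance_nonneg)

end

end

theorem theorem3p5:
  fixes M :: "'w measure"
    and \<theta> :: "'a::euclidean_space \<Rightarrow> 'w \<Rightarrow> 'w"
    and \<Phi> :: "'w \<Rightarrow> 'a measure"
    and P2 :: "'a \<Rightarrow> 'w measure"
    and K :: "'w \<Rightarrow> 'a \<Rightarrow> 'a measure"
    and W :: "'a set"
  assumes "prob_space M"
    and "standard_borel M"
    and "measurable_flow M \<theta>"
    and "random_measure M \<Phi>"
    and "invariant_random_measure M \<theta> \<Phi>"
    and "locally_square_integrable M \<Phi>"
    and "0 < intensity M \<Phi>" and "intensity M \<Phi> < \<infinity>"
    and "two_point_palm M \<theta> \<Phi> P2"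
    and "invariant_prob_kernel M \<theta> K"
    and "(\<integral>\<^sup>+ y. ennreal (kappa M \<theta> \<Phi> P2 K y) \<partial>reduced_second_moment M \<Phi>) < \<infinity>"
    and "W \<in> convex_K0"
  shows "(hyperuniform M \<Phi> W \<longrightarrow> hyperuniform M (kernel_transform K \<Phi>) W) \<and>
    (fourier_smooth W \<or> total_variation (covariance_measure M \<Phi>) < \<infinity> \<longrightarrow>
      (\<forall>L::ereal.
        ((\<lambda>r. ereal (normalized_variance M \<Phi> W r)) \<longlongrightarrow> L) at_top \<longleftrightarrow>
        ((\<lambda>r. ereal (normalized_variance M (kernel_transform K \<Phi>) W r)) \<longlongrightarrow> L) at_top))"
proof -
  interpret kernel_setting M \<theta> \<Phi> P2 K
    using assms by (intro kernel_setting.intro palm_setting.intro flow_random_measure.intro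
      flow_random_measure_axioms.intro palm_setting_axioms.intro kernel_setting_axioms.intro)
  have kf: "(\<integral>\<^sup>+z. ennreal (kap z) \<partial>\<alpha>) < \<infinity>"
    using assms(11) by (simp add: kap_def)
  note W = assms(12)
  have pos: "\<forall>\<^sub>F r in at_top. (0::real) < r" by (rule eventually_gt_at_top)
  show ?thesis
  proof (intro conjI impI allI)
    assume h: "hyperuniform M \<Phi> W"
    have "(normalized_variance M K\<Phi> W \<longlongrightarrow> 0) at_top"
    \<comment> \<open>For a window that is not Borel all normalised variances at positive r are 0,
      so the limit is trivial.\<close>
    proof (cases "W \<in> sets borel")
      case True
      with h show ?thesis by (intro K\<Phi>_variance_tendsto_0[OF kf W]) (auto simp: hyperuniform_def)
    next
      case False
      have "\<forall>\<^sub>F r in at_top. normalized_variance M K\<Phi> W r = 0"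
        using pos by eventually_elim (rule normalized_variance_not_borel[OF False])
      then show ?thesis by (rule tendsto_eventually)
    qed
    then show "hyperuniform M K\<Phi> W"
      unfolding hyperuniform_def using K\<Phi>_measurable K\<Phi>_stationary K\<Phi>_lsi[OF kf] by blast
  next
    fix L :: ereal
    assume h: "fourier_smooth W \<or> total_variation (covariance_measure M \<Phi>) < \<infinity>"
    show "((\<lambda>r. ereal (normalized_variance M \<Phi> W r)) \<longlongrightarrow> L) at_top \<longleftrightarrow>
        ((\<lambda>r. ereal (normalized_variance M K\<Phi> W r)) \<longlongrightarrow> L) at_top"
    proof (cases "W \<in> sets borel")
      case True
      then show ?thesis by (rule variance_limits[OF kf W _ h])
    next
      case False
      show ?thesis
        by (rule tendsto_cong, use pos in eventually_elim) (simp add: normalized_variance_not_borel[OF False])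
    qed
  qed
qed

end
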